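(* The proper symmetric 3-sat problem (given a proper symmetric 3-sat formula, decide whether it is satisfiable) is NP-hard (and thus NP-complete).
   Context: Formulas are in propositional variables $x_0,x_1,\dots$. A literal is $x_j$ or $\neg x_j$. A 3-clause is a disjunction of three literals; a 3-sat formula is a conjunction of finitely many 3-clauses. Order literals by $x_0\prec\neg x_0\prec x_1\prec\neg x_1\prec x_2\prec\cdots$. A 3-sat formula is reduced if the literals in each clause appear in weakly increasing order, the clauses appear in lexicographic order, and the clauses are pairwise distinct. It is proper if it is reduced and the 3 variables in every clause are distinct. The mirror of a 3-clause is the 3-clause obtained by replacing each literal by its negation (e.g. the mirror of $x_3\vee x_5\vee\neg x_8$ is $\neg x_3\vee\neg x_5\vee x_8$). A 3-sat formula is symmetric if, for every clause in it, the mirror clause also appears in the formula, the same number of times. *)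

theory Defs
  imports "HOL-Computational_Algebra.Polynomial"
begin

section \<open>3-sat formulas\<close>

datatype literal = Pos (var: nat) | Neg (var: nat)

fun neg_lit :: "literal \<Rightarrow> literal" where
  "neg_lit (Pos j) = Neg j"
| "neg_lit (Neg j) = Pos j"

fun lit_rank :: "literal \<Rightarrow> nat" where
  "lit_rank (Pos j) = 2 * j"
| "lit_rank (Neg j) = 2 * j + 1"

lemma lit_rank_inject: "lit_rank l = lit_rank m \<longleftrightarrow> l = m"
proof (cases l; cases m)
  fix i j assume "l = Pos i" "m = Neg j" then show ?thesis by simp presburger
next
  fix i j assume "l = Neg i" "m = Pos j" then show ?thesis by simp presburger
qed simp_all

text \<open>The order is \<open>Pos 0 < Neg 0 < Pos 1 < Neg 1 < \<dots>\<close>.\<close>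

instantiation literal :: linorder
begin

definition less_eq_literal :: "literal \<Rightarrow> literal \<Rightarrow> bool" where
  "l \<le> m \<longleftrightarrow> lit_rank l \<le> lit_rank m"

definition less_literal :: "literal \<Rightarrow> literal \<Rightarrow> bool" where
  "l < m \<longleftrightarrow> lit_rank l < lit_rank m"

instance
  by standard (auto simp: less_eq_literal_def less_literal_def lit_rank_inject)

end

text \<open>
  Clauses and formulas are syntactic objects: the order of the literals in a clause, and the
  order and the multiplicity of the clauses in a formula, matter.
\<close>

type_synonym clause = "literal \<times> literal \<times> literal"
type_synonym formula = "clause list"

fun mirror :: "clause \<Rightarrow> clause" where
  "mirror (a, b, c) = (neg_lit a, neg_lit b, neg_lit c)"

text \<open>
  The lexicographic order is spelled out rather than taken from a global order instance on
  products, of which the library has two incompatible ones.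
\<close>

fun clause_le :: "clause \<Rightarrow> clause \<Rightarrow> bool" where
  "clause_le (a, b, c) (a', b', c') \<longleftrightarrow>
     a < a' \<or> (a = a' \<and> (b < b' \<or> (b = b' \<and> c \<le> c')))"

definition reduced :: "formula \<Rightarrow> bool" where
  "reduced \<phi> \<longleftrightarrow>
     (\<forall>(a, b, c) \<in> set \<phi>. a \<le> b \<and> b \<le> c) \<and> sorted_wrt clause_le \<phi> \<and> distinct \<phi>"

definition proper :: "formula \<Rightarrow> bool" where
  "proper \<phi> \<longleftrightarrow> reduced \<phi> \<and>
     (\<forall>(a, b, c) \<in> set \<phi>. var a \<noteq> var b \<and> var a \<noteq> var c \<and> var b \<noteq> var c)"

definition symmetric :: "formula \<Rightarrow> bool" where
  "symmetric \<phi> \<longleftrightarrow>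
     (\<forall>c \<in> set \<phi>. mirror c \<in> set \<phi> \<and> count_list \<phi> (mirror c) = count_list \<phi> c)"

fun lit_true :: "(nat \<Rightarrow> bool) \<Rightarrow> literal \<Rightarrow> bool" where
  "lit_true \<alpha> (Pos j) \<longleftrightarrow> \<alpha> j"
| "lit_true \<alpha> (Neg j) \<longleftrightarrow> \<not> \<alpha> j"

fun clause_true :: "(nat \<Rightarrow> bool) \<Rightarrow> clause \<Rightarrow> bool" where
  "clause_true \<alpha> (a, b, c) \<longleftrightarrow> lit_true \<alpha> a \<or> lit_true \<alpha> b \<or> lit_true \<alpha> c"

definition satisfiable :: "formula \<Rightarrow> bool" where
  "satisfiable \<phi> \<longleftrightarrow> (\<exists>\<alpha>. \<forall>c \<in> set \<phi>. clause_true \<alpha> c)"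


section \<open>Encoding of formulas as bit strings\<close>

text \<open>
  Variable indices are written in binary, most significant bit first, without leading zeros
  (so 0 is the empty string). Each digit is preceded by \<open>True\<close> and the end of the number is
  marked by \<open>False\<close>, which makes the code of a number, hence of a literal and of a clause,
  self-delimiting.
\<close>

fun binary :: "nat \<Rightarrow> bool list" where
  "binary n = (if n = 0 then [] else binary (n div 2) @ [odd n])"

declare binary.simps [simp del]

definition enc_nat :: "nat \<Rightarrow> bool list" where
  "enc_nat n = concat (map (\<lambda>b. [True, b]) (binary n)) @ [False]"

fun enc_literal :: "literal \<Rightarrow> bool list" where
  "enc_literal (Pos j) = True # enc_nat j"
| "enc_literal (Neg j) = False # enc_nat j"

fun enc_clause :: "clause \<Rightarrow> bool list" where
  "enc_clause (a, b, c) = enc_literal a @ enc_literal b @ enc_literal c"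

definition enc_formula :: "formula \<Rightarrow> bool list" where
  "enc_formula \<phi> = concat (map enc_clause \<phi>)"

lemma binary_inject: "binary m = binary n \<longleftrightarrow> m = n"
proof
  show "binary m = binary n \<Longrightarrow> m = n"
  proof (induction m arbitrary: n rule: less_induct)
    case (less m)
    show ?case
    proof (cases "m = 0 \<or> n = 0")
      case True
      with less.prems show ?thesis
        by (auto simp: binary.simps[of m] binary.simps[of n] split: if_splits)
    next
      case False
      with less.prems have "binary (m div 2) = binary (n div 2)" "odd m = odd n"
        by (auto simp: binary.simps[of m] binary.simps[of n])
      with less.IH[of "m div 2" "n div 2"] False have "m div 2 = n div 2" "odd m = odd n"
        by auto
      then show ?thesis by presburger
    qed
  qed
qed simp

lemma enc_nat_prefix_free: "enc_nat m @ u = enc_nat n @ v \<longleftrightarrow> m = n \<and> u = v"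
proof -
  have "concat (map (\<lambda>b. [True, b]) xs) @ False # u = concat (map (\<lambda>b. [True, b]) ys) @ False # v
        \<longleftrightarrow> xs = ys \<and> u = v" for xs ys
  proof (induction xs arbitrary: ys)
    case Nil
    then show ?case by (cases ys) auto
  next
    case (Cons x xs)
    then show ?case by (cases ys) auto
  qed
  then show ?thesis by (simp add: enc_nat_def binary_inject)
qed

lemma enc_literal_prefix_free: "enc_literal l @ u = enc_literal m @ v \<longleftrightarrow> l = m \<and> u = v"
  by (cases l; cases m) (auto simp: enc_nat_prefix_free)

lemma enc_clause_prefix_free: "enc_clause c @ u = enc_clause d @ v \<longleftrightarrow> c = d \<and> u = v"
  by (cases c; cases d) (auto simp: enc_literal_prefix_free)

lemma enc_formula_inject: "enc_formula \<phi> = enc_formula \<psi> \<longleftrightarrow> \<phi> = \<psi>"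
proof
  have nonempty: "enc_clause c \<noteq> []" for c
  proof (cases c)
    case (fields l m n)
    then show ?thesis by (cases l) auto
  qed
  show "enc_formula \<phi> = enc_formula \<psi> \<Longrightarrow> \<phi> = \<psi>"
  proof (induction \<phi> arbitrary: \<psi>)
    case Nil
    then show ?case by (cases \<psi>) (auto simp: enc_formula_def nonempty)
  next
    case (Cons c \<phi>)
    then show ?case
      by (cases \<psi>) (auto simp: enc_formula_def nonempty enc_clause_prefix_free)
  qed
qed simp


section \<open>Turing machines\<close>

text \<open>
  Deterministic machines with finitely many two-way infinite tapes, one head per tape.
  A machine with \<open>states M = Q\<close> has the working states \<open>0, \<dots>, Q - 1\<close>, the start
  state 0 and the halting state \<open>Q\<close>; its tape symbols are \<open>0, \<dots>, symbols M - 1\<close>.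
  Symbol 0 is the blank, 1 and 2 are the two bits. The argument and the result of
  \<open>delta M q\<close> list the symbols read, respectively the actions taken, tape by tape; only its
  values on working states and lists of tape symbols of length \<open>tapes M\<close> matter, so that a
  machine is a finite object.
\<close>

datatype move = MoveLeft | MoveStay | MoveRight

record tm =
  tapes :: nat
  symbols :: nat
  states :: nat
  delta :: "nat \<Rightarrow> nat list \<Rightarrow> nat \<times> (nat \<times> move) list"

definition wf_tm :: "tm \<Rightarrow> bool" where
  "wf_tm M \<longleftrightarrow> tapes M \<ge> 1 \<and> symbols M \<ge> 3 \<and>
     (\<forall>q rs. q < states M \<and> length rs = tapes M \<and> set rs \<subseteq> {..<symbols M} \<longrightarrow>
       (case delta M q rs of (q', as) \<Rightarrow>
          q' \<le> states M \<and> length as = tapes M \<and> (\<forall>(s, d) \<in> set as. s < symbols M)))"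

type_synonym tape = "(int \<Rightarrow> nat) \<times> int"
type_synonym config = "nat \<times> tape list"

fun move_offset :: "move \<Rightarrow> int" where
  "move_offset MoveLeft = - 1"
| "move_offset MoveStay = 0"
| "move_offset MoveRight = 1"

fun read_tape :: "tape \<Rightarrow> nat" where
  "read_tape (f, h) = f h"

fun act_tape :: "nat \<times> move \<Rightarrow> tape \<Rightarrow> tape" where
  "act_tape (s, d) (f, h) = (f(h := s), h + move_offset d)"

fun tm_step :: "tm \<Rightarrow> config \<Rightarrow> config" where
  "tm_step M (q, ts) =
     (if q < states M
      then (case delta M q (map read_tape ts) of (q', as) \<Rightarrow> (q', map2 act_tape as ts))
      else (q, ts))"

definition bit_symbol :: "bool \<Rightarrow> nat" where
  "bit_symbol b = (if b then 2 else 1)"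

definition word_tape :: "bool list \<Rightarrow> tape" where
  "word_tape w =
     (\<lambda>i. if 0 \<le> i \<and> i < int (length w) then bit_symbol (w ! nat i) else 0, 0)"

text \<open>The input words are on the first tapes, one word per tape; all other tapes are blank.\<close>

definition init_config :: "tm \<Rightarrow> bool list list \<Rightarrow> config" where
  "init_config M ws =
     (0, map (\<lambda>k. word_tape (if k < length ws then ws ! k else [])) [0..<tapes M])"

text \<open>The word on a tape extends from the head to the right, up to the first blank.\<close>

fun tape_holds :: "tape \<Rightarrow> bool list \<Rightarrow> bool" where
  "tape_holds (f, h) w \<longleftrightarrow>
     (\<forall>i < length w. f (h + int i) = bit_symbol (w ! i)) \<and> f (h + int (length w)) = 0"

text \<open>The output is the word on the first tape in the halting state.\<close>

definition computes_within :: "tm \<Rightarrow> bool list list \<Rightarrow> bool list \<Rightarrow> nat \<Rightarrow> bool" where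
  "computes_within M ws w t \<longleftrightarrow>
     (\<exists>n \<le> t. case (tm_step M ^^ n) (init_config M ws) of (q, ts) \<Rightarrow>
        q = states M \<and> tape_holds (ts ! 0) w)"


section \<open>Polynomial time, NP, and NP-completeness\<close>

definition polytime_fun :: "(bool list \<Rightarrow> bool list) \<Rightarrow> bool" where
  "polytime_fun f \<longleftrightarrow>
     (\<exists>M (p :: nat poly). wf_tm M \<and>
        (\<forall>x. computes_within M [x] (f x) (poly p (length x))))"

definition polytime_rel :: "(bool list \<Rightarrow> bool list \<Rightarrow> bool) \<Rightarrow> bool" where
  "polytime_rel R \<longleftrightarrow>
     (\<exists>M (p :: nat poly). wf_tm M \<and> tapes M \<ge> 2 \<and>
        (\<forall>x y. computes_within M [x, y] [R x y] (poly p (length x + length y))))"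

type_synonym language = "bool list set"

definition in_NP :: "language \<Rightarrow> bool" where
  "in_NP L \<longleftrightarrow>
     (\<exists>R (p :: nat poly). polytime_rel R \<and>
        (\<forall>x. x \<in> L \<longleftrightarrow> (\<exists>y. length y \<le> poly p (length x) \<and> R x y)))"

definition polytime_reducible :: "language \<Rightarrow> language \<Rightarrow> bool" where
  "polytime_reducible L L' \<longleftrightarrow> (\<exists>f. polytime_fun f \<and> (\<forall>x. x \<in> L \<longleftrightarrow> f x \<in> L'))"

definition NP_hard :: "language \<Rightarrow> bool" where
  "NP_hard L \<longleftrightarrow> (\<forall>L'. in_NP L' \<longrightarrow> polytime_reducible L' L)"

definition NP_complete :: "language \<Rightarrow> bool" where
  "NP_complete L \<longleftrightarrow> in_NP L \<and> NP_hard L"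

definition proper_symmetric_3sat :: language where
  "proper_symmetric_3sat =
     {enc_formula \<phi> | \<phi>. proper \<phi> \<and> symmetric \<phi> \<and> satisfiable \<phi>}"

end

theory Submission
  imports Defs
begin

text \<open>
  Cook and Levin's argument, with not-all-equal constraints as the target. If the tape cells are
  addressed relative to the heads, the run of a verifier is described by Horn clauses: once the
  initial tapes are fixed, the true cells are propagated through time, so no clause has to exclude
  wrong cells, and a single negative unit clause forbids rejection. Only the certificate is left
  open. A proper symmetric formula says of each of its clauses that the literals do not all have
  the same value. This is invariant under complementing the assignment, so one variable can play
  the constant false, and a clause \<open>l\<^sub>1 \<or> \<dots> \<or> l\<^sub>n\<close> is expressed by naming the disjunctions of its
  suffixes and splitting constraints on four literals in two.

  Turing machines are only needed for a While language on four stacks. One stack holds trees in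
  prefix notation, and the functions on encoded data computed this way are closed under pairing,
  composition, case distinction and recursion along lists with an accumulator that grows additively.
  The reduction and the verifier of satisfying assignments are built from these operations.
\<close>

section \<open>While programs on stacks\<close>

text \<open>Horn clauses suffice because, once a certificate has been read off at time 0, induction
  on time shows that a satisfying assignment makes all cells of the actual run true; for this
  argument cells that are true in excess do no harm. Addressing relative to the heads makes a
  transition depend on \<open>tapes M + 1\<close> fixed cells; the price is that a move shifts a
  whole tape. The shift is by at most one cell, so a window of half width \<open>m + T\<close> lasts
  for \<open>T\<close> steps. Additive growth of accumulators is what keeps recursion polynomial: a
  step that doubles its accumulator is cheap once, but exponential along a list. Numbers are coded
  in unary, so arithmetic becomes list processing and the size of a number is linear in its value.
  This is adequate for the reduction, where times, positions and variable numbers are polynomially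
  bounded, but not for reading a given formula, whose variables are named in binary.\<close>

datatype reg = RA | RB | RC | RD

primrec tape_of :: "reg \<Rightarrow> nat" where
  "tape_of RA = 0"
| "tape_of RB = 1"
| "tape_of RC = 2"
| "tape_of RD = 3"

lemma tape_of_less [simp]: "tape_of r < 4"
  by (cases r) auto

lemma tape_of_eq_iff [simp]: "tape_of r = tape_of r' \<longleftrightarrow> r = r'"
  by (cases r; cases r') auto

type_synonym store = "reg \<Rightarrow> bool list"

text \<open>A test sees only the symbol under the head, 0 standing for the empty stack, so it takes
  one machine step whatever the predicate is.\<close>

datatype com =
    Push reg bool
  | Pop reg
  | Seq com com (infixr ";;" 60)
  | Cond reg "nat \<Rightarrow> bool" com com
  | While reg "nat \<Rightarrow> bool" com

primrec top_symbol :: "bool list \<Rightarrow> nat" where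
  "top_symbol [] = 0"
| "top_symbol (b # _) = bit_symbol b"

text \<open>The third argument is the exact number of steps of the compiled machine.\<close>

inductive exec :: "com \<Rightarrow> store \<Rightarrow> nat \<Rightarrow> store \<Rightarrow> bool" where
  exec_Push: "exec (Push r b) s 2 (s(r := b # s r))"
| exec_Pop: "exec (Pop r) s 1 (s(r := tl (s r)))"
| exec_Seq: "exec c s t s' \<Longrightarrow> exec d s' u s'' \<Longrightarrow> exec (c ;; d) s (t + u) s''"
| exec_Cond_True: "P (top_symbol (s r)) \<Longrightarrow> exec c s t s' \<Longrightarrow> exec (Cond r P c d) s (Suc t) s'"
| exec_Cond_False: "\<not> P (top_symbol (s r)) \<Longrightarrow> exec d s t s' \<Longrightarrow> exec (Cond r P c d) s (Suc t) s'"
| exec_While_False: "\<not> P (top_symbol (s r)) \<Longrightarrow> exec (While r P c) s 1 s"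
| exec_While_True: "P (top_symbol (s r)) \<Longrightarrow> exec c s t s' \<Longrightarrow> exec (While r P c) s' u s''
    \<Longrightarrow> exec (While r P c) s (Suc (t + u)) s''"

text \<open>No command adds more symbols than it takes steps, so a time bound is also a bound on the
  size of the result.\<close>

lemma exec_length: "exec c s t s' \<Longrightarrow> length (s' r) \<le> length (s r) + t"
  by (induction rule: exec.induct) auto

section \<open>Compilation to four-tape machines\<close>

type_synonym instr = "reg \<times> (nat \<Rightarrow> nat \<times> move \<times> nat)"

primrec code_size :: "com \<Rightarrow> nat" where
  "code_size (Push r b) = 2"
| "code_size (Pop r) = 1"
| "code_size (c ;; d) = code_size c + code_size d"
| "code_size (Cond r P c d) = 1 + code_size c + code_size d"
| "code_size (While r P c) = 1 + code_size c"

text \<open>\<open>compile c a e\<close> is code to be placed at address \<open>a\<close> which continues at address \<open>e\<close>.\<close>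

primrec compile :: "com \<Rightarrow> nat \<Rightarrow> nat \<Rightarrow> instr list" where
  "compile (Push r b) a e =
     [(r, \<lambda>s. (s, MoveLeft, a + 1)), (r, \<lambda>s. (bit_symbol b, MoveStay, e))]"
| "compile (Pop r) a e = [(r, \<lambda>s. (0, if s = 0 then MoveStay else MoveRight, e))]"
| "compile (c ;; d) a e = compile c a (a + code_size c) @ compile d (a + code_size c) e"
| "compile (Cond r P c d) a e =
     (r, \<lambda>s. (s, MoveStay, if P s then a + 1 else a + 1 + code_size c)) #
     compile c (a + 1) e @ compile d (a + 1 + code_size c) e"
| "compile (While r P c) a e =
     (r, \<lambda>s. (s, MoveStay, if P s then a + 1 else e)) # compile c (a + 1) a"

lemma length_compile [simp]: "length (compile c a e) = code_size c"
  by (induction c arbitrary: a e) auto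

lemma code_size_pos [simp]: "0 < code_size c"
  by (induction c) auto

definition machine :: "instr list \<Rightarrow> tm" where
  "machine P = \<lparr>tapes = 4, symbols = 3, states = length P,
     delta = (\<lambda>q rs. case P ! q of (r, g) \<Rightarrow> case g (rs ! tape_of r) of (s, d, q') \<Rightarrow>
       (q', map (\<lambda>k. if k = tape_of r then (s, d) else (rs ! k, MoveStay)) [0..<4]))\<rparr>"

lemma machine_simps [simp]:
  "tapes (machine P) = 4" "symbols (machine P) = 3" "states (machine P) = length P"
  by (simp_all add: machine_def)

text \<open>Jumps stay inside the block or go to its exit; with the exit at the end of the program
  this gives the bound on states in \<open>wf_tm\<close>.\<close>

lemma compile_instr:
  assumes "(r, g) \<in> set (compile c a e)" "s < 3" "g s = (s', d, q)"
  shows "s' < 3 \<and> (q = e \<or> a \<le> q \<and> q < a + code_size c)"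
  using assms
proof (induction c arbitrary: a e)
  case (Seq c d)
  \<comment> \<open>The exit of \<open>c\<close> is the first address of \<open>d\<close>; it lies
    inside the block because \<open>d\<close> is not empty.\<close>
  have "0 < code_size d" by simp
  with Seq show ?case by fastforce
next
  case (Cond r P c d)
  have "0 < code_size c" "0 < code_size d" by simp_all
  with Cond show ?case by (fastforce split: if_splits)
next
  case (While r P c)
  have "0 < code_size c" by simp
  with While show ?case by (fastforce split: if_splits)
qed (auto simp: bit_symbol_def split: if_splits)

lemma wf_machine: "wf_tm (machine (compile c 0 (code_size c)))"
proof -
  let ?P = "compile c 0 (code_size c)"
  have "case delta (machine ?P) q rs of (q', as) \<Rightarrow>
          q' \<le> length ?P \<and> length as = 4 \<and> (\<forall>(s, d)\<in>set as. s < 3)"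
    if q: "q < length ?P" and rs: "length rs = 4" "set rs \<subseteq> {..<3}" for q rs
  proof -
    obtain r g where P: "?P ! q = (r, g)" by (cases "?P ! q")
    obtain s d q' where g: "g (rs ! tape_of r) = (s, d, q')" by (cases "g (rs ! tape_of r)")
    have lt: "rs ! k < 3" if "k < 4" for k
      using rs that by (metis lessThan_iff nth_mem subsetD)
    have "(r, g) \<in> set ?P" using P q by (metis nth_mem)
    from compile_instr[OF this lt g] have "s < 3" "q' \<le> code_size c" by auto
    then show ?thesis by (auto simp: machine_def P g lt split: if_splits)
  qed
  then show ?thesis unfolding wf_tm_def by auto
qed

text \<open>The top of a stack is under the head and stacks grow to the left. Cells to the left of
  the head are unconstrained, so whatever was left there is harmless.\<close>

definition represents :: "tape list \<Rightarrow> store \<Rightarrow> bool" where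
  "represents ts s \<longleftrightarrow> length ts = 4 \<and> (\<forall>r. tape_holds (ts ! tape_of r) (s r))"

lemma machine_step:
  assumes "q < length P" "P ! q = (r, g)" "length ts = 4"
    and "g (read_tape (ts ! tape_of r)) = (s, d, q')"
  shows "tm_step (machine P) (q, ts) = (q', ts[tape_of r := act_tape (s, d) (ts ! tape_of r)])"
proof -
  have stay: "act_tape (read_tape t, MoveStay) t = t" for t by (cases t) auto
  have "map2 act_tape (map (\<lambda>k. if k
      = tape_of r then (s, d) else (map read_tape ts ! k, MoveStay)) [0..<4]) ts
      = ts[tape_of r := act_tape (s, d) (ts ! tape_of r)]"
    by (rule nth_equalityI) (auto simp: assms nth_list_update stay simp del: act_tape.simps
        upt.simps)
  then show ?thesis using assms by (simp add: machine_def del: upt.simps)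
qed

lemma tape_holds_top: "tape_holds t w \<Longrightarrow> read_tape t = top_symbol w"
  by (cases t; cases w) (force)+

text \<open>On an empty stack the head must stay: a move to the right would expose cells about which
  nothing is known.\<close>

lemma tape_holds_Pop:
  assumes "tape_holds t w"
  shows "tape_holds (act_tape (0, if read_tape t = 0 then MoveStay else MoveRight) t) (tl w)"
proof (cases t; cases w)
  fix f h assume t: "t = (f, h)" and "w = []"
  with assms show ?thesis by (auto simp: fun_upd_idem)
next
  fix f h b v assume t: "t = (f, h)" and w: "w = b # v"
  have fh: "f h \<noteq> 0" using tape_holds_top[OF assms] t w by
      (simp add: bit_symbol_def split: if_splits)
  have "f (h + 1 + int i) = bit_symbol (v ! i)" if "i < length v" for i
    using assms t w that by (auto dest!: spec[of _ "Suc i"] simp: add_ac)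
  moreover have "f (h + 1 + int (length v)) = 0" using assms t w by (auto simp: add_ac)
  ultimately show ?thesis using t w fh by auto
qed

text \<open>An action writes before it moves, so a push takes two steps: go left without changing
  the symbol read, then overwrite whatever stands there.\<close>

lemma tape_holds_Push:
  assumes "tape_holds t w"
  shows "tape_holds (act_tape (bit_symbol b, MoveStay) (act_tape (read_tape t, MoveLeft) t))
      (b # w)"
proof (cases t)
  fix f h assume t: "t = (f, h)"
  have "f (h - 1 + int i) = bit_symbol ((b # w) ! i)" if "0 < i" "i < Suc (length w)" for i
    using assms t that by (cases i) auto
  with t assms show ?thesis by auto
qed

lemma represents_read: "represents ts s \<Longrightarrow> read_tape (ts ! tape_of r) = top_symbol (s r)"
  by (simp add: represents_def tape_holds_top)

lemma represents_update:
  "represents ts s \<Longrightarrow> tape_holds t w \<Longrightarrow> represents (ts[tape_of r := t]) (s(r := w))"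
  by (auto simp: represents_def nth_list_update)

definition code_at :: "instr list \<Rightarrow> nat \<Rightarrow> instr list \<Rightarrow> bool" where
  "code_at P a is \<longleftrightarrow> (\<exists>us vs. P = us @ is @ vs \<and> length us = a)"

declare tm_step.simps [simp del]

lemma code_at_Cons: "code_at P a (i # is) \<longleftrightarrow> a < length P \<and> P ! a = i \<and> code_at P (a + 1) is"
proof
  assume "code_at P a (i # is)"
  then obtain us vs where "P = us @ (i # is) @ vs" "length us = a" by (auto simp: code_at_def)
  then show "a < length P \<and> P ! a = i \<and> code_at P (a + 1) is"
    unfolding code_at_def by (intro conjI exI[of _ "us @ [i]"] exI[of _ vs]) auto
next
  assume *: "a < length P \<and> P ! a = i \<and> code_at P (a + 1) is"
  then obtain us vs where P: "P = us @ is @ vs" "length us = a + 1" by (auto simp: code_at_def)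
  then obtain us' j where us: "us = us' @ [j]" by (cases us rule: rev_cases) auto
  with * P have "P = us' @ (i # is) @ vs \<and> length us' = a" by (auto simp: nth_append)
  then show "code_at P a (i # is)" unfolding code_at_def by blast
qed

lemma code_at_append:
  "code_at P a (is @ js) \<longleftrightarrow> code_at P a is \<and> code_at P (a + length is) js"
proof (induction "is" arbitrary: a)
  case Nil
  have "code_at P a [] " if js: "code_at P a js"
  proof -
    from js obtain us vs where "P = us @ js @ vs" "length us = a" by (auto simp: code_at_def)
    then show ?thesis unfolding code_at_def by (intro exI[of _ us] exI[of _ "js @ vs"]) auto
  qed
  then show ?case by auto
qed (auto simp: code_at_Cons)

lemma machine_test:
  assumes "represents ts s" "a < length P" "P ! a = (r, \<lambda>x. (x, MoveStay, h x))"
  shows "tm_step (machine P) (a, ts) = (h (top_symbol (s r)), ts)"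
proof -
  have *: "act_tape (read_tape t, MoveStay) t = t" for t by (cases t) auto
  from assms(1) have l: "length ts = 4" by (simp add: represents_def)
  show ?thesis
    using machine_step[OF assms(2,3) l refl] represents_read[OF assms(1), of r] 
      *[of "ts ! tape_of r"]
    by simp
qed

lemma funpow_Suc_apply: "(f ^^ Suc n) x = (f ^^ n) (f x)"
  by (simp add: funpow_Suc_right del: funpow.simps)

lemma funpow_add_apply: "(f ^^ (m + n)) x = (f ^^ n) ((f ^^ m) x)"
  by (simp add: add.commute[of m n] funpow_add)

text \<open>Address and exit are arbitrary in the induction: the body of a loop is compiled with the
  address of the test as its exit, after which the same code is entered again.\<close>

lemma exec_machine:
  assumes "exec c s t s'" "code_at P a (compile c a e)" "represents ts s"
  shows "\<exists>ts'. (tm_step (machine P) ^^ t) (a, ts) = (e, ts') \<and> represents ts' s'"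
  using assms
proof (induction arbitrary: a e ts rule: exec.induct)
  case (exec_Push r b s)
  let ?t = "act_tape (read_tape (ts ! tape_of r), MoveLeft) (ts ! tape_of r)"
  have len: "length ts = 4" using exec_Push by (simp add: represents_def)
  have a: "a < length P" "P ! a = (r, \<lambda>s. (s, MoveLeft, a + 1))" "a + 1 < length P"
      "P ! (a + 1) = (r, \<lambda>s. (bit_symbol b, MoveStay, e))"
    using exec_Push by (simp_all add: code_at_Cons)
  have "tm_step (machine P) (a, ts) = (a + 1, ts[tape_of r := ?t])"
    using machine_step[OF a(1,2) len] by simp
  moreover have "tm_step (machine P) (a + 1, ts[tape_of r := ?t]) =
      (e, ts[tape_of r := act_tape (bit_symbol b, MoveStay) ?t])"
    using machine_step[OF a(3,4), of "ts[tape_of r := ?t]"] len by simp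
  moreover have "represents (ts[tape_of r := act_tape (bit_symbol b, MoveStay) ?t])
      (s(r := b # s r))"
    using exec_Push(2) by (intro represents_update tape_holds_Push) (auto simp: represents_def)
  ultimately have "(tm_step (machine P) ^^ 2) (a, ts) =
      (e, ts[tape_of r := act_tape (bit_symbol b, MoveStay) ?t]) \<and>
      represents (ts[tape_of r := act_tape (bit_symbol b, MoveStay) ?t]) (s(r := b # s r))"
    by (simp add: numeral_2_eq_2 del: act_tape.simps)
  then show ?case by blast
next
  case (exec_Pop r s)
  let ?t = "act_tape (0, if read_tape (ts ! tape_of r) = 0 then MoveStay else MoveRight)
      (ts ! tape_of r)"
  have len: "length ts = 4" using exec_Pop by (simp add: represents_def)
  have a: "a < length P" "P ! a = (r, \<lambda>s. (0, if s = 0 then MoveStay else MoveRight, e))"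
    using exec_Pop by (simp_all add: code_at_Cons)
  have "tm_step (machine P) (a, ts) = (e, ts[tape_of r := ?t])"
    using machine_step[OF a(1,2) len] by simp
  moreover have "represents (ts[tape_of r := ?t]) (s(r := tl (s r)))"
    using exec_Pop(2) by (intro represents_update tape_holds_Pop) (auto simp: represents_def)
  ultimately have "(tm_step (machine P) ^^ 1) (a, ts) = (e, ts[tape_of r := ?t]) \<and>
      represents (ts[tape_of r := ?t]) (s(r := tl (s r)))"
    by (simp del: act_tape.simps)
  then show ?case by blast
next
  case (exec_Seq c s t s' d u s'')
  from exec_Seq.prems have "code_at P a (compile c a (a + code_size c))"
      "code_at P (a + code_size c) (compile d (a + code_size c) e)"
    by (simp_all add: code_at_append)
  with exec_Seq.IH exec_Seq.prems(2) show ?case unfolding funpow_add_apply by metis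
next
  case (exec_Cond_True Q s r c t s' d)
  from exec_Cond_True.prems have c: "code_at P (a + 1) (compile c (a + 1) e)" and
    a: "a < length P" "P ! a = (r, \<lambda>s. (s, MoveStay, if Q s then a + 1 else a + 1 + code_size c))"
    by (simp_all add: code_at_append code_at_Cons)
  from exec_Cond_True.IH[OF c exec_Cond_True.prems(2)] show ?case
    using machine_test[OF exec_Cond_True.prems(2) a] exec_Cond_True.hyps(1)
    by (simp add: funpow_Suc_apply del: funpow.simps tm_step.simps)
next
  case (exec_Cond_False Q s r d t s' c)
  from exec_Cond_False.prems have d:
      "code_at P (a + 1 + code_size c) (compile d (a + 1 + code_size c) e)" and
    a: "a < length P" "P ! a = (r, \<lambda>s. (s, MoveStay, if Q s then a + 1 else a + 1 + code_size c))"
    by (simp_all add: code_at_append code_at_Cons)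
  from exec_Cond_False.IH[OF d exec_Cond_False.prems(2)] show ?case
    using machine_test[OF exec_Cond_False.prems(2) a] exec_Cond_False.hyps(1)
    by (simp add: funpow_Suc_apply del: funpow.simps tm_step.simps)
next
  case (exec_While_False Q s r c)
  from exec_While_False.prems have
    a: "a < length P" "P ! a = (r, \<lambda>s. (s, MoveStay, if Q s then a + 1 else e))"
    by (simp_all add: code_at_Cons)
  show ?case
    using machine_test[OF exec_While_False.prems(2) a] exec_While_False by simp
next
  case (exec_While_True Q s r c t s' u s'')
  from exec_While_True.prems have c: "code_at P (a + 1) (compile c (a + 1) a)" and
    a: "a < length P" "P ! a = (r, \<lambda>s. (s, MoveStay, if Q s then a + 1 else e))"
    by (simp_all add: code_at_Cons)
  obtain ts' where 1: "(tm_step (machine P) ^^ t) (a + 1, ts) = (a, ts')" and 2: "represents ts' s'"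
    using exec_While_True.IH(1)[OF c exec_While_True.prems(2)] by auto
  obtain ts'' where "(tm_step (machine P) ^^ u) (a, ts') = (e, ts'')" "represents ts'' s''"
    using exec_While_True.IH(2)[OF exec_While_True.prems(1) 2] by auto
  then show ?case
    using machine_test[OF exec_While_True.prems(2) a] exec_While_True.hyps(1) 1
    by (auto simp add: funpow_Suc_apply funpow_add_apply simp del: funpow.simps tm_step.simps)
qed

definition store :: "bool list \<Rightarrow> bool list \<Rightarrow> bool list \<Rightarrow> bool list \<Rightarrow> store" where
  "store a b c d r = (case r of RA \<Rightarrow> a | RB \<Rightarrow> b | RC \<Rightarrow> c | RD \<Rightarrow> d)"

lemma store_simps [simp]:
  "store a b c d RA = a" "store a b c d RB = b" "store a b c d RC = c" "store a b c d RD = d"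
  "(store a b c d)(RA := x) = store x b c d" "(store a b c d)(RB := x) = store a x c d"
  "(store a b c d)(RC := x) = store a b x d" "(store a b c d)(RD := x) = store a b c x"
  by (auto simp: store_def fun_eq_iff split: reg.splits)

text \<open>A blank tape represents the empty stack, so one input word is the case
  \<open>y = []\<close> of two.\<close>

lemma exec_computes_within:
  assumes "exec c (store x y [] []) t (store w b c' d)" and "t \<le> u"
      and "zs = [x, y] \<or> zs = [x] \<and> y = []"
  shows "computes_within (machine (compile c 0 (code_size c))) zs w u"
proof -
  let ?P = "compile c 0 (code_size c)"
  have code: "code_at ?P 0 ?P" by (auto simp: code_at_def)
  obtain ts where ts: "init_config (machine ?P) zs = (0, ts)" by (auto simp: init_config_def)
  have word: "tape_holds (word_tape v) v" for v by (auto simp: word_tape_def)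
  have "represents ts (store x y [] [])"
    unfolding represents_def
  proof (intro conjI allI)
    show "length ts = 4" using ts by (auto simp: init_config_def)
    fix r
    from ts assms(3) show "tape_holds (ts ! tape_of r) (store x y [] [] r)"
      by (cases r) (auto simp: init_config_def word simp del: tape_holds.simps upt.simps)
  qed
  from exec_machine[OF assms(1) code this] ts show ?thesis
    unfolding computes_within_def using assms(2)
    by (auto simp: represents_def intro!: exI[of _ t] dest!: spec[of _ RA])
qed

text \<open>In contrast to the exact counts of \<open>exec\<close>, bounds can be rounded up when
  executions are combined.\<close>

definition runs :: "com \<Rightarrow> store \<Rightarrow> nat \<Rightarrow> store \<Rightarrow> bool" where
  "runs c s t s' \<longleftrightarrow> (\<exists>u \<le> t. exec c s u s')"

lemma runs_Seq:
  assumes "runs c s t s'" "runs d s' u s''" "t + u \<le> v"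
  shows "runs (c ;; d) s v s''"
proof -
  from assms obtain t' u' where "exec c s t' s'" "t' \<le> t" "exec d s' u' s''" "u' \<le> u"
    unfolding runs_def by blast
  with assms(3) exec_Seq[OF this(1,3)] show ?thesis
    unfolding runs_def by (intro exI[of _ "t' + u'"]) simp
qed

lemma runs_Push: "2 \<le> t \<Longrightarrow> s' = s(r := b # s r) \<Longrightarrow> runs (Push r b) s t s'"
  unfolding runs_def by (auto intro: exec_Push)

lemma runs_Pop: "1 \<le> t \<Longrightarrow> s' = s(r := tl (s r)) \<Longrightarrow> runs (Pop r) s t s'"
  unfolding runs_def by (auto intro: exec_Pop[unfolded One_nat_def])

lemma runs_Cond:
  assumes "runs (if P (top_symbol (s r)) then c else d) s t s'" "Suc t \<le> u"
  shows "runs (Cond r P c d) s u s'"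
proof -
  from assms obtain t' where "exec (if P (top_symbol (s r)) then c else d) s t' s'" "t' \<le> t"
    unfolding runs_def by blast
  then have "exec (Cond r P c d) s (Suc t') s'"
    by (auto intro: exec_Cond_True exec_Cond_False split: if_splits)
  with \<open>t' \<le> t\<close> assms(2) show ?thesis
    unfolding runs_def by (intro exI[of _ "Suc t'"]) simp
qed

lemma runs_While_False:
  "\<not> P (top_symbol (s r)) \<Longrightarrow> s' = s \<Longrightarrow> 1 \<le> t \<Longrightarrow> runs (While r P c) s t s'"
  unfolding runs_def by (auto intro: exec_While_False[unfolded One_nat_def])

lemma runs_While_True:
  assumes "P (top_symbol (s r))" "runs c s t s1" "runs (While r P c) s1 u s'" "Suc (t + u) \<le> v"
  shows "runs (While r P c) s v s'"
proof -
  from assms obtain t' u' where "exec c s t' s1" "t' \<le> t" "exec (While r P c) s1 u' s'" "u' \<le> u"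
    unfolding runs_def by blast
  with assms(4) exec_While_True[OF assms(1) this(1,3)] show ?thesis
    unfolding runs_def by (intro exI[of _ "Suc (t' + u')"]) simp
qed

lemma runs_mono: "runs c s t s' \<Longrightarrow> t \<le> u \<Longrightarrow> runs c s u s'"
  unfolding runs_def by (auto intro: le_trans)

lemma runs_length: "runs c s t s' \<Longrightarrow> length (s' r) \<le> length (s r) + t"
  unfolding runs_def using exec_length[of c s _ s' r] by fastforce

section \<open>Symbolic execution of loop-free code\<close>

primrec loop_free :: "com \<Rightarrow> bool" where
  "loop_free (Push r b) = True"
| "loop_free (Pop r) = True"
| "loop_free (c ;; d) = (loop_free c \<and> loop_free d)"
| "loop_free (Cond r P c d) = (loop_free c \<and> loop_free d)"
| "loop_free (While r P c) = False"

text \<open>The value at \<open>While\<close> is a dummy, excluded by \<open>loop_free\<close>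
  wherever \<open>final\<close> is used.\<close>

primrec final :: "com \<Rightarrow> store \<Rightarrow> store" where
  "final (Push r b) s = s(r := b # s r)"
| "final (Pop r) s = s(r := tl (s r))"
| "final (c ;; d) s = final d (final c s)"
| "final (Cond r P c d) s = (if P (top_symbol (s r)) then final c s else final d s)"
| "final (While r P c) s = s"

primrec cost :: "com \<Rightarrow> nat" where
  "cost (Push r b) = 2"
| "cost (Pop r) = 1"
| "cost (c ;; d) = cost c + cost d"
| "cost (Cond r P c d) = 1 + max (cost c) (cost d)"
| "cost (While r P c) = 0"

lemma runs_loop_free: "loop_free c \<Longrightarrow> runs c s (cost c) (final c s)"
proof (induction c arbitrary: s)
  case (Cond r P c d)
  then show ?case
    using runs_mono[of c s "cost c" _ "max (cost c) (cost d)"]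
        runs_mono[of d s "cost d" _ "max (cost c) (cost d)"]
    by (auto intro!: runs_Cond[where t = "max (cost c) (cost d)"])
qed (auto intro: runs_Push runs_Pop runs_Seq)

lemma runs_loop_freeI: "loop_free c \<Longrightarrow> s' = final c s \<Longrightarrow> cost c \<le> t \<Longrightarrow> runs c s t s'"
  using runs_loop_free runs_mono by blast

text \<open>Shaped for elimination: the run of the remaining rounds is matched first, and the
  equations between stores are left to the simplifier.\<close>

lemma runs_While_body:
  "P (top_symbol (s r)) \<Longrightarrow> loop_free c \<Longrightarrow> runs (While r P c) s1 u s2 \<Longrightarrow> final c s = s1 \<Longrightarrow>
    s2 = s' \<Longrightarrow> Suc (cost c + u) \<le> v \<Longrightarrow> runs (While r P c) s v s'"
  using runs_While_True[OF _ runs_loop_free] by blast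

abbreviation nonblank :: "nat \<Rightarrow> bool" where "nonblank x \<equiv> x \<noteq> 0"
abbreviation is_one :: "nat \<Rightarrow> bool" where "is_one x \<equiv> x = 2"

lemma bit_symbol_simps [simp]:
  "bit_symbol True = 2" "bit_symbol False = 1" "bit_symbol b \<noteq> 0" "0 < bit_symbol b"
  "bit_symbol b = 2 \<longleftrightarrow> b" "bit_symbol b = Suc 0 \<longleftrightarrow> \<not> b"
  by (auto simp: bit_symbol_def)

definition transfer :: "reg \<Rightarrow> reg \<Rightarrow> com" where
  "transfer r r' = While r nonblank
     (Cond r is_one (Pop r ;; Push r' True) (Pop r ;; Push r' False))"

text \<open>Each symbol costs 5 steps: the loop test, the case distinction, a pop, and two for the
  push. The final test accounts for the summand 1.\<close>

lemma runs_transfer: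
  assumes "r \<noteq> r'" "s' = s(r := [], r' := rev (s r) @ s r')" "5 * length (s r) + 1 \<le> t"
  shows "runs (transfer r r') s t s'"
proof -
  have "runs (transfer r r') s (5 * length xs + 1) (s(r := [], r' := rev xs @ s r'))" if
      "s r = xs" for xs
    using that
  proof (induction xs arbitrary: s)
    case Nil
    then show ?case unfolding transfer_def by (intro runs_While_False) (auto simp: fun_eq_iff)
  next
    case (Cons b xs)
    let ?s1 = "s(r := xs, r' := b # s r')"
    have "runs (transfer r r') ?s1 (5 * length xs + 1) (?s1(r := [], r' := rev xs @ ?s1 r'))"
      by (rule Cons.IH) (use assms(1) in auto)
    moreover have "?s1(r := [], r' := rev xs @ ?s1 r') = s(r := [], r' := rev (b # xs) @ s r')"
      by (auto simp: fun_eq_iff)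
    ultimately have "runs (transfer r r') ?s1 (5 * length xs + 1)
        (s(r := [], r' := rev (b # xs) @ s r'))"
      by metis
    with Cons.prems assms(1) show ?case
      unfolding transfer_def
      by (elim runs_While_body[rotated 2]) (auto simp: fun_eq_iff)
  qed
  with assms show ?thesis using runs_mono by blast
qed

definition clear :: "reg \<Rightarrow> com" where
  "clear r = While r nonblank (Pop r)"

lemma runs_clear:
  assumes "s' = s(r := [])" "2 * length (s r) + 1 \<le> t"
  shows "runs (clear r) s t s'"
proof -
  have "runs (clear r) s (2 * length xs + 1) (s(r := []))" if "s r = xs" for xs
    using that
  proof (induction xs arbitrary: s)
    case Nil
    then show ?case unfolding clear_def by (intro runs_While_False) (auto simp: fun_eq_iff)
  next
    case (Cons b xs)
    have "runs (clear r) (s(r := xs)) (2 * length xs + 1) ((s(r := xs))(r := []))"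
      by (rule Cons.IH) auto
    with Cons.prems show ?case unfolding clear_def fun_upd_upd
      by (elim runs_While_body[rotated 2]) (auto simp: fun_eq_iff)
  qed
  with assms show ?thesis using runs_mono by blast
qed

section \<open>Trees\<close>

datatype tree = Leaf | Node tree tree

text \<open>Preorder codes are self-delimiting, so values can lie on a stack without
  separators.\<close>

primrec code :: "tree \<Rightarrow> bool list" where
  "code Leaf = [False]"
| "code (Node l r) = True # code l @ code r"

lemma code_prefix_free: "code t @ u = code t' @ v \<longleftrightarrow> t = t' \<and> u = v"
  by (induction t arbitrary: t' u v; case_tac t') auto

lemma code_inject: "code t = code t' \<longleftrightarrow> t = t'"
  using code_prefix_free[of t "[]" t' "[]"] by simp

lemma code_nonempty [simp]: "code t \<noteq> []"
  by (cases t) auto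

text \<open>Register RB counts the subtrees that are still to be read.\<close>

definition grab_loop :: "reg \<Rightarrow> com" where
  "grab_loop r = While RB nonblank (Cond RA is_one
     (Pop RA ;; Push r True ;; Push RB True) (Pop RA ;; Push r False ;; Pop RB))"

definition grab :: "reg \<Rightarrow> com" where
  "grab r = Push RB True ;; grab_loop r"

text \<open>Stated in continuation style: a run that goes on after \<open>t\<close> has been read is
  extended to one that starts with \<open>t\<close>. For a node the right subtree is prepended
  first, then the left one.\<close>

lemma runs_grab_loop:
  assumes "r \<noteq> RA" "r \<noteq> RB"
    and "runs (grab_loop r) (s(RA := w, RB := replicate n True, r := rev (code t) @ v)) k s'"
  shows "runs (grab_loop r) (s(RA := code t @ w, RB := replicate (Suc n) True, r := v))
    (k + 7 * length (code t)) s'"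
  using assms(3)
proof (induction t arbitrary: n w v k)
  case Leaf
  then show ?case
    unfolding grab_loop_def using assms(1,2)
    by (elim runs_While_body[rotated 2]) (auto simp: fun_eq_iff)
next
  case (Node t1 t2)
  have "runs (grab_loop r) (s(RA := code t2 @ w, RB := replicate (Suc n) True,
      r := rev (code t1) @ True # v)) (k + 7 * length (code t2)) s'"
    by (rule Node.IH(2)) (use Node.prems
        in \<open>simp only: code.simps rev.simps rev_append append_assoc append.simps\<close>)
  from Node.IH(1)[OF this] show ?case
    unfolding grab_loop_def using assms(1,2)
    by (elim runs_While_body[rotated 2]) (auto simp: fun_eq_iff)
qed

lemma runs_grab:
  assumes "r \<noteq> RA" "r \<noteq> RB" "s RA = code t @ w" "s RB = []"
    and "s' = s(RA := w, r := rev (code t) @ s r)" "7 * length (code t) + 3 \<le> u"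
  shows "runs (grab r) s u s'"
proof -
  have "runs (grab_loop r) (s(RA := w, RB := replicate 0 True, r := rev (code t) @ s r)) 1 s'"
    unfolding grab_loop_def using assms by (intro runs_While_False) (auto simp: fun_eq_iff)
  from runs_grab_loop[OF assms(1,2) this]
  have "runs (grab_loop r) (s(RA := code t @ w, RB := replicate (Suc 0) True, r := s r))
      (1 + 7 * length (code t)) s'" .
  also have "s(RA := code t @ w, RB := replicate (Suc 0) True, r := s r) = s(RB := [True])"
    using assms by (auto simp: fun_eq_iff)
  finally have *: "runs (grab_loop r) (s(RB := [True])) (1 + 7 * length (code t)) s'" .
  show ?thesis unfolding grab_def
    by (rule runs_Seq[OF runs_Push * ]) (use assms in auto)
qed

section \<open>Moving, copying and comparing trees\<close>

abbreviation stack :: "bool list \<Rightarrow> store" where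
  "stack w \<equiv> store w [] [] []"

definition drop_tree :: com where
  "drop_tree = grab RC ;; clear RC"

lemma runs_drop_tree:
  "runs drop_tree (stack (code t @ w)) (9 * length (code t) + 4) (stack w)"
  unfolding drop_tree_def
  by (rule runs_Seq[OF runs_grab[OF _ _ _ _ refl order_refl] runs_clear[OF _ order_refl]]) auto

definition swap_trees :: com where
  "swap_trees = grab RC ;; grab RD ;; transfer RC RA ;; transfer RD RA"

lemma runs_swap_trees:
  "runs swap_trees (stack (code t @ code t' @ w)) (12 * length (code t) + 12 * length (code t') + 8)
    (stack (code t' @ code t @ w))"
  unfolding swap_trees_def
  apply (rule runs_Seq[OF runs_grab[OF _ _ _ _ refl order_refl]
      runs_Seq[OF runs_grab[OF _ _ _ _ refl order_refl] 
        runs_Seq[OF runs_transfer[OF _ refl order_refl] runs_transfer[OF _ _ order_refl]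
            order_refl] order_refl]])
  by auto

definition copy_back :: com where
  "copy_back = While RC nonblank (Cond RC is_one (Pop RC ;; Push RA True ;; Push RD True)
     (Pop RC ;; Push RA False ;; Push RD False))"

lemma runs_copy_back:
  "runs copy_back (store w [] u v) (7 * length u + 1) (store (rev u @ w) [] [] (rev u @ v))"
proof (induction u arbitrary: w v)
  case Nil
  show ?case unfolding copy_back_def by (intro runs_While_False) auto
next
  case (Cons b u)
  from Cons.IH[of "b # w" "b # v"] show ?case
    unfolding copy_back_def by (elim runs_While_body[rotated 2]) auto
qed

text \<open>\<open>copy_back\<close> leaves the second copy on \<open>RD\<close> in the original
  order; a single transfer would reverse it, hence the detour through \<open>RC\<close>.\<close>

definition dup_tree :: com where
  "dup_tree = grab RC ;; copy_back ;; transfer RD RC ;; transfer RC RA"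

lemma runs_dup_tree:
  "runs dup_tree (stack (code t @ w)) (24 * length (code t) + 6) (stack (code t @ code t @ w))"
proof -
  have 1: "runs (grab RC) (stack (code t @ w)) (7 * length (code t) + 3)
      (store w [] (rev (code t)) [])"
    by (intro runs_grab) auto
  have 2: "runs (transfer RD RC ;; transfer RC RA) (store (code t @ w) [] [] (code t))
      (10 * length (code t) + 2) (stack (code t @ code t @ w))"
    by (intro runs_Seq[OF runs_transfer[OF _ refl order_refl] runs_transfer[OF _ _ order_refl]])
        auto
  show ?thesis unfolding dup_tree_def
    by (rule runs_Seq[OF 1 runs_Seq[OF runs_copy_back _ order_refl]]) (use 2 in auto)
qed

text \<open>The push followed by a pop serves as the empty program. The last symbol is pushed first,
  so \<open>v\<close> ends up in reading order.\<close>

definition push_word :: "bool list \<Rightarrow> com" where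
  "push_word v = foldr (\<lambda>b c. c ;; Push RA b) v (Push RA True ;; Pop RA)"

lemma runs_push_word: "runs (push_word v) (stack w) (2 * length v + 3) (stack (v @ w))"
proof (induction v)
  case Nil
  show ?case unfolding push_word_def by (intro runs_loop_freeI) auto
next
  case (Cons b v)
  have "push_word (b # v) = push_word v ;; Push RA b" by (simp add: push_word_def)
  then show ?case by (auto intro!: runs_Seq[OF Cons] runs_Push)
qed

text \<open>Both words are consumed; RB collects one mark for every difference.\<close>

definition compare :: com where
  "compare = While RC nonblank (Cond RC is_one
      (Cond RD is_one (Pop RC ;; Pop RD) (Pop RC ;; Push RB True))
      (Cond RD (\<lambda>x. x = 1) (Pop RC ;; Pop RD) (Pop RC ;; Push RB True))) ;;
    While RD nonblank (Pop RD ;; Push RB True)"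

text \<open>After a mismatch \<open>RD\<close> is not popped and the comparison continues out of
  step; the mark on \<open>RB\<close> has already recorded the difference. Only the emptiness of
  \<open>m\<close> is informative; its length is bounded to pay for clearing it.\<close>

lemma runs_compare:
  "\<exists>m. runs compare (store w b u v) (6 * length u + 4 * length v + 2) (store w m [] []) \<and>
     (m = [] \<longleftrightarrow> b = [] \<and> u = v) \<and> length m \<le> length b + length u + length v"
proof -
  have rest: "runs (While RD nonblank (Pop RD ;; Push RB True)) (store w b [] v) (4 * length v + 1)
     (store w (replicate (length v) True @ b) [] [])" for b v
  proof (induction v arbitrary: b)
    case Nil
    show ?case by (intro runs_While_False) auto
  next
    case (Cons c v)
    from Cons.IH[of "True # b"] show ?case
      by (elim runs_While_body[rotated 2]) (auto simp: replicate_app_Cons_same)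
  qed
  let ?W = "While RC nonblank (Cond RC is_one
      (Cond RD is_one (Pop RC ;; Pop RD) (Pop RC ;; Push RB True))
      (Cond RD (\<lambda>x. x = 1) (Pop RC ;; Pop RD) (Pop RC ;; Push RB True)))"
  have "\<exists>m v'. runs ?W (store w b u v) (6 * length u + 1) (store w m [] v') \<and>
     (m = [] \<and> v' = [] \<longleftrightarrow> b = [] \<and> u = v) \<and> length m + length v' \<le> length b + length u + length v \<and>
     length v' \<le> length v"
  proof (induction u arbitrary: b v)
    case Nil
    show ?case by (rule exI[of _ b], rule exI[of _ v]) (auto intro: runs_While_False)
  next
    case (Cons c u)
    show ?case
    proof (cases "\<exists>v1. v = c # v1")
      case True
      then obtain v1 where v: "v = c # v1" by auto
      from Cons.IH[of b v1] obtain m v' where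
        "runs ?W (store w b u v1) (6 * length u + 1) (store w m [] v')"
        "m = [] \<and> v' = [] \<longleftrightarrow> b = [] \<and> u = v1"
            "length m + length v' \<le> length b + length u + length v1"
        "length v' \<le> length v1"
        by blast
      moreover from this(1) have
          "runs ?W (store w b (c # u) v) (6 * length (c # u) + 1) (store w m [] v')"
        by (elim runs_While_body[rotated 2]) (use v in auto)
      ultimately show ?thesis using v
        by (intro exI[of _ m] exI[of _ v']) auto
    next
      case False
      from Cons.IH[of "True # b" v] obtain m v' where
        "runs ?W (store w (True # b) u v) (6 * length u + 1) (store w m [] v')"
        "m \<noteq> [] \<or> v' \<noteq> []" "length m + length v' \<le> Suc (length b + length u + length v)"
        "length v' \<le> length v"
        by auto
      moreover from this(1) have
          "runs ?W (store w b (c # u) v) (6 * length (c # u) + 1) (store w m [] v')"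
        by (elim runs_While_body[rotated 2]) (use False in \<open>cases v; auto\<close>)+
      ultimately show ?thesis using False
        by (intro exI[of _ m] exI[of _ v']) auto
    qed
  qed
  then obtain m v' where *: "runs ?W (store w b u v) (6 * length u + 1) (store w m [] v')"
    "m = [] \<and> v' = [] \<longleftrightarrow> b = [] \<and> u = v" "length m + length v' \<le> length b + length u + length v"
    "length v' \<le> length v"
    by auto
  have "runs compare (store w b u v) (6 * length u + 4 * length v + 2)
      (store w (replicate (length v') True @ m) [] [])"
    unfolding compare_def by (rule runs_Seq[OF *(1) rest]) (use *(4) in simp)
  moreover have "replicate (length v') True @ m = [] \<longleftrightarrow> b = [] \<and> u = v" using *(2) by auto
  moreover have "length (replicate (length v') True @ m) \<le> length b + length u + length v"
      using *(3) by simp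
  ultimately show ?thesis by blast
qed

section \<open>Functions computed in polynomial time on encoded data\<close>

class treeable =
  fixes tr :: "'a \<Rightarrow> tree"
  assumes tr_inject: "tr x = tr y \<longleftrightarrow> x = y"

instantiation tree :: treeable
begin
definition tr_tree :: "tree \<Rightarrow> tree" where "tr_tree t = t"
instance by standard (simp add: tr_tree_def)
end

instantiation unit :: treeable
begin
definition tr_unit :: "unit \<Rightarrow> tree" where "tr_unit t = Leaf"
instance by standard (simp add: tr_unit_def)
end

instantiation bool :: treeable
begin
definition tr_bool :: "bool \<Rightarrow> tree" where "tr_bool b = (if b then Node Leaf Leaf else Leaf)"
instance by standard (simp add: tr_bool_def)
end

text \<open>Unary numbers have the same trees as lists of units, so counting and list recursion can
  be exchanged at no cost.\<close>

instantiation nat :: treeable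
begin
primrec tr_nat :: "nat \<Rightarrow> tree" where
  "tr_nat 0 = Leaf"
| "tr_nat (Suc n) = Node Leaf (tr_nat n)"
instance
proof
  show "tr m = tr n \<longleftrightarrow> m = n" for m n :: nat
    by (induction m arbitrary: n; case_tac n) auto
qed
end

instantiation prod :: (treeable, treeable) treeable
begin
definition tr_prod :: "'a \<times> 'b \<Rightarrow> tree" where "tr_prod p = Node (tr (fst p)) (tr (snd p))"
instance by standard (auto simp: tr_prod_def tr_inject prod_eq_iff)
end

instantiation list :: (treeable) treeable
begin
primrec tr_list :: "'a list \<Rightarrow> tree" where
  "tr_list [] = Leaf"
| "tr_list (x # xs) = Node (tr x) (tr_list xs)"
instance
proof
  show "tr xs = tr ys \<longleftrightarrow> xs = ys" for xs ys :: "'a list"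
    by (induction xs arbitrary: ys; case_tac ys) (auto simp: tr_inject)
qed
end

definition tsize :: "'a::treeable \<Rightarrow> nat" where
  "tsize x = length (code (tr x))"

lemma tsize_Pair [simp]: "tsize (x, y) = Suc (tsize x + tsize y)"
  by (simp add: tsize_def tr_prod_def)

lemma tsize_list [simp]: "tsize [] = 1" "tsize (x # xs) = Suc (tsize x + tsize xs)"
  by (simp_all add: tsize_def)

lemma tsize_nat [simp]: "tsize (n :: nat) = 2 * n + 1"
  by (induction n) (simp_all add: tsize_def)

lemma tsize_bool: "tsize (b :: bool) \<le> 3"
  by (simp add: tsize_def tr_bool_def)

lemma tsize_fst: "tsize p = Suc (tsize (fst p) + tsize (snd p))"
  by (cases p) simp

lemma length_le_tsize: "length xs \<le> tsize xs"
  by (induction xs) auto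

text \<open>The rest \<open>w\<close> of the stack is arbitrary and does not enter the time bound,
  so a program can run while other values wait below its argument. The other three stacks are empty
  before and after.\<close>

definition feasible :: "('a::treeable \<Rightarrow> 'b::treeable) \<Rightarrow> bool" where
  "feasible f \<longleftrightarrow> (\<exists>c p. \<forall>x w. runs c (stack (code (tr x) @ w)) (poly p (tsize x))
     (stack (code (tr (f x)) @ w)))"

lemma feasibleI:
  assumes "\<And>x w. runs c (stack (code (tr x) @ w)) (poly p (tsize x)) (stack (code (tr (f x)) @ w))"
  shows "feasible f"
  using assms unfolding feasible_def by blast

lemma feasibleE:
  assumes "feasible f"
  obtains c p where
    "\<And>x w. runs c (stack (code (tr x) @ w)) (poly p (tsize x)) (stack (code (tr (f x)) @ w))"
  using assms unfolding feasible_def by blast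

lemma poly_nat_mono: "m \<le> n \<Longrightarrow> poly p m \<le> poly p n" for p :: "nat poly"
  by (induction p) (auto intro: add_mono mult_mono)

lemma feasible_tsize:
  assumes "feasible f"
  obtains p where "\<And>x. tsize (f x) \<le> poly p (tsize x)"
proof -
  from assms obtain c p where
    *: "\<And>x w. runs c (stack (code (tr x) @ w)) (poly p (tsize x)) (stack (code (tr (f x)) @ w))"
    by (rule feasibleE) blast
  have "tsize (f x) \<le> poly ([:0, 1:] + p) (tsize x)" for x
    using runs_length[OF *[of x "[]"], of RA] by (simp add: tsize_def)
  then show ?thesis by (rule that)
qed

lemma feasible_comp:
  assumes "feasible f" "feasible g"
  shows "feasible (\<lambda>x. g (f x))"
proof -
  from assms(1) obtain c p where
    c: "\<And>x w. runs c (stack (code (tr x) @ w)) (poly p (tsize x)) (stack (code (tr (f x)) @ w))"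
    by (rule feasibleE) blast
  from assms(2) obtain d q where
    d: "\<And>x w. runs d (stack (code (tr x) @ w)) (poly q (tsize x)) (stack (code (tr (g x)) @ w))"
    by (rule feasibleE) blast
  from assms(1) obtain r where r: "\<And>x. tsize (f x) \<le> poly r (tsize x)"
    by (rule feasible_tsize) blast
  show ?thesis
    by (rule feasibleI[where c = "c ;; d" and p = "p + pcompose q r"])
      (use poly_nat_mono[OF r] in \<open>auto simp: poly_pcompose intro!: runs_Seq[OF c d]\<close>)
qed

text \<open>Passing to another type with the same tree requires no computation; the program is a
  push undone by a pop.\<close>

lemma feasible_cast:
  assumes "\<And>x. tr (f x) = tr x"
  shows "feasible f"
  by (rule feasibleI[where c = "Push RA True ;; Pop RA" and p = "[:3:]"])
    (auto simp: assms intro!: runs_loop_freeI)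

lemma feasible_const: "feasible (\<lambda>x. y)"
proof (rule feasibleI)
  fix x :: 'a and w
  show "runs (drop_tree ;; push_word (code (tr y))) (stack (code (tr x) @ w))
    (poly [:2 * tsize y + 7, 9:] (tsize x)) (stack (code (tr y) @ w))"
    by (rule runs_Seq[OF runs_drop_tree runs_push_word]) (simp add: tsize_def)
qed

text \<open>Duplicate the argument, apply \<open>g\<close> on top, swap, apply \<open>f\<close>; a
  leading \<open>True\<close> joins the two results to a node.\<close>

lemma feasible_Pair:
  assumes "feasible f" "feasible g"
  shows "feasible (\<lambda>x. (f x, g x))"
proof -
  from assms(1) obtain c p where
    c: "\<And>x w. runs c (stack (code (tr x) @ w)) (poly p (tsize x)) (stack (code (tr (f x)) @ w))"
    by (rule feasibleE) blast
  from assms(2) obtain d q where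
    d: "\<And>x w. runs d (stack (code (tr x) @ w)) (poly q (tsize x)) (stack (code (tr (g x)) @ w))"
    by (rule feasibleE) blast
  from assms(2) obtain r where r: "\<And>x. tsize (g x) \<le> poly r (tsize x)"
    by (rule feasible_tsize) blast
  show ?thesis
  proof (rule feasibleI)
    fix x w
    have 1: "runs (c ;; Push RA True) (stack (code (tr x) @ code (tr (g x)) @ w))
        (poly p (tsize x) + 2)
        (stack (code (tr (f x, g x)) @ w))"
      by (rule runs_Seq[OF c runs_Push]) (auto simp: tr_prod_def)
    show "runs (dup_tree ;; d ;; swap_trees ;; c ;; Push RA True) (stack (code (tr x) @ w))
        (poly ([:16, 36:] + q + p + smult 12 r) (tsize x)) (stack (code (tr (f x, g x)) @ w))"
      by (rule runs_Seq[OF runs_dup_tree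
          runs_Seq[OF d runs_Seq[OF runs_swap_trees 1 order_refl] order_refl]])
       (use r[of x] in \<open>simp add: tsize_def algebra_simps\<close>)
  qed
qed

lemma feasible_fst': "feasible fst"
proof (rule feasibleI)
  fix x :: "'a \<times> 'b" and w
  show "runs (Pop RA ;; swap_trees ;; drop_tree) (stack (code (tr x) @ w))
    (poly [:13, 24:] (tsize x)) (stack (code (tr (fst x)) @ w))"
    apply (rule runs_Seq[OF runs_Pop[OF order_refl refl]])
     apply (rule runs_Seq[of _ _ "12 * tsize (fst x) + 12 * tsize (snd x) + 8" _ _
         "9 * tsize (snd x) + 4"])
       apply (use runs_swap_trees[of "tr (fst x)" "tr (snd x)" w]
           in \<open>simp add: tr_prod_def tsize_def\<close>)
      apply (simp add: tsize_def runs_drop_tree)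
     apply (rule order_refl)
    apply (simp add: tsize_fst[of x])
    done
qed

lemma feasible_snd': "feasible snd"
proof (rule feasibleI)
  fix x :: "'a \<times> 'b" and w
  show "runs (Pop RA ;; drop_tree) (stack (code (tr x) @ w))
    (poly [:5, 9:] (tsize x)) (stack (code (tr (snd x)) @ w))"
    apply (rule runs_Seq[OF runs_Pop[OF order_refl refl]])
     apply (use runs_drop_tree[of "tr (fst x)" "code (tr (snd x)) @ w"] in \<open>simp add: tr_prod_def\<close>)
    apply (use tsize_fst[of x] in \<open>simp add: tsize_def\<close>)
    done
qed

lemma feasible_eq':
  assumes "feasible f" "feasible g"
  shows "feasible (\<lambda>x. f x = g x)"
proof -
  have "feasible (\<lambda>p :: 'b \<times> 'b. fst p = snd p)"
  proof (rule feasibleI)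
    fix x :: "'b \<times> 'b" and w
    let ?a = "code (tr (fst x))" and ?b = "code (tr (snd x))"
    \<comment> \<open>The branches push the codes of \<open>False\<close> and of
      \<open>True\<close>, each from its last symbol.\<close>
    let ?c = "Cond RB nonblank (clear RB ;; Push RA False)
        (Push RA False ;; Push RA False ;; Push RA True)"
    obtain m where m: "runs compare (store w [] (rev ?a) (rev ?b))
        (6 * length ?a + 4 * length ?b + 2)
        (store w m [] [])" "m = [] \<longleftrightarrow> fst x = snd x" "length m \<le> length ?a + length ?b"
      using runs_compare[of w "[]" "rev ?a" "rev ?b"] by (auto simp: code_inject tr_inject)
    have c: "runs ?c (store w m [] []) (2 * length ?a + 2 * length ?b + 7)
        (stack (code (tr (fst x = snd x)) @ w))"
    proof (cases "m = []")
      case True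
      then show ?thesis using m(2) by (intro runs_loop_freeI runs_Cond) (auto simp: tr_bool_def)
    next
      case False
      then obtain b m' where "m = b # m'" by (cases m) auto
      then have "runs (clear RB ;; Push RA False) (store w m [] []) (2 * length m + 3)
          (stack (code (tr (fst x = snd x)) @ w))"
        using m(2) by (intro runs_Seq[OF runs_clear[OF refl order_refl] runs_Push[OF order_refl]])
          (auto simp: tr_bool_def)
      then show ?thesis using m(3) \<open>m = b # m'\<close> by (intro runs_Cond) auto
    qed
    have 1: "runs (grab RD) (store (?b @ w) [] (rev ?a) []) (7 * length ?b + 3)
        (store w [] (rev ?a) (rev ?b))"
      by (intro runs_grab) auto
    have 2: "runs (grab RC) (stack (?a @ ?b @ w)) (7 * length ?a + 3)
        (store (?b @ w) [] (rev ?a) [])"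
      by (intro runs_grab) auto
    show "runs (Pop RA ;; grab RC ;; grab RD ;; compare ;; ?c) (stack (code (tr x) @ w))
      (poly [:16, 20:] (tsize x)) (stack (code (tr (fst x = snd x)) @ w))"
      apply (rule runs_Seq[OF runs_Pop[OF order_refl refl]])
       apply (use runs_Seq[OF 2 runs_Seq[OF 1 runs_Seq[OF m(1) c order_refl] order_refl]
           order_refl] 
            in \<open>simp add: tr_prod_def\<close>)
      apply (use tsize_fst[of x] in \<open>simp add: tsize_def\<close>)
      done
  qed
  from feasible_comp[OF feasible_Pair[OF assms] this] show ?thesis by simp
qed

text \<open>The value \<open>y\<close> given to \<open>f\<close> may have any type, provided that
  its tree is that of \<open>t x\<close>. Thus a nonempty list is received as the pair of its head
  and tail, and \<open>True\<close> as a pair of units.\<close>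

lemma feasible_branch:
  fixes t :: "'a::treeable \<Rightarrow> 'b::treeable" and f :: "'a \<times> 'c::treeable \<Rightarrow> 'd::treeable"
  assumes "feasible t" "feasible a" "feasible f"
    and h: "\<And>x. if tr (t x) = Leaf then h x = a x else \<exists>y. tr (t x) = tr y \<and> h x = f (x, y)"
  shows "feasible h"
proof -
  from assms(1) obtain c p where
    c: "\<And>x w. runs c (stack (code (tr x) @ w)) (poly p (tsize x)) (stack (code (tr (t x)) @ w))"
    by (rule feasibleE) blast
  from assms(2) obtain d q where
    d: "\<And>x w. runs d (stack (code (tr x) @ w)) (poly q (tsize x)) (stack (code (tr (a x)) @ w))"
    by (rule feasibleE) blast
  from assms(3) obtain e r where
    e: "\<And>x w. runs e (stack (code (tr x) @ w)) (poly r (tsize x)) (stack (code (tr (f x)) @ w))"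
    by (rule feasibleE) blast
  from assms(1) obtain s where s: "\<And>x. tsize (t x) \<le> poly s (tsize x)"
    by (rule feasible_tsize) blast
  let ?c = "Cond RA is_one (swap_trees ;; Push RA True ;; e) (Pop RA ;; d)"
  let ?p = "[:18, 36:] + p + q + smult 12 s + pcompose r ([:1, 1:] + s)"
  show ?thesis
  proof (rule feasibleI)
    fix x w
    let ?T = "\<lambda>n. 12 * poly s n + 12 * n + 10 + poly r (1 + n + poly s n) + 1 + poly q n"
    have branch: "runs ?c (stack (code (tr (t x)) @ code (tr x) @ w)) (?T (tsize x) + 1)
        (stack (code (tr (h x)) @ w))"
    proof (cases "tr (t x) = Leaf")
      case True
      then have "runs (Pop RA ;; d) (stack (code (tr (t x)) @ code (tr x) @ w))
          (1 + poly q (tsize x)) (stack (code (tr (h x)) @ w))"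
        using h[of x] d[of x w] by (intro runs_Seq[OF runs_Pop[OF order_refl refl] _ order_refl])
            auto
      with True show ?thesis by (intro runs_Cond[where t = "1 + poly q (tsize x)"]) auto
    next
      case False
      with h[of x] obtain y where y: "tr (t x) = tr y" "h x = f (x, y)" by auto
      from False obtain u v where uv: "tr (t x) = Node u v" by (cases "tr (t x)") auto
      have le: "tsize (x, y) \<le> 1 + tsize x + poly s (tsize x)"
        using s[of x] y(1) by (simp add: tsize_def[of y] tsize_def[of "t x"])
      have 1: "runs (Push RA True ;; e) (stack (code (tr x) @ code (tr (t x)) @ w))
          (2 + poly r (1 + tsize x + poly s (tsize x))) (stack (code (tr (h x)) @ w))"
        using poly_nat_mono[OF le, of r] e[of "(x, y)" w] y
        by (intro runs_Seq[OF runs_Push[OF order_refl refl]]) (auto simp: tr_prod_def)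
      have "runs (swap_trees ;; Push RA True ;; e) (stack (code (tr (t x)) @ code (tr x) @ w))
          (?T (tsize x)) (stack (code (tr (h x)) @ w))"
        by (rule runs_Seq[OF runs_swap_trees 1]) (use s[of x] in \<open>simp add: tsize_def\<close>)
      moreover have "top_symbol (code (tr (t x)) @ code (tr x) @ w) = 2" using uv by simp
      ultimately have "runs (if is_one (top_symbol (stack (code (tr (t x)) @ code (tr x) @ w) RA))
          then swap_trees ;; Push RA True ;; e else Pop RA ;; d)
          (stack (code (tr (t x)) @ code (tr x) @ w)) (?T (tsize x)) (stack (code (tr (h x)) @ w))"
        by (simp only: store_simps simp_thms if_True)
      then show ?thesis by (rule runs_Cond) linarith
    qed
    show "runs (dup_tree ;; c ;; ?c) (stack (code (tr x) @ w)) (poly ?p (tsize x))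
        (stack (code (tr (h x)) @ w))"
      by (rule runs_Seq[OF runs_dup_tree runs_Seq[OF c branch order_refl]])
        (simp add: tsize_def poly_pcompose algebra_simps)
  qed
qed

text \<open>The first component controls the loop, which stops when its tree is a leaf. The
  polynomial \<open>P\<close> must also bound the intermediate states, since feasibility of
  \<open>g\<close> alone would allow their sizes to explode.\<close>

lemma feasible_while:
  fixes g h :: "'l::treeable \<times> 's::treeable \<Rightarrow> 'l \<times> 's" and P :: "nat poly"
  assumes "feasible g"
    and h: "\<And>x. \<exists>n \<le> poly P (tsize x). h x = (g ^^ n) x \<and> tr (fst ((g ^^ n) x)) = Leaf \<and>
      (\<forall>i<n. tr (fst ((g ^^ i) x)) \<noteq> Leaf \<and> tsize ((g ^^ i) x) \<le> poly P (tsize x))"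
  shows "feasible h"
proof -
  from assms(1) obtain c p where
    c: "\<And>x w. runs c (stack (code (tr x) @ w)) (poly p (tsize x)) (stack (code (tr (g x)) @ w))"
    by (rule feasibleE) blast
  \<comment> \<open>Between rounds the leading \<open>True\<close> of the pair is removed, so that
    the top symbol tells whether the control component is a leaf.\<close>
  let ?body = "Push RA True ;; c ;; Pop RA"
  let ?loop = "While RA is_one ?body"
  have code_hd: "code (tr x) = True # tl (code (tr x))" for x :: "'l \<times> 's" by
      (simp add: tr_prod_def)
  have body: "runs ?body (stack (tl (code (tr x)) @ w)) (poly p (tsize x) + 3)
      (stack (tl (code (tr (g x))) @ w))" for x w
  proof -
    have 1: "runs (c ;; Pop RA) (stack (code (tr x) @ w)) (poly p (tsize x) + 1)
        (stack (tl (code (tr (g x))) @ w))"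
      by (rule runs_Seq[OF c runs_Pop[OF order_refl]]) (subst (1) code_hd, auto)
    show ?thesis
      by (rule runs_Seq[OF runs_Push[OF order_refl refl]], use 1
          in \<open>simp flip: code_hd append_Cons\<close>, simp)
  qed
  have top: "top_symbol (tl (code (tr x)) @ w) = 2 \<longleftrightarrow> tr (fst x) \<noteq> Leaf" for x :: "'l \<times> 's" and w
    by (cases "tr (fst x)") (auto simp: tr_prod_def)
  have loop: "runs ?loop (stack (tl (code (tr x)) @ w)) (n * (poly p B + 4) + 1)
      (stack (tl (code (tr ((g ^^ n) x))) @ w))"
    if "tr (fst ((g ^^ n) x)) = Leaf"
        "\<forall>i<n. tr (fst ((g ^^ i) x)) \<noteq> Leaf \<and> tsize ((g ^^ i) x) \<le> B" for n x w B
    using that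
  proof (induction n arbitrary: x)
    case 0
    then show ?case by (intro runs_While_False) (auto simp: top)
  next
    case (Suc n)
    have *: "tr (fst ((g ^^ i) (g x))) \<noteq> Leaf \<and> tsize ((g ^^ i) (g x)) \<le> B" if "i < n" for i
      using Suc.prems(2)[rule_format, of "Suc i"] that unfolding funpow_Suc_apply by blast
    have "runs ?loop (stack (tl (code (tr (g x))) @ w)) (n * (poly p B + 4) + 1)
        (stack (tl (code (tr ((g ^^ n) (g x)))) @ w))"
    proof (rule Suc.IH)
      show "tr (fst ((g ^^ n) (g x))) = Leaf" using Suc.prems(1) by (simp only: funpow_Suc_apply)
    qed (use * in blast)
    moreover have "poly p (tsize x) \<le> poly p B" "tr (fst x) \<noteq> Leaf"
      using Suc.prems(2)[rule_format, of 0] by (simp_all add: poly_nat_mono)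
    ultimately show ?case
      unfolding funpow_Suc_apply
      by (elim runs_While_True[OF _ body, rotated]) (simp_all add: top)
  qed
  show ?thesis
  proof (rule feasibleI)
    fix x w
    obtain n where n: "n \<le> poly P (tsize x)" "h x = (g ^^ n) x" "tr (fst ((g ^^ n) x)) = Leaf"
      "\<forall>i<n. tr (fst ((g ^^ i) x)) \<noteq> Leaf \<and> tsize ((g ^^ i) x) \<le> poly P (tsize x)"
      using h by blast
    have 1: "runs (?loop ;; Push RA True) (stack (tl (code (tr x)) @ w))
       (n * (poly p (poly P (tsize x)) + 4) + 3) (stack (code (tr (h x)) @ w))"
      by (rule runs_Seq[OF loop[OF n(3,4)] runs_Push[OF order_refl]])
       (simp_all add: n(2) flip: code_hd append_Cons)
    show "runs (Pop RA ;; ?loop ;; Push RA True) (stack (code (tr x) @ w))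
        (poly (P * (pcompose p P + [:4:]) + [:4:]) (tsize x)) (stack (code (tr (h x)) @ w))"
      apply (rule runs_Seq[OF runs_Pop[OF order_refl refl]])
       apply (use 1 code_hd[of x] in \<open>simp add: tr_prod_def\<close>)
      apply (use n(1) in \<open>simp add: poly_pcompose\<close>)
      done
  qed
qed

section \<open>Words on tapes\<close>

text \<open>The word arrives reversed, as \<open>transfer\<close> leaves it, so the list is built
  from its end by putting cells in front.\<close>

definition wrap :: "reg \<Rightarrow> com" where
  "wrap r = Push RA False ;; While r nonblank (Cond r is_one
     (Pop r ;; Push RA False ;; Push RA False ;; Push RA True ;; Push RA True)
     (Pop r ;; Push RA False ;; Push RA True))"

lemma runs_wrap:
  assumes "r \<noteq> RA" "s r = rev x" "s' = s(RA := code (tr x) @ s RA, r := [])" "11 * length x + 3 \<le> t"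
  shows "runs (wrap r) s t s'"
proof -
  let ?W = "While r nonblank (Cond r is_one
     (Pop r ;; Push RA False ;; Push RA False ;; Push RA True ;; Push RA True)
     (Pop r ;; Push RA False ;; Push RA True))"
  have *: "runs ?W (s(RA := code (tr y) @ w, r := v)) (11 * length v + 1)
      (s(RA := code (tr (rev v @ y)) @ w, r := []))"
    for v y w
  proof (induction v arbitrary: y)
    case Nil
    show ?case by (intro runs_While_False) auto
  next
    case (Cons b v)
    from Cons.IH[of "b # y"] show ?case
      using assms(1) by (elim runs_While_body[rotated 2]) (auto simp: tr_bool_def fun_eq_iff)
  qed
  show ?thesis unfolding wrap_def
    apply (rule runs_Seq[OF runs_Push[OF order_refl refl]])
     apply (use *[of "[]" "s RA" "rev x"] assms(1,2,3) in \<open>simp add: fun_upd_idem fun_upd_twist\<close>)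
    apply (use assms(4) in simp)
    done
qed

definition unwrap :: com where
  "unwrap = While RA is_one (Pop RA ;; Cond RA is_one
     (Pop RA ;; Pop RA ;; Pop RA ;; Push RC True) (Pop RA ;; Push RC False)) ;;
   Pop RA ;; transfer RC RA"

lemma runs_unwrap:
  "runs unwrap (stack (code (tr (x :: bool list)))) (13 * length x + 3) (stack x)"
proof -
  let ?W = "While RA is_one (Pop RA ;; Cond RA is_one
     (Pop RA ;; Pop RA ;; Pop RA ;; Push RC True) (Pop RA ;; Push RC False))"
  have *: "runs ?W (store (code (tr x)) [] v []) (8 * length x + 1)
      (store [False] [] (rev x @ v) [])"
    for v and x :: "bool list"
  proof (induction x arbitrary: v)
    case Nil
    show ?case by (intro runs_While_False) auto
  next
    case (Cons b x)
    from Cons.IH[of "b # v"] show ?case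
      by (elim runs_While_body[rotated 2]) (auto simp: tr_bool_def)
  qed
  show ?thesis unfolding unwrap_def
    by (rule runs_Seq[OF * runs_Seq[OF runs_Pop[OF order_refl refl]
        runs_transfer[OF _ _ order_refl] order_refl]]) auto
qed

lemma tsize_word: "tsize (x :: bool list) \<le> 4 * length x + 1"
  by (induction x) (use tsize_bool in \<open>auto intro: order_trans[OF add_mono]\<close>)

lemma runs_polytime:
  assumes "runs c (store x y [] []) t (stack w)" "zs = [x, y] \<or> zs = [x] \<and> y = []" "t \<le> u"
  shows "computes_within (machine (compile c 0 (code_size c))) zs w u"
proof -
  from assms(1) obtain t' where t': "exec c (store x y [] []) t' (stack w)" "t' \<le> t"
      unfolding runs_def by auto
  show ?thesis by (rule exec_computes_within[OF t'(1) _ assms(2)]) (use t'(2) assms(3) in linarith)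
qed

lemma feasible_polytime_fun:
  fixes f :: "bool list \<Rightarrow> bool list"
  assumes "feasible f"
  shows "polytime_fun f"
proof -
  from assms(1) obtain c p where
    c: "\<And>x w. runs c (stack (code (tr x) @ w)) (poly p (tsize x)) (stack (code (tr (f x)) @ w))"
    by (rule feasibleE) blast
  from assms obtain r where r: "\<And>x. tsize (f x) \<le> poly r (tsize x)"
    by (rule feasible_tsize) blast
  let ?c = "transfer RA RC ;; wrap RC ;; c ;; unwrap"
  \<comment> \<open>The inner polynomial \<open>[:1, 4:]\<close> is the bound of
    \<open>tsize_word\<close> for the tree of the input.\<close>
  let ?p = "[:10, 16:] + pcompose (p + smult 13 r) [:1, 4:]"
  have "runs ?c (stack x) (poly ?p (length x)) (stack (f x))" for x
  proof -
    have 1: "runs (transfer RA RC) (stack x) (5 * length x + 1) (store [] [] (rev x) [])"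
      by (rule runs_transfer) auto
    have 2: "runs (wrap RC) (store [] [] (rev x) []) (11 * length x + 3) (stack (code (tr x)))"
      by (rule runs_wrap) auto
    have 3: "runs (c ;; unwrap) (stack (code (tr x))) (poly p (tsize x) + (13 * length (f x) + 3))
        (stack (f x))"
      using runs_Seq[OF c[of x "[]"], unfolded append_Nil2, OF runs_unwrap order_refl] .
    have "length (f x) \<le> poly r (tsize x)" using length_le_tsize[of "f x"] r[of x] by simp
    moreover have "poly r (tsize x) \<le> poly r (1 + 4 * length x)"
        "poly p (tsize x) \<le> poly p (1 + 4 * length x)"
      using tsize_word[of x] by (auto intro!: poly_nat_mono)
    ultimately show ?thesis
      by (intro runs_Seq[OF 1 runs_Seq[OF 2 3 order_refl]]) (simp add: poly_pcompose algebra_simps)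
  qed
  then have "computes_within (machine (compile ?c 0 (code_size ?c))) [x] (f x)
      (poly ?p (length x))" for x
    by (rule runs_polytime) auto
  then show ?thesis unfolding polytime_fun_def using wf_machine by blast
qed

lemma feasible_polytime_rel:
  assumes "feasible (\<lambda>p. [R (fst p) (snd p)])"
  shows "polytime_rel R"
proof -
  from assms(1) obtain c p where
    c: "\<And>x w. runs c (stack (code (tr x) @ w)) (poly p (tsize x))
        (stack (code (tr [R (fst x) (snd x)]) @ w))"
    by (rule feasibleE) blast
  let ?c = "transfer RA RC ;; transfer RB RD ;; wrap RD ;; wrap RC ;; Push RA True ;; c ;; unwrap"
  \<comment> \<open>In \<open>[:3, 4:]\<close> each of the two words contributes 1 to the constant,
    and so does the pair.\<close>
  let ?p = "[:26, 16:] + pcompose p [:3, 4:]"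
  have "runs ?c (store x y [] []) (poly ?p (length x + length y)) (stack [R x y])" for x y
  proof -
    have 1: "runs (transfer RA RC) (store x y [] []) (5 * length x + 1) (store [] y (rev x) [])"
      by (rule runs_transfer) auto
    have 2: "runs (transfer RB RD) (store [] y (rev x) []) (5 * length y + 1)
        (store [] [] (rev x) (rev y))"
      by (rule runs_transfer) auto
    have 3: "runs (wrap RD) (store [] [] (rev x) (rev y)) (11 * length y + 3)
        (store (code (tr y)) [] (rev x) [])"
      by (rule runs_wrap) auto
    have 4: "runs (wrap RC) (store (code (tr y)) [] (rev x) []) (11 * length x + 3)
        (stack (code (tr x) @ code (tr y)))"
      by (rule runs_wrap) auto
    have 5: "runs (Push RA True) (stack (code (tr x) @ code (tr y))) 2 (stack (code (tr (x, y))))"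
      by (rule runs_Push) (auto simp: tr_prod_def)
    have 6: "runs (c ;; unwrap) (stack (code (tr (x, y))))
        (poly p (tsize (x, y)) + (13 * length [R x y] + 3)) (stack [R x y])"
      using runs_Seq[OF c[of "(x, y)" "[]"], unfolded append_Nil2 fst_conv snd_conv,
          OF runs_unwrap order_refl] .
    have "poly p (tsize (x, y)) \<le> poly p (3 + 4 * (length x + length y))"
      using tsize_word[of x] tsize_word[of y] by (auto intro!: poly_nat_mono)
    then show ?thesis
      by (intro runs_Seq[OF 1 runs_Seq[OF 2
          runs_Seq[OF 3 runs_Seq[OF 4 runs_Seq[OF 5 6 order_refl] order_refl] order_refl]
          order_refl]])
        (simp add: poly_pcompose algebra_simps)
  qed
  then have "computes_within (machine (compile ?c 0 (code_size ?c))) [x, y] [R x y]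
      (poly ?p (length x + length y))" for x y
    by (rule runs_polytime) auto
  then show ?thesis unfolding polytime_rel_def using wf_machine machine_simps
    by (intro exI[of _ "machine (compile ?c 0 (code_size ?c))"] exI[of _ ?p])
        (simp del: compile.simps code_size.simps)
qed

section \<open>Feasible operations on lists and numbers\<close>

named_theorems feasible_intros

lemma feasible_id [feasible_intros]: "feasible (\<lambda>x. x)"
  by (rule feasible_cast) simp

lemmas [feasible_intros] = feasible_const feasible_Pair feasible_eq'

lemma feasible_fst [feasible_intros]: "feasible f \<Longrightarrow> feasible (\<lambda>x. fst (f x))"
  by (rule feasible_comp[OF _ feasible_fst'])

lemma feasible_snd [feasible_intros]: "feasible f \<Longrightarrow> feasible (\<lambda>x. snd (f x))"
  by (rule feasible_comp[OF _ feasible_snd'])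

lemma feasible_comp2:
  assumes "feasible (\<lambda>p. F (fst p) (snd p))" "feasible f" "feasible g"
  shows "feasible (\<lambda>x. F (f x) (g x))"
  using feasible_comp[OF feasible_Pair[OF assms(2,3)] assms(1)] by simp

lemma feasible_comp3:
  assumes "feasible (\<lambda>p. F (fst p) (fst (snd p)) (snd (snd p)))" "feasible f" "feasible g"
      "feasible h"
  shows "feasible (\<lambda>x. F (f x) (g x) (h x))"
  using feasible_comp[OF feasible_Pair[OF assms(2) feasible_Pair[OF assms(3,4)]] assms(1)] by simp

lemma feasible_Suc [feasible_intros]:
  assumes "feasible f"
  shows "feasible (\<lambda>x. Suc (f x))"
proof -
  have "feasible (\<lambda>p :: unit \<times> nat. Suc (snd p))"
    by (rule feasible_cast) (auto simp: tr_prod_def tr_unit_def)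
  from feasible_comp[OF feasible_Pair[OF feasible_const[of "()"] assms] this] show ?thesis by simp
qed

lemma feasible_Cons [feasible_intros]:
  assumes "feasible f" "feasible g"
  shows "feasible (\<lambda>x. f x # g x)"
  by (rule feasible_comp2[OF feasible_cast assms]) (simp add: tr_prod_def)

lemma feasible_if [feasible_intros]:
  assumes "feasible b" "feasible f" "feasible g"
  shows "feasible (\<lambda>x. if b x then f x else g x)"
proof (rule feasible_branch[OF assms(1,3)])
  show "feasible (\<lambda>p :: 'a \<times> unit \<times> unit. f (fst p))"
    by (rule feasible_comp[OF feasible_fst' assms(2)])
qed (auto simp: tr_bool_def tr_prod_def tr_unit_def)

lemma feasible_not [feasible_intros]:
  assumes "feasible P"
  shows "feasible (\<lambda>x. \<not> P x)"
proof -
  have *: "(\<lambda>x. \<not> P x) = (\<lambda>x. if P x then False else True)" by auto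
  show ?thesis unfolding * by (intro feasible_intros assms)
qed

lemma feasible_conj [feasible_intros]:
  assumes "feasible P" "feasible Q"
  shows "feasible (\<lambda>x. P x \<and> Q x)"
proof -
  have *: "(\<lambda>x. P x \<and> Q x) = (\<lambda>x. if P x then Q x else False)" by auto
  show ?thesis unfolding * by (intro feasible_intros assms)
qed

lemma feasible_disj [feasible_intros]:
  assumes "feasible P" "feasible Q"
  shows "feasible (\<lambda>x. P x \<or> Q x)"
proof -
  have *: "(\<lambda>x. P x \<or> Q x) = (\<lambda>x. if P x then True else Q x)" by auto
  show ?thesis unfolding * by (intro feasible_intros assms)
qed

lemma feasible_case_list [feasible_intros]:
  assumes "feasible xs" "feasible a" "feasible (\<lambda>p. f (fst p) (fst (snd p)) (snd (snd p)))"
  shows "feasible (\<lambda>x. case xs x of [] \<Rightarrow> a x | y # ys \<Rightarrow> f x y ys)"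
proof (rule feasible_branch[OF assms])
  fix x
  show "if tr (xs x) = Leaf then (case xs x of [] \<Rightarrow> a x | y # ys \<Rightarrow> f x y ys) = a x
    else \<exists>y. tr (xs x) = tr y \<and> (case xs x of [] \<Rightarrow> a x | y # ys \<Rightarrow> f x y ys) =
       f (fst (x, y)) (fst (snd (x, y))) (snd (snd (x, y)))"
    by (cases "xs x") (auto simp: tr_prod_def)
qed

text \<open>Unlike in \<open>foldl\<close>, the step also sees the part of the list still to come;
  \<open>sorted_wrt\<close> and the intervals \<open>[0..<n]\<close> depend on this.\<close>

primrec iter_list :: "('a \<Rightarrow> 'a list \<Rightarrow> 'b \<Rightarrow> 'b) \<Rightarrow> 'a list \<Rightarrow> 'b \<Rightarrow> 'b" where
  "iter_list f [] b = b"
| "iter_list f (a # as) b = iter_list f as (f a as b)"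

text \<open>The accumulator may grow by a polynomial amount in every round, but only additively.\<close>

lemma feasible_iter_list:
  fixes g :: "'x::treeable \<Rightarrow> 'a::treeable \<Rightarrow> 'a list \<Rightarrow> 'b::treeable \<Rightarrow> 'b"
  assumes g: "feasible (\<lambda>p. g (fst p) (fst (fst (snd p))) (snd (fst (snd p))) (snd (snd p)))"
    and growth: "\<exists>q :: nat poly. \<forall>x a as b. tsize (g x a as b) \<le> tsize b
        + poly q (tsize x + tsize (a # as))"
    and "feasible xs" "feasible b0"
  shows "feasible (\<lambda>x. iter_list (g x) (xs x) (b0 x))"
proof -
  \<comment> \<open>The remaining list comes first because it controls the loop; the parameter is
    carried along unchanged.\<close>
  define G :: "'a list \<times> 'x \<times> 'b \<Rightarrow> 'a list \<times> 'x \<times> 'b" where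
    "G s = (case fst s of [] \<Rightarrow> s | a # as \<Rightarrow>
        (as, fst (snd s), g (fst (snd s)) a as (snd (snd s))))" for s
  have feasG: "feasible G"
    unfolding G_def
    apply (intro feasible_intros)
    subgoal
      by (rule feasible_comp[OF _ g, of "\<lambda>p. (fst (snd (fst p)), snd p, snd (snd (fst p)))",
          simplified])
        (intro feasible_intros)
    done
  from growth obtain q :: "nat poly" where q:
      "tsize (g x a as b) \<le> tsize b + poly q (tsize x + tsize (a # as))" for x a as b
    by blast
  \<comment> \<open>\<open>Q\<close> bounds the growth in every round, as \<open>q\<close> is
    monotone and each round works on a suffix of \<open>l\<close>; hence the total growth
    \<open>i * Q\<close>.\<close>
  have iter: "\<exists>l' b'. (G ^^ i) (l, x, b) = (l', x, b') \<and> tsize l' \<le> tsize l \<and> tsize b' \<le> tsize b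
      + i * Q \<and>
      (i < length l \<longrightarrow> l' \<noteq> []) \<and> (i = length l \<longrightarrow> l' = [] \<and> b' = iter_list (g x) l b)"
    if "i \<le> length l" "poly q (tsize x + tsize l) \<le> Q" for i l x b Q
    using that
  proof (induction l arbitrary: i b)
    case Nil
    then show ?case by auto
  next
    case (Cons a l)
    show ?case
    proof (cases i)
      case 0
      then show ?thesis by auto
    next
      case (Suc j)
      have "poly q (tsize x + tsize l) \<le> Q"
        using Cons.prems(2) poly_nat_mono[of "tsize x + tsize l" "tsize x + tsize (a # l)" q] by
            simp
      moreover have "j \<le> length l" using Suc Cons.prems by simp
      ultimately obtain l' b' where
        *: "(G ^^ j) (l, x, g x a l b) = (l', x, b')" "tsize l' \<le> tsize l"
            "tsize b' \<le> tsize (g x a l b) + j * Q"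
        "j < length l \<longrightarrow> l' \<noteq> []" "j = length l \<longrightarrow> l' = [] \<and> b' = iter_list (g x) l (g x a l b)"
        using Cons.IH[of j "g x a l b"] by blast
      have "tsize (g x a l b) \<le> tsize b + Q" using q[of x a l b] Cons.prems(2) by simp
      moreover have "(G ^^ i) (a # l, x, b) = (l', x, b')"
        unfolding Suc funpow_Suc_apply using *(1) by (simp add: G_def)
      ultimately show ?thesis using * Suc by (intro exI[of _ l'] exI[of _ b']) auto
    qed
  qed
  define H :: "'a list \<times> 'x \<times> 'b \<Rightarrow> 'a list \<times> 'x \<times> 'b" where
    "H s = ([], fst (snd s), iter_list (g (fst (snd s))) (fst s) (snd (snd s)))" for s
  have tr_Nil: "tr l = Leaf \<longleftrightarrow> l = []" for l :: "'a list" by (cases l) auto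
  have "feasible H"
  proof (rule feasible_while[OF feasG, where P = "[:0, 1:] + [:0, 1:] * q"])
    fix s :: "'a list \<times> 'x \<times> 'b"
    obtain l x b where s: "s = (l, x, b)" by (cases s) auto
    let ?N = "tsize s"
    have q': "poly q (tsize x + tsize l) \<le> poly q ?N" by (rule poly_nat_mono) (simp add: s)
    have len: "length l \<le> ?N" using length_le_tsize[of l] by (simp add: s)
    have bnd: "tsize ((G ^^ i) s) \<le> poly ([:0, 1:] + [:0, 1:] * q) ?N" if i: "i < length l" for i
    proof -
      obtain l' b' where "(G ^^ i) s = (l', x, b')" "tsize l' \<le> tsize l"
          "tsize b' \<le> tsize b + i * poly q ?N"
        using iter[OF _ q', of i b] i s by auto
      moreover have "i * poly q ?N \<le> ?N * poly q ?N" using i len by (intro mult_right_mono) auto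
      ultimately show ?thesis using s by simp
    qed
    have "fst ((G ^^ i) s) \<noteq> []" if "i < length l" for i
      using iter[OF _ q', of i b] that s by auto
    moreover have "(G ^^ length l) s = H s"
      using iter[OF _ q', of "length l" b] s by (auto simp: H_def)
    moreover have "fst (H s) = []" by (simp add: H_def)
    ultimately show "\<exists>n \<le> poly ([:0, 1:] + [:0, 1:] * q) ?N. H s = (G ^^ n) s \<and>
        tr (fst ((G ^^ n) s)) = Leaf \<and>
      (\<forall>i<n. tr (fst ((G ^^ i) s)) \<noteq> Leaf \<and> tsize ((G ^^ i) s) \<le> poly ([:0, 1:] + [:0, 1:] * q) ?N)"
      using bnd len by (intro exI[of _ "length l"]) (auto simp: tr_Nil)
  qed
  moreover have "feasible (\<lambda>x. (xs x, x, b0 x))" by (intro feasible_intros assms)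
  ultimately have "feasible (\<lambda>x. H (xs x, x, b0 x))" by (rule feasible_comp[rotated])
  from feasible_snd[OF feasible_snd[OF this]] show ?thesis by (simp add: H_def)
qed

lemma foldl_conv_iter_list: "foldl f b xs = iter_list (\<lambda>a as b. f b a) xs b"
  by (induction xs arbitrary: b) auto

lemma feasible_foldl:
  fixes g :: "'x::treeable \<Rightarrow> 'b::treeable \<Rightarrow> 'a::treeable \<Rightarrow> 'b"
  assumes g: "feasible (\<lambda>p. g (fst p) (fst (snd p)) (snd (snd p)))"
    and growth: "\<exists>q :: nat poly. \<forall>x b a. tsize (g x b a) \<le> tsize b + poly q (tsize x + tsize a)"
    and "feasible b0" "feasible xs"
  shows "feasible (\<lambda>x. foldl (g x) (b0 x) (xs x))"
  unfolding foldl_conv_iter_list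
proof (rule feasible_iter_list[OF _ _ assms(4,3)])
  show "feasible (\<lambda>p :: 'x \<times> ('a \<times> 'a list) \<times> 'b. g (fst p) (snd (snd p)) (fst (fst (snd p))))"
    by (rule feasible_comp3[OF g]) (intro feasible_intros)+
  from growth obtain q :: "nat poly" where q:
      "tsize (g x b a) \<le> tsize b + poly q (tsize x + tsize a)" for x b a
    by blast
  have "tsize (g x b a) \<le> tsize b + poly q (tsize x + tsize (a # as))" for x a as b
    using q[of x b a] poly_nat_mono[of "tsize x + tsize a" "tsize x + tsize (a # as)" q] by simp
  then show "\<exists>q :: nat poly. \<forall>x a as b. tsize (g x b a) \<le> tsize b
      + poly q (tsize x + tsize (a # as))"
    by blast
qed

lemma feasible_foldl_const:
  fixes g :: "'x::treeable \<Rightarrow> 'b::treeable \<Rightarrow> 'a::treeable \<Rightarrow> 'b"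
  assumes g: "feasible (\<lambda>p. g (fst p) (fst (snd p)) (snd (snd p)))"
    and growth: "\<And>x b a. tsize (g x b a) \<le> tsize b + k"
    and "feasible b0" "feasible xs"
  shows "feasible (\<lambda>x. foldl (g x) (b0 x) (xs x))"
  using growth by (intro feasible_foldl[OF g _ assms(3,4)] exI[of _ "[:k:]"]) auto

lemma feasible_rev [feasible_intros]:
  assumes "feasible xs"
  shows "feasible (\<lambda>x. rev (xs x))"
proof -
  have "feasible (\<lambda>x. foldl (\<lambda>b a. a # b) [] (xs x))"
    by (rule feasible_foldl) (intro feasible_intros assms exI[of _ "[:1, 1:]"] allI | simp)+
  moreover have "foldl (\<lambda>b a. a # b) v u = rev u @ v" for u v :: "'b list"
    by (induction u arbitrary: v) auto
  ultimately show ?thesis by simp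
qed

lemma feasible_append [feasible_intros]:
  assumes "feasible xs" "feasible ys"
  shows "feasible (\<lambda>x. xs x @ ys x)"
proof -
  have "feasible (\<lambda>x. foldl (\<lambda>b a. a # b) (ys x) (rev (xs x)))"
    by (rule feasible_foldl) (intro feasible_intros assms exI[of _ "[:1, 1:]"] allI | simp)+
  moreover have "foldl (\<lambda>b a. a # b) v u = rev u @ v" for u v :: "'b list"
    by (induction u arbitrary: v) auto
  ultimately show ?thesis by simp
qed

lemma tsize_append: "tsize (xs @ ys) \<le> tsize xs + tsize ys"
  by (induction xs) auto

lemma feasible_concat [feasible_intros]:
  assumes "feasible xs"
  shows "feasible (\<lambda>x. concat (xs x))"
proof -
  have "feasible (\<lambda>x. foldl (\<lambda>b a. a @ b) [] (rev (xs x)))"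
    apply (rule feasible_foldl)
       apply (intro feasible_intros)
      apply (rule exI[of _ "[:0, 1:]"])
      apply (auto intro: order_trans[OF tsize_append])
     apply (intro feasible_intros assms)+
    done
  moreover have "foldl (\<lambda>b a. a @ b) v (rev u) = concat u @ v" for u and v :: "'b list"
    by (induction u arbitrary: v) auto
  ultimately show ?thesis by simp
qed

lemma feasible_map [feasible_intros]:
  assumes "feasible (\<lambda>p. f (fst p) (snd p))" "feasible xs"
  shows "feasible (\<lambda>x. map (f x) (xs x))"
proof -
  obtain p where p: "\<And>x. tsize (f (fst x) (snd x)) \<le> poly p (tsize x)"
    using feasible_tsize[OF assms(1)] by blast
  have growth: "tsize (f x a # b) \<le> tsize b
      + poly ([:1:] + pcompose p [:1, 1:]) (tsize x + tsize a)" for x a and b :: "'c list"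
    using p[of "(x, a)"] by (simp add: poly_pcompose)
  have "feasible (\<lambda>x. rev (foldl (\<lambda>b a. f x a # b) [] (xs x)))"
    apply (intro feasible_intros feasible_foldl)
       apply (rule feasible_comp2[OF assms(1)])
        apply (intro feasible_intros)+
     apply (rule exI[of _ "[:1:] + pcompose p [:1, 1:]"], use growth in blast)
    apply (intro feasible_intros assms)+
    done
  moreover have "foldl (\<lambda>b a. f x a # b) v u = rev (map (f x) u) @ v" for x u v
    by (induction u arbitrary: v) auto
  ultimately show ?thesis by simp
qed

lemma feasible_filter [feasible_intros]:
  assumes "feasible (\<lambda>p. P (fst p) (snd p))" "feasible xs"
  shows "feasible (\<lambda>x. filter (P x) (xs x))"
proof -
  have "feasible (\<lambda>x. concat (map (\<lambda>a. if P x a then [a] else []) (xs x)))"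
    by (intro feasible_intros assms)
  moreover have "concat (map (\<lambda>a. if P x a then [a] else []) u) = filter (P x) u" for x u
    by (induction u) auto
  ultimately show ?thesis by simp
qed

lemma feasible_Bex [feasible_intros]:
  assumes "feasible (\<lambda>p. P (fst p) (snd p))" "feasible xs"
  shows "feasible (\<lambda>x. \<exists>a\<in>set (xs x). P x a)"
proof -
  have "feasible (\<lambda>x. filter (P x) (xs x) \<noteq> [])"
    by (intro feasible_intros assms)
  then show ?thesis by (simp add: filter_empty_conv)
qed

lemma feasible_Ball [feasible_intros]:
  assumes "feasible (\<lambda>p. P (fst p) (snd p))" "feasible xs"
  shows "feasible (\<lambda>x. \<forall>a\<in>set (xs x). P x a)"
proof -
  have "feasible (\<lambda>x. filter (\<lambda>a. \<not> P x a) (xs x) = [])"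
    by (intro feasible_intros assms)
  then show ?thesis by (simp add: filter_empty_conv)
qed

lemma feasible_member [feasible_intros]:
  assumes "feasible y" "feasible xs"
  shows "feasible (\<lambda>x. y x \<in> set (xs x))"
proof -
  have "feasible (\<lambda>x. \<exists>a\<in>set (xs x). a = y x)"
    by (intro feasible_intros assms feasible_comp[OF feasible_fst' assms(1)])
  then show ?thesis by simp
qed

lemma feasible_tl [feasible_intros]:
  assumes "feasible xs"
  shows "feasible (\<lambda>x. tl (xs x))"
proof -
  have "feasible (\<lambda>x. case xs x of [] \<Rightarrow> [] | y # ys \<Rightarrow> ys)"
    by (intro feasible_intros assms)
  moreover have "tl l = (case l of [] \<Rightarrow> [] | y # ys \<Rightarrow> ys)" for l :: "'b list"
    by (cases l) auto
  ultimately show ?thesis by simp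
qed

lemma feasible_sorted_wrt [feasible_intros]:
  assumes "feasible (\<lambda>p. P (fst p) (fst (snd p)) (snd (snd p)))" "feasible xs"
  shows "feasible (\<lambda>x. sorted_wrt (P x) (xs x))"
proof -
  have "feasible (\<lambda>x. iter_list (\<lambda>a as b. b \<and> (\<forall>y\<in>set as. P x a y)) (xs x) True)"
    apply (rule feasible_iter_list)
       apply (intro feasible_intros)
        apply (rule feasible_comp3[OF assms(1)])
          apply (intro feasible_intros)+
      apply (rule exI[of _ "[:3:]"])
      apply (use tsize_bool in \<open>auto intro: trans_le_add2\<close>)[1]
     apply (intro feasible_intros assms)+
    done
  moreover have "iter_list (\<lambda>a as b. b \<and> (\<forall>y\<in>set as. P x a y)) u b \<longleftrightarrow> b \<and> sorted_wrt (P x) u" for x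
      u b
    by (induction u arbitrary: b) auto
  ultimately show ?thesis by simp
qed

section \<open>Unary arithmetic by means of lists\<close>

lemma feasible_replicate_unit [feasible_intros]:
  assumes "feasible n"
  shows "feasible (\<lambda>x. replicate (n x) ())"
proof (rule feasible_comp[OF assms feasible_cast])
  show "tr (replicate k ()) = tr k" for k by (induction k) (auto simp: tr_unit_def)
qed

lemma feasible_length [feasible_intros]:
  assumes "feasible xs"
  shows "feasible (\<lambda>x. length (xs x))"
proof -
  have "feasible (\<lambda>x. foldl (\<lambda>n a. Suc n) 0 (xs x))"
    by (rule feasible_foldl_const[where k = 2]) (intro feasible_intros assms | simp)+
  moreover have "foldl (\<lambda>n a. Suc n) m u = length u + m" for m and u :: "'b list"
    by (induction u arbitrary: m) auto
  ultimately show ?thesis by simp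
qed

lemma feasible_plus [feasible_intros]:
  assumes "feasible m" "feasible n"
  shows "feasible (\<lambda>x. m x + n x :: nat)"
proof -
  have "feasible (\<lambda>x. length (replicate (m x) () @ replicate (n x) ()))"
    by (intro feasible_intros assms)
  then show ?thesis by simp
qed

lemma feasible_times [feasible_intros]:
  assumes "feasible m" "feasible n"
  shows "feasible (\<lambda>x. m x * n x :: nat)"
proof -
  have "feasible (\<lambda>x. length (concat (map (\<lambda>_. replicate (n x) ()) (replicate (m x) ()))))"
    by (intro feasible_intros assms feasible_comp[OF feasible_fst' assms(2)])
  then show ?thesis by (simp add: length_concat map_replicate_const sum_list_replicate)
qed

lemma feasible_poly [feasible_intros]:
  assumes "feasible n"
  shows "feasible (\<lambda>x. poly p (n x) :: nat)"
  by (induction p) (auto intro!: feasible_intros assms)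

text \<open>The length of the rest counts down to 0 along a list of \<open>n\<close> units, so
  putting it in front each time yields the increasing list.\<close>

lemma feasible_upt_0:
  assumes "feasible n"
  shows "feasible (\<lambda>x. [0..<n x])"
proof -
  have "feasible (\<lambda>x. iter_list (\<lambda>a as b. length as # b) (replicate (n x) ()) [])"
    apply (rule feasible_iter_list)
       apply (intro feasible_intros)
      apply (rule exI[of _ "[:2, 2:]"])
      apply (intro allI)
      subgoal for x a as b using length_le_tsize[of as] by simp
     apply (intro feasible_intros assms)+
    done
  moreover have "iter_list (\<lambda>a as b. length as # b) (replicate k ()) b = [0..<k] @ b" for k b
    by (induction k arbitrary: b) auto
  ultimately show ?thesis by simp
qed

lemma feasible_less [feasible_intros]:
  assumes "feasible m" "feasible n"
  shows "feasible (\<lambda>x. m x < (n x :: nat))"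
proof -
  have "feasible (\<lambda>x. m x \<in> set [0..<n x])"
    by (intro feasible_intros assms feasible_upt_0)
  then show ?thesis by simp
qed

lemma feasible_upt [feasible_intros]:
  assumes "feasible m" "feasible n"
  shows "feasible (\<lambda>x. [m x..<n x])"
proof -
  have "feasible (\<lambda>x. filter (\<lambda>i. \<not> i < m x) [0..<n x])"
    by (intro feasible_intros feasible_upt_0 assms feasible_comp[OF feasible_fst' assms(1)])
  moreover have "filter (\<lambda>i. \<not> i < a) [0..<b] = [a..<b]" for a b :: nat
    by (induction b) auto
  ultimately show ?thesis by simp
qed

lemma feasible_minus [feasible_intros]:
  assumes "feasible m" "feasible n"
  shows "feasible (\<lambda>x. m x - n x :: nat)"
proof -
  have "feasible (\<lambda>x. length [n x..<m x])" by (intro feasible_intros assms)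
  then show ?thesis by simp
qed

lemma feasible_drop [feasible_intros]:
  assumes "feasible n" "feasible xs"
  shows "feasible (\<lambda>x. drop (n x) (xs x))"
proof -
  have tl: "tsize (tl l) \<le> tsize l" for l :: "'b list" by (cases l) auto
  have "feasible (\<lambda>x. foldl (\<lambda>l _. tl l) (xs x) (replicate (n x) ()))"
    by (rule feasible_foldl_const[where k = 0]) (intro feasible_intros assms | simp add: tl)+
  moreover have "foldl (\<lambda>l _. tl l) u (replicate k ()) = drop k u" for k and u :: "'b list"
    by (induction k arbitrary: u) (auto simp: drop_Suc)
  ultimately show ?thesis by simp
qed

text \<open>Halving by alternation: the flag is the parity so far, and the quotient grows in every
  second round.\<close>

lemma div2_odd_Suc: "foldl (\<lambda>s _. (if snd s then Suc (fst s) else fst s, \<not> snd s)) (0, False)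
    (replicate n ()) = (n div 2, odd n)"
proof (induction n)
  case (Suc n)
  then show ?case by (simp flip: replicate_append_same)
qed simp

lemma feasible_div2_odd: "feasible (\<lambda>n :: nat. (n div 2, odd n))"
proof -
  have "feasible (\<lambda>n. foldl (\<lambda>s _. (if snd s then Suc (fst s) else fst s, \<not> snd s)) (0, False)
      (replicate n ()))"
    by (rule feasible_foldl_const[where k = 6])
        (intro feasible_intros | simp add: tsize_fst tsize_def tr_bool_def)+
  then show ?thesis by (simp add: div2_odd_Suc)
qed

lemma feasible_div2 [feasible_intros]: "feasible n \<Longrightarrow> feasible (\<lambda>x. n x div (2 :: nat))"
  using feasible_fst[OF feasible_comp[OF _ feasible_div2_odd]] by simp

lemma feasible_even [feasible_intros]: "feasible n \<Longrightarrow> feasible (\<lambda>x. even (n x :: nat))"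
  using feasible_not[OF feasible_snd[OF feasible_comp[OF _ feasible_div2_odd]]] by simp

lemma feasible_binary [feasible_intros]:
  assumes "feasible n"
  shows "feasible (\<lambda>x. binary (n x))"
proof -
  \<comment> \<open>Digits are produced from the least significant one. \<open>n\<close> rounds are
    enough, and rounds after the number has become 0 change nothing.\<close>
  let ?step = "\<lambda>s _. if fst s = 0 then s else (fst s div 2, odd (fst s) # snd s)"
  have *: "foldl ?step (m, acc) (replicate k ()) = (0, binary m @ acc)" if "m \<le> k" for k m acc
    using that
  proof (induction k arbitrary: m acc)
    case 0
    then show ?case by (simp add: binary.simps)
  next
    case (Suc k)
    show ?case
    proof (cases "m = 0")
      case True
      then have "foldl ?step (m, acc) (replicate (Suc k) ())
          = foldl ?step (m, acc) (replicate k ())" by simp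
      with Suc.IH[of m acc] True show ?thesis by simp
    next
      case False
      then have "m div 2 \<le> k" using Suc.prems by linarith
      from Suc.IH[OF this, of "odd m # acc"] False show ?thesis
        by (subst binary.simps) simp
    qed
  qed
  have "feasible (\<lambda>n. snd (foldl ?step (n, []) (replicate n ())))"
    apply (intro feasible_intros feasible_foldl_const[where k = 4])
     apply (auto simp: tsize_fst tsize_def tr_bool_def)
    done
  from feasible_comp[OF assms this] show ?thesis by (simp add: *)
qed

lemma feasible_enc_nat [feasible_intros]:
  assumes "feasible n"
  shows "feasible (\<lambda>x. enc_nat (n x))"
  unfolding enc_nat_def by (intro feasible_intros assms)

primrec index :: "'a \<Rightarrow> 'a list \<Rightarrow> nat" where
  "index a [] = 0"
| "index a (x # xs) = (if x = a then 0 else Suc (index a xs))"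

lemma feasible_index [feasible_intros]:
  assumes "feasible a" "feasible xs"
  shows "feasible (\<lambda>x. index (a x) (xs x))"
proof -
  have "feasible (\<lambda>x. foldl (\<lambda>n y. if y = a x then 0 else Suc n) 0 (rev (xs x)))"
    by (rule feasible_foldl_const[where k = 2])
      (intro feasible_intros assms feasible_comp[OF feasible_fst' assms(1)] | simp)+
  moreover have "foldl (\<lambda>n y. if y = b then 0 else Suc n) 0 (rev u) = index b u" for b :: 'b and u
    by (induction u) auto
  ultimately show ?thesis by simp
qed

section \<open>Reducing clauses to proper symmetric formulas\<close>

type_synonym 'v lit = "bool \<times> 'v"

definition holds :: "('v \<Rightarrow> bool) \<Rightarrow> 'v lit \<Rightarrow> bool" where
  "holds \<alpha> l \<longleftrightarrow> \<alpha> (snd l) = fst l"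

definition cnf_sat :: "'v lit list list \<Rightarrow> bool" where
  "cnf_sat F \<longleftrightarrow> (\<exists>\<alpha>. \<forall>c\<in>set F. \<exists>l\<in>set c. holds \<alpha> l)"

definition nae :: "('v \<Rightarrow> bool) \<Rightarrow> 'v lit set \<Rightarrow> bool" where
  "nae \<alpha> L \<longleftrightarrow> (\<exists>l\<in>L. holds \<alpha> l) \<and> (\<exists>l\<in>L. \<not> holds \<alpha> l)"

definition nae_sat :: "'v lit list list \<Rightarrow> bool" where
  "nae_sat T \<longleftrightarrow> (\<exists>\<alpha>. \<forall>t\<in>set T. nae \<alpha> (set t))"

definition flip :: "'v lit \<Rightarrow> 'v lit" where
  "flip l = (\<not> fst l, snd l)"

lemma flip_simps [simp]: "fst (flip l) = (\<not> fst l)" "snd (flip l) = snd l" "flip (flip l) = l"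
  by (auto simp: flip_def)

lemma holds_flip [simp]: "holds \<alpha> (flip l) \<longleftrightarrow> \<not> holds \<alpha> l"
  by (auto simp: holds_def)

lemma feasible_flip [feasible_intros]: "feasible f \<Longrightarrow> feasible (\<lambda>x. flip (f x))"
  unfolding flip_def by (intro feasible_intros)

text \<open>
  The variable \<open>(0, [(True, v)])\<close> stands for the old variable \<open>v\<close> and \<open>(1, ls)\<close> for the disjunction
  of \<open>ls\<close>. The variable \<open>(3, [])\<close> plays the role of the constant false: an assignment and its
  complement satisfy the same constraints.
\<close>

type_synonym 'v var = "nat \<times> 'v lit list"

definition old :: "'v lit \<Rightarrow> 'v var lit" where "old l = (fst l, 0, [(True, snd l)])"
definition disjunct :: "'v lit list \<Rightarrow> 'v var lit" where "disjunct ls = (True, 1, ls)"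
text \<open>The fresh literal that splits a constraint on four literals.\<close>

definition link :: "'v lit list \<Rightarrow> 'v var lit" where "link ls = (True, 2, ls)"
definition falsum :: "'v var lit" where "falsum = (True, 3, [])"
definition extra :: "'v var lit" where "extra = (True, 4, [])"

text \<open>If \<open>a\<close> and \<open>flip b\<close> had the same value, one of
  \<open>c\<close> and \<open>flip c\<close> would share it. The free literal \<open>c\<close> turns
  a constraint on two literals into triples.\<close>

definition equate :: "'v lit \<Rightarrow> 'v lit \<Rightarrow> 'v lit \<Rightarrow> 'v lit list list" where
  "equate a b c = [[a, flip b, c], [a, flip b, flip c]]"

text \<open>With \<open>falsum\<close> false, not-all-equal for the negated disjunction of
  \<open>ls\<close>, \<open>l\<close>, the disjunction of \<open>ls'\<close> and
  \<open>falsum\<close> is the implication from the first disjunction to \<open>l\<close> or the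
  second. The two triples split it by \<open>link ls\<close>.\<close>

definition unfold_disj :: "'v lit list \<Rightarrow> 'v var lit list list" where
  "unfold_disj ls = (case ls of [] \<Rightarrow> [] | l # ls' \<Rightarrow>
     [[flip (disjunct ls), old l, link ls], [flip (link ls), disjunct ls', falsum]])"

definition clause_constraints :: "'v lit list \<Rightarrow> 'v var lit list list" where
  "clause_constraints ls = concat (map (\<lambda>i. unfold_disj (drop i ls)) [0..<length ls])
     @ equate (disjunct ls) (flip falsum) extra"

definition nae_constraints :: "'v lit list list \<Rightarrow> 'v var lit list list" where
  "nae_constraints F = concat (map clause_constraints F) @ equate (disjunct []) falsum extra"

lemma nae_equate:
  "(\<forall>t\<in>set (equate a b c). nae \<alpha> (set t)) \<longleftrightarrow> (holds \<alpha> a \<longleftrightarrow> holds \<alpha> b)"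
  by (auto simp: equate_def nae_def)

lemma nae_unfold_disj:
  assumes "\<forall>t\<in>set (unfold_disj (l # ls)). nae \<beta> (set t)"
    and "holds \<beta> (disjunct (l # ls)) \<noteq> holds \<beta> falsum"
  shows "holds \<beta> (old l) \<noteq> holds \<beta> falsum \<or> holds \<beta> (disjunct ls) \<noteq> holds \<beta> falsum"
  using assms by (auto simp: unfold_disj_def nae_def)

lemma nae_sat_constraints: "nae_sat (nae_constraints F) \<longleftrightarrow> cnf_sat F"
proof
  assume "cnf_sat F"
  then obtain \<alpha> where \<alpha>: "\<And>c. c \<in> set F \<Longrightarrow> \<exists>l\<in>set c. holds \<alpha> l" by (auto simp: cnf_sat_def)
  \<comment> \<open>Each \<open>link ls\<close> gets the value of the disjunction of the tail, which
    settles both halves of the split; \<open>falsum\<close> and \<open>extra\<close> are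
    false.\<close>
  define \<beta> where "\<beta> = (\<lambda>x. case x of (k, ls) \<Rightarrow>
    if k = (0::nat) then \<alpha> (snd (hd ls)) else if k = 1 then \<exists>l\<in>set ls. holds \<alpha> l
    else if k = 2 then \<exists>l\<in>set (tl ls). holds \<alpha> l else False)"
  have \<beta>: "holds \<beta> (old l) = holds \<alpha> l" "holds \<beta> (disjunct ls) = (\<exists>l\<in>set ls. holds \<alpha> l)"
    "holds \<beta> (link ls) = (\<exists>l\<in>set (tl ls). holds \<alpha> l)" "\<not> holds \<beta> falsum" for l ls
    by (auto simp: \<beta>_def holds_def old_def disjunct_def link_def falsum_def)
  have unf: "\<forall>t\<in>set (unfold_disj ls). nae \<beta> (set t)" for ls
    by (auto simp: unfold_disj_def nae_def \<beta> split: list.splits)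
  have "\<forall>t\<in>set (nae_constraints F). nae \<beta> (set t)"
    unfolding nae_constraints_def clause_constraints_def set_append ball_Un nae_equate
    using unf \<alpha> by (auto simp: ball_Un nae_equate \<beta>)
  then show "nae_sat (nae_constraints F)" by (auto simp: nae_sat_def)
next
  assume "nae_sat (nae_constraints F)"
  then obtain \<beta> where \<beta>: "\<forall>t\<in>set (nae_constraints F). nae \<beta> (set t)" by (auto simp: nae_sat_def)
  \<comment> \<open>Rather than complementing \<beta> when \<open>falsum\<close> is true, values are
    read relative to \<open>z\<close>: a literal counts as true if it differs from
    \<open>falsum\<close>.\<close>
  define z where "z = holds \<beta> falsum"
  define \<alpha> where "\<alpha> v = (\<beta> (0, [(True, v)]) \<noteq> z)" for v
  have \<alpha>: "holds \<alpha> l \<longleftrightarrow> holds \<beta> (old l) \<noteq> z" for l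
    by (auto simp: holds_def \<alpha>_def old_def)
  have nil: "holds \<beta> (disjunct []) = z"
    using \<beta> by (simp add: nae_constraints_def ball_Un nae_equate z_def)
  have "\<exists>l\<in>set c. holds \<alpha> l" if "c \<in> set F" for c
  proof -
    have con: "\<forall>t\<in>set (clause_constraints c). nae \<beta> (set t)"
      using \<beta> that by (auto simp: nae_constraints_def)
    have c: "holds \<beta> (disjunct c) \<noteq> z"
      using con by (simp add: clause_constraints_def ball_Un nae_equate z_def)
    \<comment> \<open>A suffix whose disjunction counts as true has a true head or a rest of the
      same kind. The descent cannot reach the empty suffix, by \<open>nil\<close>.\<close>
    have "\<exists>l\<in>set (drop i c). holds \<alpha> l" if "holds \<beta> (disjunct (drop i c)) \<noteq> z" "i \<le> length c" for i
      using that
    proof (induction "length c - i" arbitrary: i)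
      case 0
      then show ?case using nil by simp
    next
      case (Suc k)
      then have i: "i < length c" by simp
      then have d: "drop i c = c ! i # drop (Suc i) c" by (simp add: Cons_nth_drop_Suc)
      have "\<forall>t\<in>set (unfold_disj (drop i c)). nae \<beta> (set t)"
        using con i by (fastforce simp: clause_constraints_def)
      from nae_unfold_disj[OF this[unfolded d]] Suc.prems(1)
      have "holds \<alpha> (c ! i) \<or> holds \<beta> (disjunct (drop (Suc i) c)) \<noteq> z" by (simp add: d z_def \<alpha>)
      moreover have "k = length c - Suc i" using Suc.hyps(2) by simp
      ultimately show ?case using Suc.hyps(1)[of "Suc i"] i by (auto simp: d)
    qed
    from this[of 0] c show ?thesis by simp
  qed
  then show "cnf_sat F" by (auto simp: cnf_sat_def)
qed

section \<open>Numbering the variables\<close>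

definition proper_triple :: "'v lit list \<Rightarrow> bool" where
  "proper_triple t \<longleftrightarrow> length t = 3 \<and> distinct (map snd t)"

text \<open>The variables within a constraint are distinct because they always carry different tags
  from 0 to 4.\<close>

lemma proper_nae_constraints: "t \<in> set (nae_constraints F) \<Longrightarrow> proper_triple t"
  by (auto simp: nae_constraints_def clause_constraints_def unfold_disj_def equate_def
      proper_triple_def
      old_def disjunct_def link_def falsum_def extra_def flip_def split: list.splits)

lemma feasible_nae_constraints [feasible_intros]:
  assumes "feasible F"
  shows "feasible (\<lambda>x. nae_constraints (F x))"
  unfolding nae_constraints_def clause_constraints_def unfold_disj_def equate_def old_def
      disjunct_def
    link_def falsum_def extra_def
  by (intro feasible_intros assms)

text \<open>A variable gets the position of its first occurrence. Numbers may be skipped, but they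
  stay below the number of occurrences, hence polynomial even in unary.\<close>

definition rename :: "'v lit list list \<Rightarrow> nat lit list list" where
  "rename T = map (map (\<lambda>l. (fst l, index (snd l) (concat (map (map snd) T))))) T"

lemma index_inject: "a \<in> set xs \<Longrightarrow> index a xs = index b xs \<Longrightarrow> a = b"
  by (induction xs) (auto split: if_splits)

lemma index_less: "a \<in> set xs \<Longrightarrow> index a xs < length xs"
  by (induction xs) auto

lemma feasible_rename [feasible_intros]:
  assumes "feasible T"
  shows "feasible (\<lambda>x. rename (T x))"
proof -
  have "feasible (\<lambda>T :: 'b lit list list. rename T)"
    unfolding rename_def by (intro feasible_intros)
  from feasible_comp[OF assms this] show ?thesis .
qed

lemma nae_map:
  assumes "\<And>l. l \<in> L \<Longrightarrow> holds \<alpha> (f l) = holds \<beta> l"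
  shows "nae \<alpha> (f ` L) \<longleftrightarrow> nae \<beta> L"
  using assms by (auto simp: nae_def)

lemma nae_sat_rename: "nae_sat (rename T) \<longleftrightarrow> nae_sat T"
proof
  let ?V = "concat (map (map snd) T)"
  assume "nae_sat (rename T)"
  then obtain \<alpha> where \<alpha>: "\<forall>t\<in>set T. nae \<alpha> ((\<lambda>l. (fst l, index (snd l) ?V)) ` set t)"
    by (auto simp: nae_sat_def rename_def)
  moreover have "nae \<alpha> ((\<lambda>l. (fst l, index (snd l) ?V)) ` L) = nae (\<lambda>v. \<alpha> (index v ?V)) L" for L
    by (rule nae_map) (simp add: holds_def)
  ultimately show "nae_sat T" by (auto simp: nae_sat_def)
next
  let ?V = "concat (map (map snd) T)"
  assume "nae_sat T"
  then obtain \<alpha> where \<alpha>: "\<forall>t\<in>set T. nae \<alpha> (set t)" by (auto simp: nae_sat_def)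
  define \<beta> where "\<beta> n = (\<exists>v\<in>set ?V. index v ?V = n \<and> \<alpha> v)" for n
  have \<beta>: "\<beta> (index v ?V) = \<alpha> v" if "v \<in> set ?V" for v
    using that index_inject[of v ?V] unfolding \<beta>_def by metis
  have "nae \<beta> ((\<lambda>l. (fst l, index (snd l) ?V)) ` set t) = nae \<alpha> (set t)" if "t \<in> set T" for t
  proof (rule nae_map)
    fix l assume "l \<in> set t"
    with that have "snd l \<in> set ?V" by auto
    from \<beta>[OF this] show "holds \<beta> (fst l, index (snd l) ?V) = holds \<alpha> l" by (simp add: holds_def)
  qed
  with \<alpha> have "\<forall>t\<in>set (rename T). nae \<beta> (set t)" by (auto simp: rename_def)
  then show "nae_sat (rename T)" by (auto simp: nae_sat_def)
qed

lemma proper_rename: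
  assumes "\<And>t. t \<in> set T \<Longrightarrow> proper_triple t" "t' \<in> set (rename T)"
  shows "proper_triple t'" "\<And>l. l \<in> set t' \<Longrightarrow> snd l < length (concat T)"
proof -
  let ?V = "concat (map (map snd) T)"
  from assms obtain t where t: "t \<in> set T" "t' = map (\<lambda>l. (fst l, index (snd l) ?V)) t"
      "proper_triple t"
    by (auto simp: rename_def)
  have V: "snd l \<in> set ?V" if "l \<in> set t" for l using t that by auto
  have "inj_on (\<lambda>v. index v ?V) (set (map snd t))"
    by (intro inj_onI, rule index_inject[of _ ?V]) (use V in auto)
  moreover have "map snd t' = map (\<lambda>v. index v ?V) (map snd t)" using t by simp
  ultimately show "proper_triple t'"
    using t unfolding proper_triple_def by (simp only: distinct_map length_map)
  have "length ?V = length (concat T)" by (simp add: length_concat comp_def)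
  then show "snd l < length (concat T)" if "l \<in> set t'" for l
    using that index_less V t by (fastforce simp del: set_concat)
qed

section \<open>Producing the proper symmetric formula\<close>

definition all_lits :: "nat \<Rightarrow> nat lit list" where
  "all_lits n = concat (map (\<lambda>i. [(True, i), (False, i)]) [0..<n])"

lemma set_all_lits [simp]: "set (all_lits n) = {l. snd l < n}"
  by (auto simp: all_lits_def)

text \<open>Instead of sorting, all candidate triples are enumerated in lexicographic order and
  filtered. Order and distinctness come from the enumeration, symmetry from the condition, which is
  invariant under \<open>flip\<close>.\<close>

definition ordered_triples :: "nat lit list list \<Rightarrow> (nat lit \<times> nat lit \<times> nat lit) list" where
  "ordered_triples T = (let ls = all_lits (length (concat T)) in
     concat (map (\<lambda>a. concat (map (\<lambda>b. map (\<lambda>c. (a, b, c))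
       (filter (\<lambda>c. snd a < snd b \<and> snd b < snd c \<and> (\<exists>t\<in>set T.
          set t = {a, b, c} \<or> set t = {flip a, flip b, flip c})) ls)) ls)) ls))"

lemma set_ordered_triples:
  "(a, b, c) \<in> set (ordered_triples T) \<longleftrightarrow>
     snd c < length (concat T) \<and> snd a < snd b \<and> snd b < snd c \<and>
     (\<exists>t\<in>set T. set t = {a, b, c} \<or> set t = {flip a, flip b, flip c})"
  by (auto simp: ordered_triples_def Let_def image_iff simp del: split_paired_Ex)

lemma feasible_ordered_triples [feasible_intros]:
  assumes "feasible T"
  shows "feasible (\<lambda>x. ordered_triples (T x))"
proof -
  \<comment> \<open>Equality of sets is spelled out by bounded quantifiers and membership, to which
    the feasibility rules apply.\<close>
  have set3: "set t = {a, b, c} \<longleftrightarrow> (\<forall>x\<in>set t. x = a \<or> x = b \<or> x = c) \<and> a \<in> set t \<and> b \<in> set t \<and> c \<in>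
      set t"
    for t and a b c :: "nat lit" by auto
  have "feasible (\<lambda>T. ordered_triples T)"
    unfolding ordered_triples_def Let_def all_lits_def set3 by (intro feasible_intros)
  from feasible_comp[OF assms this] show ?thesis .
qed

definition to_literal :: "nat lit \<Rightarrow> literal" where
  "to_literal l = (if fst l then Pos (snd l) else Neg (snd l))"

lemma var_to_literal [simp]: "var (to_literal l) = snd l"
  by (simp add: to_literal_def)

lemma neg_to_literal [simp]: "neg_lit (to_literal l) = to_literal (flip l)"
  by (simp add: to_literal_def)

lemma to_literal_inject [simp]: "to_literal l = to_literal m \<longleftrightarrow> l = m"
  by (auto simp: to_literal_def prod_eq_iff)

lemma lit_true_to_literal [simp]: "lit_true \<alpha> (to_literal l) = holds \<alpha> l"
  by (auto simp: to_literal_def holds_def)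

lemma to_literal_less: "snd l < snd m \<Longrightarrow> to_literal l < to_literal m"
  by (auto simp: to_literal_def less_literal_def)

definition to_clause :: "nat lit \<times> nat lit \<times> nat lit \<Rightarrow> clause" where
  "to_clause t = (to_literal (fst t), to_literal (fst (snd t)), to_literal (snd (snd t)))"

definition to_formula :: "nat lit list list \<Rightarrow> formula" where
  "to_formula T = map to_clause (ordered_triples T)"

lemma feasible_enc_to_formula [feasible_intros]:
  assumes "feasible T"
  shows "feasible (\<lambda>x. enc_formula (to_formula (T x)))"
proof -
  have "enc_literal (to_literal l) = fst l # enc_nat (snd l)" for l
    by (simp add: to_literal_def)
  then have "enc_formula (to_formula T) = concat (map (\<lambda>t. (fst (fst t) # enc_nat (snd (fst t))) @
      (fst (fst (snd t)) # enc_nat (snd (fst (snd t)))) @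
          (fst (snd (snd t)) # enc_nat (snd (snd (snd t)))))
      (ordered_triples T))" for T
    by (simp add: enc_formula_def to_formula_def to_clause_def comp_def)
  then show ?thesis by (simp only:) (intro feasible_intros assms)
qed

lemma sorted_wrt_concat_map:
  assumes "sorted_wrt (\<lambda>x y. \<forall>u\<in>set (f x). \<forall>v\<in>set (f y). P u v) xs"
      "\<And>x. x \<in> set xs \<Longrightarrow> sorted_wrt P (f x)"
  shows "sorted_wrt P (concat (map f xs))"
  using assms by (induction xs) (auto simp: sorted_wrt_append)

lemma sorted_all_lits: "sorted_wrt (\<lambda>l m. to_literal l < to_literal m) (all_lits n)"
  unfolding all_lits_def
  by (rule sorted_wrt_concat_map[OF sorted_wrt_mono_rel[OF _ sorted_wrt_upt]])
    (auto intro: to_literal_less simp: to_literal_def less_literal_def)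

lemma sorted_ordered_triples:
  "sorted_wrt (\<lambda>s t. clause_le (to_clause s) (to_clause t) \<and> s \<noteq> t) (ordered_triples T)"
  unfolding ordered_triples_def Let_def
  apply (rule sorted_wrt_concat_map[OF sorted_wrt_mono_rel[OF _ sorted_all_lits]])
   apply (auto simp: to_clause_def)[1]
  apply (rule sorted_wrt_concat_map[OF sorted_wrt_mono_rel[OF _ sorted_all_lits]])
   apply (auto simp: to_clause_def)[1]
  apply (subst sorted_wrt_map)
  apply (rule sorted_wrt_filter)
  apply (rule sorted_wrt_mono_rel[OF _ sorted_all_lits])
  apply (auto simp: to_clause_def)
  done

lemma distinct_conv_sorted_wrt: "distinct xs \<longleftrightarrow> sorted_wrt (\<noteq>) xs"
  by (induction xs) auto

lemma to_clause_inject: "to_clause s = to_clause t \<longleftrightarrow> s = t"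
  by (auto simp: to_clause_def prod_eq_iff)

lemma proper_to_formula: "proper (to_formula T)"
proof -
  have "sorted_wrt (\<lambda>s t. clause_le s t \<and> s \<noteq> t) (to_formula T)"
    unfolding to_formula_def sorted_wrt_map to_clause_inject by (rule sorted_ordered_triples)
  then have "sorted_wrt clause_le (to_formula T)" "distinct (to_formula T)"
    by (auto simp: distinct_conv_sorted_wrt elim: sorted_wrt_mono_rel[rotated])
  then show ?thesis
    by (auto simp: proper_def reduced_def to_formula_def to_clause_def set_ordered_triples
        intro!: less_imp_le to_literal_less)
qed

lemma symmetric_to_formula: "symmetric (to_formula T)"
proof -
  have "mirror c \<in> set (to_formula T)" if "c \<in> set (to_formula T)" for c
  proof -
    from that obtain x y z where xyz: "(x, y, z) \<in> set (ordered_triples T)"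
        "c = to_clause (x, y, z)"
      by (auto simp: to_formula_def)
    then have "(flip x, flip y, flip z) \<in> set (ordered_triples T)" by
        (auto simp: set_ordered_triples)
    moreover have "mirror c = to_clause (flip x, flip y, flip z)" by (simp add: xyz to_clause_def)
    ultimately show ?thesis by (auto simp: to_formula_def)
  qed
  moreover have "distinct (to_formula T)" using proper_to_formula by
      (auto simp: proper_def reduced_def)
  moreover have "count_list xs x = (if x \<in> set xs then 1 else 0)" if "distinct xs" for xs and x ::
      clause
    using that by (induction xs) auto
  ultimately show ?thesis unfolding symmetric_def by metis
qed

lemma ordered_triple_exists:
  fixes t :: "nat lit list"
  assumes "proper_triple t"
  obtains a b c where "set t = {a, b, c}" "snd a < snd b" "snd b < snd c"
proof -
  from assms obtain x y z where t: "t = [x, y, z]" and d: "snd x \<noteq> snd y" "snd x \<noteq> snd z"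
      "snd y \<noteq> snd z"
    by (auto simp: proper_triple_def length_Suc_conv numeral_3_eq_3)
  define s where "s = sort_key snd t"
  have s: "length s = 3" "set s = set t" "sorted (map snd s)" "distinct (map snd s)"
    using assms by (simp_all add: s_def proper_triple_def distinct_map)
  from s(1) obtain a b c where abc: "s = [a, b, c]" by (auto simp: length_Suc_conv numeral_3_eq_3)
  show ?thesis using that[of a b c] s by (auto simp: abc less_le)
qed

lemma satisfiable_to_formula:
  assumes "\<And>t. t \<in> set T \<Longrightarrow> proper_triple t"
      "\<And>t l. t \<in> set T \<Longrightarrow> l \<in> set t \<Longrightarrow> snd l < length (concat T)"
  shows "satisfiable (to_formula T) \<longleftrightarrow> nae_sat T"
proof -
  have "(\<forall>c\<in>set (to_formula T). clause_true \<alpha> c) \<longleftrightarrow> (\<forall>t\<in>set T. nae \<alpha> (set t))" for \<alpha>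
  proof
    assume \<alpha>: "\<forall>c\<in>set (to_formula T). clause_true \<alpha> c"
    show "\<forall>t\<in>set T. nae \<alpha> (set t)"
    proof
      fix t assume t: "t \<in> set T"
      obtain a b c where abc: "set t = {a, b, c}" "snd a < snd b" "snd b < snd c"
        using ordered_triple_exists[OF assms(1)[OF t]] .
      have "snd c < length (concat T)" using assms(2)[OF t] abc by simp
      with abc t have "(a, b, c) \<in> set (ordered_triples T)"
          "(flip a, flip b, flip c) \<in> set (ordered_triples T)"
        by (auto simp: set_ordered_triples)
      then have "clause_true \<alpha> (to_clause (a, b, c))"
          "clause_true \<alpha> (to_clause (flip a, flip b, flip c))"
        using \<alpha> unfolding to_formula_def set_map by blast+
      then show "nae \<alpha> (set t)" using abc by (auto simp: to_clause_def nae_def)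
    qed
  next
    assume \<alpha>: "\<forall>t\<in>set T. nae \<alpha> (set t)"
    show "\<forall>c\<in>set (to_formula T). clause_true \<alpha> c"
    proof
      fix c assume "c \<in> set (to_formula T)"
      then obtain x y z where xyz: "(x, y, z) \<in> set (ordered_triples T)" "c = to_clause (x, y, z)"
        by (auto simp: to_formula_def)
      then obtain t where t: "t \<in> set T" "set t = {x, y, z} \<or> set t = {flip x, flip y, flip z}"
        by (auto simp: set_ordered_triples)
      with \<alpha> have "nae \<alpha> (set t)" by blast
      with t(2) show "clause_true \<alpha> c" by (auto simp: xyz to_clause_def nae_def)
    qed
  qed
  then show ?thesis by (simp add: satisfiable_def nae_sat_def)
qed

definition cnf_to_3sat :: "'v lit list list \<Rightarrow> formula" where
  "cnf_to_3sat F = to_formula (rename (nae_constraints F))"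

lemma cnf_to_3sat_correct: "enc_formula (cnf_to_3sat F) \<in> proper_symmetric_3sat \<longleftrightarrow> cnf_sat F"
proof -
  let ?T = "rename (nae_constraints F)"
  have len: "length (concat ?T) = length (concat (nae_constraints F))"
    by (simp add: rename_def length_concat comp_def)
  have "satisfiable (to_formula ?T) \<longleftrightarrow> nae_sat ?T"
    using proper_rename[OF proper_nae_constraints, of "nae_constraints F"] unfolding len
    by (intro satisfiable_to_formula) (auto simp: len)
  then show ?thesis
    unfolding cnf_to_3sat_def proper_symmetric_3sat_def
    using proper_to_formula symmetric_to_formula
    by (auto simp: enc_formula_inject nae_sat_rename nae_sat_constraints)
qed

lemma feasible_cnf_to_3sat [feasible_intros]:
  assumes "feasible F"
  shows "feasible (\<lambda>x. enc_formula (cnf_to_3sat (F x)))"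
  unfolding cnf_to_3sat_def by (intro feasible_intros assms)

section \<open>The tableau of a verifier\<close>

lemma feasible_le [feasible_intros]:
  assumes "feasible m" "feasible n"
  shows "feasible (\<lambda>x. m x \<le> (n x :: nat))"
  unfolding not_less[symmetric] by (intro feasible_intros assms)

text \<open>The halting state gets idle transitions, so all runs can be followed for the same number
  of steps.\<close>

definition full_delta :: "tm \<Rightarrow> nat \<Rightarrow> nat list \<Rightarrow> nat \<times> (nat \<times> move) list" where
  "full_delta M q rs = (if q < states M then delta M q rs else (q, map (\<lambda>a. (a, MoveStay)) rs))"

lemma tm_step_full_delta:
  "tm_step M (q, ts) = (fst (full_delta M q (map read_tape ts)),
     map2 act_tape (snd (full_delta M q (map read_tape ts))) ts)"
proof -
  have "act_tape (read_tape t, MoveStay) t = t" for t by (cases t) auto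
  then have "map2 act_tape (map (\<lambda>a. (a, MoveStay)) (map read_tape ts)) ts = ts"
    by (induction ts) auto
  then show ?thesis by (simp add: full_delta_def tm_step.simps split: prod.split)
qed

lemma full_delta_wf:
  assumes "wf_tm M" "q \<le> states M" "length rs = tapes M" "set rs \<subseteq> {..<symbols M}"
  shows "fst (full_delta M q rs) \<le> states M" "length (snd (full_delta M q rs)) = tapes M"
    "\<And>j. j < tapes M \<Longrightarrow> fst (snd (full_delta M q rs) ! j) < symbols M"
proof -
  have "case delta M q rs of (q', as) \<Rightarrow>
      q' \<le> states M \<and> length as = tapes M \<and> (\<forall>(s, d)\<in>set as. s < symbols M)" if "q < states M"
    by (rule assms(1)[unfolded wf_tm_def, THEN conjunct2, THEN conjunct2, THEN spec, THEN spec,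
        THEN mp])
      (intro conjI that assms)
  then have *: "fst (full_delta M q rs) \<le> states M \<and> length (snd (full_delta M q rs)) = tapes M \<and>
     (\<forall>p \<in> set (snd (full_delta M q rs)). fst p < symbols M)"
    using assms(2-4) by (cases "q < states M") (auto simp: full_delta_def case_prod_beta subset_eq)
  then show "fst (full_delta M q rs) \<le> states M" "length (snd (full_delta M q rs)) = tapes M"
    "\<And>j. j < tapes M \<Longrightarrow> fst (snd (full_delta M q rs) ! j) < symbols M"
    by simp_all
qed

section \<open>Cells relative to the head\<close>

fun content :: "tape \<Rightarrow> int \<Rightarrow> nat" where
  "content (f, h) i = f (h + i)"

lemma content_act_tape:
  "content (act_tape (s, d) t) i
      = (if i + move_offset d = 0 then s else content t (i + move_offset d))"
  by (cases t) (auto simp: add_ac)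

lemma read_tape_content: "read_tape t = content t 0"
  by (cases t) auto

definition valid_config :: "tm \<Rightarrow> config \<Rightarrow> bool" where
  "valid_config M c \<longleftrightarrow> fst c \<le> states M \<and> length (snd c) = tapes M \<and>
     (\<forall>t\<in>set (snd c). \<forall>i. content t i < symbols M)"

lemma valid_config_reads:
  assumes "valid_config M (q, ts)"
  shows "length (map read_tape ts) = tapes M" "set (map read_tape ts) \<subseteq> {..<symbols M}"
  using assms by (auto simp: valid_config_def read_tape_content)

lemma valid_config_step:
  assumes "wf_tm M" "valid_config M c"
  shows "valid_config M (tm_step M c)"
proof -
  obtain q ts where c: "c = (q, ts)" by (cases c)
  let ?rs = "map read_tape ts"
  have q: "q \<le> states M" and ts: "length ts = tapes M" "\<And>t i. t \<in> set ts \<Longrightarrow> content t i < symbols M"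
    using assms(2) by (auto simp: valid_config_def c)
  note wf = full_delta_wf[OF assms(1) q valid_config_reads[OF assms(2)[unfolded c]]]
  have "content t i < symbols M" if "t \<in> set (map2 act_tape (snd (full_delta M q ?rs)) ts)" for t i
  proof -
    from that obtain j where j: "j < tapes M" "t = act_tape (snd (full_delta M q ?rs) ! j) (ts ! j)"
      using wf(2) ts(1) by (auto simp: in_set_conv_nth)
    show ?thesis
      using wf(3)[OF j(1)] ts j by (cases "snd (full_delta M q ?rs) ! j")
          (simp add: content_act_tape)
  qed
  then show ?thesis
    using wf(1,2) ts(1) by (simp add: c tm_step_full_delta valid_config_def)
qed

text \<open>The offset plus 1, so that addresses remain natural numbers: new cell \<open>u\<close>
  stems from old cell \<open>u + shift d - 1\<close>.\<close>

definition shift :: "move \<Rightarrow> nat" where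
  "shift d = nat (move_offset d + 1)"

lemma shift_eq: "int (shift d) = move_offset d + 1"
  by (cases d) (auto simp: shift_def)

text \<open>
  Cells are addressed relative to the head, which is always at position \<open>W\<close>; tape number
  \<open>tapes M\<close> stands for the state.
\<close>

definition cell :: "tm \<Rightarrow> nat \<Rightarrow> config \<Rightarrow> nat \<Rightarrow> nat \<Rightarrow> nat" where
  "cell M W c j u = (if j < tapes M then content (snd c ! j) (int u - int W) else fst c)"

text \<open>The condition \<open>1 \<le> u\<close> keeps the truncated subtraction exact. A source
  address \<open>W\<close> is the cell just written; every other cell is copied.\<close>

lemma cell_step:
  fixes W :: nat
  assumes "wf_tm M" "valid_config M c"
  defines "rs \<equiv> map (\<lambda>j. cell M W c j W) [0..<tapes M]"
  shows "cell M W (tm_step M c) (tapes M) u = fst (full_delta M (fst c) rs)"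
    and "\<And>j u. j < tapes M \<Longrightarrow> 1 \<le> u \<Longrightarrow> cell M W (tm_step M c) j u =
      (if u + shift (snd (snd (full_delta M (fst c) rs) ! j)) - 1 = W then fst
          (snd (full_delta M (fst c) rs) ! j)
       else cell M W c j (u + shift (snd (snd (full_delta M (fst c) rs) ! j)) - 1))"
    and "length rs = tapes M" "set rs \<subseteq> {..<symbols M}"
proof -
  obtain q ts where c: "c = (q, ts)" by (cases c)
  have ts: "length ts = tapes M" using assms(2) by (simp add: valid_config_def c)
  have rs: "rs = map read_tape ts"
    by (rule nth_equalityI) (auto simp: rs_def ts cell_def c read_tape_content)
  show "cell M W (tm_step M c) (tapes M) u = fst (full_delta M (fst c) rs)"
    by (simp add: cell_def c tm_step_full_delta rs)
  show "length rs = tapes M" "set rs \<subseteq> {..<symbols M}"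
    unfolding rs using valid_config_reads assms(2) c by auto
  have q: "q \<le> states M" using assms(2) by (simp add: valid_config_def c)
  note wf = full_delta_wf[OF assms(1) q valid_config_reads[OF assms(2)[unfolded c]]]
  fix j u :: nat assume j: "j < tapes M" and u: "1 \<le> u"
  obtain s d where sd: "snd (full_delta M q rs) ! j = (s, d)" by fastforce
  have "int u - int W + move_offset d = int (u + shift d - 1) - int W"
    using u shift_eq[of d] by simp
  moreover have "int (u + shift d - 1) - int W = 0 \<longleftrightarrow> u + shift d - 1 = W" by simp
  ultimately have "content (act_tape (s, d) (ts ! j)) (int u - int W) =
      (if u + shift d - 1 = W then s else content (ts ! j) (int (u + shift d - 1) - int W))"
    by (simp only: content_act_tape)
  then show "cell M W (tm_step M c) j u =
      (if u + shift (snd (snd (full_delta M (fst c) rs) ! j)) - 1 = W then fst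
          (snd (full_delta M (fst c) rs) ! j)
       else cell M W c j (u + shift (snd (snd (full_delta M (fst c) rs) ! j)) - 1))"
    using j ts wf(2) sd by (simp add: cell_def c tm_step_full_delta rs)
qed

text \<open>\<open>(t, j, u, a)\<close> is the statement that at time \<open>t\<close> cell \<open>u\<close> of tape \<open>j\<close> contains \<open>a\<close>.\<close>

type_synonym tableau_var = "nat \<times> nat \<times> nat \<times> nat"

type_synonym row = "(nat \<times> nat) list \<times> nat \<times> (nat \<times> nat \<times> nat) list"

definition row :: "tm \<Rightarrow> nat \<Rightarrow> nat list \<Rightarrow> row" where
  "row M q rs = ((tapes M, q) # map (\<lambda>j. (j, rs ! j)) [0..<tapes M], fst (full_delta M q rs),
     map (\<lambda>j. (j, fst (snd (full_delta M q rs) ! j), shift (snd (snd (full_delta M q rs) ! j))))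
         [0..<tapes M])"

text \<open>The transition table as finite data. As \<open>M\<close> is fixed, it is a constant of
  the reduction and costs nothing to compute.\<close>

definition rows :: "tm \<Rightarrow> row list" where
  "rows M = concat (map (\<lambda>q. map (row M q) (List.n_lists (tapes M) [0..<symbols M]))
      [0..<Suc (states M)])"

text \<open>The state and the symbols under the heads are the premises \<open>ps\<close> of every
  clause. Only inner cells \<open>1..<2 * W\<close> are determined, since both neighbours must lie
  in the window.\<close>

definition row_clauses :: "nat \<Rightarrow> nat \<Rightarrow> nat \<Rightarrow> nat \<Rightarrow> (nat \<times> nat) list \<Rightarrow> row \<Rightarrow>
    tableau_var lit list list" where
  "row_clauses k S W t ps r =
     (map (\<lambda>p. (False, t, fst p, W, snd p)) ps @ [(True, Suc t, k, W, fst (snd r))]) #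
     concat (map (\<lambda>a. concat (map (\<lambda>u. if u + snd (snd a) - 1 = W
       then [map (\<lambda>p. (False, t, fst p, W, snd p)) ps @ [(True, Suc t, fst a, u, fst (snd a))]]
       else map (\<lambda>b. map (\<lambda>p. (False, t, fst p, W, snd p)) ps @
          [(False, t, fst a, u + snd (snd a) - 1, b), (True, Suc t, fst a, u, b)]) [0..<S])
       [1..<2 * W])) (snd (snd r)))"

definition transition_clauses :: "tm \<Rightarrow> nat \<Rightarrow> nat \<Rightarrow> tableau_var lit list list" where
  "transition_clauses M W T = concat (map (\<lambda>t. concat (map (\<lambda>r.
     row_clauses (tapes M) (symbols M) W t (fst r) r) (rows M))) [0..<T])"

text \<open>Built from \<open>drop\<close> and a case distinction, both feasible, with the blank as
  the value beyond the end.\<close>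

definition symbol_at :: "bool list \<Rightarrow> nat \<Rightarrow> nat" where
  "symbol_at x i = (case drop i x of [] \<Rightarrow> 0 | b # _ \<Rightarrow> if b then 2 else 1)"

text \<open>The word on tape 1 is left open, except that it has length at most \<open>m\<close>.\<close>

definition initial_clauses :: "nat \<Rightarrow> bool list \<Rightarrow> nat \<Rightarrow> nat \<Rightarrow> tableau_var lit list list" where
  "initial_clauses k x m W = [(True, 0, k, W, 0)] #
     concat (map (\<lambda>j. concat (map (\<lambda>u. if j = 1 \<and> W \<le> u \<and> u < W + m
       then [[(True, 0, 1, u, 0), (True, 0, 1, u, 1), (True, 0, 1, u, 2)],
           [(False, 0, 1, u, 0), (True, 0, 1, Suc u, 0)]]
       else [[(True, 0, j, u, if j = 0 \<and> W \<le> u then symbol_at x (u - W) else 0)]])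
       [0..<Suc (2 * W)])) [0..<k])"

text \<open>Symbol 1 is the bit \<open>False\<close>, so the first clause forbids rejection. In the
  half width, \<open>m\<close> is room for the certificate and \<open>T\<close> for the border cell
  lost at each end in every step.\<close>

definition tableau :: "tm \<Rightarrow> bool list \<Rightarrow> nat \<Rightarrow> nat \<Rightarrow> tableau_var lit list list" where
  "tableau M x m T = [(False, T, 0, m + T, 1)] # initial_clauses (tapes M) x m (m + T)
      @ transition_clauses M (m + T) T"

lemma feasible_tableau:
  assumes "feasible x" "feasible m" "feasible T"
  shows "feasible (\<lambda>z. tableau M (x z) (m z) (T z))"
proof -
  have "feasible (\<lambda>p. tableau M (fst p) (fst (snd p)) (snd (snd p)))"
    unfolding tableau_def initial_clauses_def transition_clauses_def row_clauses_def symbol_at_def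
    by (intro feasible_intros)
  from feasible_comp3[OF this assms] show ?thesis .
qed

lemma symbol_at: "symbol_at x i = content (word_tape x) (int i)"
proof (cases "i < length x")
  case True
  then show ?thesis
    by (simp add: symbol_at_def word_tape_def bit_symbol_def flip: Cons_nth_drop_Suc)
qed (simp add: symbol_at_def word_tape_def)

lemma content_word_tape: "content (word_tape w) i = (if i < 0 then 0 else symbol_at w (nat i))"
  by (simp add: symbol_at) (simp add: word_tape_def)

section \<open>Meaning of the clauses under an assignment\<close>

definition satisfies :: "('v \<Rightarrow> bool) \<Rightarrow> 'v lit list list \<Rightarrow> bool" where
  "satisfies \<alpha> F \<longleftrightarrow> (\<forall>c\<in>set F. \<exists>l\<in>set c. holds \<alpha> l)"

lemma satisfies_simps [simp]:
  "satisfies \<alpha> []" "satisfies \<alpha> (c # F) \<longleftrightarrow> (\<exists>l\<in>set c. holds \<alpha> l) \<and> satisfies \<alpha> F"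
  "satisfies \<alpha> (F @ G) \<longleftrightarrow> satisfies \<alpha> F \<and> satisfies \<alpha> G"
  "satisfies \<alpha> (concat (map g xs)) \<longleftrightarrow> (\<forall>x\<in>set xs. satisfies \<alpha> (g x))"
  "satisfies \<alpha> (map f xs) \<longleftrightarrow> (\<forall>x\<in>set xs. \<exists>l\<in>set (f x). holds \<alpha> l)"
  by (auto simp: satisfies_def)

lemma satisfies_row_clauses:
  "satisfies \<alpha> (row_clauses k S W t ps r) \<longleftrightarrow> ((\<forall>p\<in>set ps. \<alpha> (t, fst p, W, snd p)) \<longrightarrow>
     \<alpha> (Suc t, k, W, fst (snd r)) \<and>
     (\<forall>(j, s, d)\<in>set (snd (snd r)). \<forall>u\<in>{1..<2 * W}. if u + d - 1 = W then \<alpha> (Suc t, j, u, s)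
        else \<forall>b<S. \<alpha> (t, j, u + d - 1, b) \<longrightarrow> \<alpha> (Suc t, j, u, b)))"
  unfolding row_clauses_def satisfies_simps
  by (auto simp: holds_def Ball_def split: if_splits)

lemma satisfies_transition_clauses:
  "satisfies \<alpha> (transition_clauses M W T) \<longleftrightarrow> (\<forall>t<T. \<forall>q\<le>states M. \<forall>rs.
     length rs = tapes M \<and> set rs \<subseteq> {..<symbols M} \<and>
     \<alpha> (t, tapes M, W, q) \<and> (\<forall>j<tapes M. \<alpha> (t, j, W, rs ! j)) \<longrightarrow>
     \<alpha> (Suc t, tapes M, W, fst (full_delta M q rs)) \<and>
     (\<forall>j<tapes M. \<forall>u\<in>{1..<2 * W}.
        if u + shift (snd (snd (full_delta M q rs) ! j)) - 1 = W then \<alpha>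
            (Suc t, j, u, fst (snd (full_delta M q rs) ! j))
        else \<forall>b<symbols M. \<alpha> (t, j, u + shift (snd (snd (full_delta M q rs) ! j)) - 1, b) \<longrightarrow> \<alpha>
            (Suc t, j, u, b)))"
proof -
  have rows: "set (rows M) =
      (\<Union>q\<in>{..states M}. row M q ` {rs. length rs = tapes M \<and> set rs \<subseteq> {..<symbols M}})"
    by (simp add: rows_def set_n_lists atLeast0LessThan lessThan_Suc_atMost del: upt_Suc)
  have *: "satisfies \<alpha> (row_clauses (tapes M) (symbols M) W t (fst (row M q rs)) (row M q rs)) \<longleftrightarrow>
     (\<alpha> (t, tapes M, W, q) \<and> (\<forall>j<tapes M. \<alpha> (t, j, W, rs ! j)) \<longrightarrow>
     \<alpha> (Suc t, tapes M, W, fst (full_delta M q rs)) \<and>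
     (\<forall>j<tapes M. \<forall>u\<in>{1..<2 * W}.
        if u + shift (snd (snd (full_delta M q rs) ! j)) - 1 = W then \<alpha>
            (Suc t, j, u, fst (snd (full_delta M q rs) ! j))
        else \<forall>b<symbols M. \<alpha> (t, j, u + shift (snd (snd (full_delta M q rs) ! j)) - 1, b) \<longrightarrow> \<alpha>
            (Suc t, j, u, b)))"
    for t q rs
    unfolding satisfies_row_clauses by (simp add: row_def atLeast0LessThan) (simp add: Ball_def)
  have "satisfies \<alpha> (transition_clauses M W T) \<longleftrightarrow> (\<forall>t<T. \<forall>r\<in>set (rows M).
     satisfies \<alpha> (row_clauses (tapes M) (symbols M) W t (fst r) r))"
    unfolding transition_clauses_def by auto
  also have "\<dots> \<longleftrightarrow> (\<forall>t<T. \<forall>q\<le>states M. \<forall>rs. length rs = tapes M \<and> set rs \<subseteq> {..<symbols M} \<longrightarrow>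
     satisfies \<alpha> (row_clauses (tapes M) (symbols M) W t (fst (row M q rs)) (row M q rs)))"
    unfolding rows by blast
  finally show ?thesis unfolding * by blast
qed

lemma satisfies_initial_clauses:
  "satisfies \<alpha> (initial_clauses k x m W) \<longleftrightarrow> \<alpha> (0, k, W, 0) \<and>
     (\<forall>j<k. \<forall>u\<le>2 * W. if j = 1 \<and> W \<le> u \<and> u < W + m
       then (\<alpha> (0, 1, u, 0) \<or> \<alpha> (0, 1, u, 1) \<or> \<alpha> (0, 1, u, 2)) \<and>
           (\<alpha> (0, 1, u, 0) \<longrightarrow> \<alpha> (0, 1, Suc u, 0))
       else \<alpha> (0, j, u, if j = 0 \<and> W \<le> u then symbol_at x (u - W) else 0))"
proof -
  let ?F = "\<lambda>j u. if j = 1 \<and> W \<le> u \<and> u < W + m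
    then [[(True, 0, 1, u, 0), (True, 0, 1, u, 1), (True, 0, 1, u, 2)],
        [(False, 0, 1, u, 0), (True, 0, 1, Suc u, 0)]]
    else [[(True, 0, j, u, if j = 0 \<and> W \<le> u then symbol_at x (u - W) else 0)]]"
  have "satisfies \<alpha> (?F j u) \<longleftrightarrow> (if j = 1 \<and> W \<le> u \<and> u < W + m
       then (\<alpha> (0, 1, u, 0) \<or> \<alpha> (0, 1, u, 1) \<or> \<alpha> (0, 1, u, 2)) \<and>
           (\<alpha> (0, 1, u, 0) \<longrightarrow> \<alpha> (0, 1, Suc u, 0))
       else \<alpha> (0, j, u, if j = 0 \<and> W \<le> u then symbol_at x (u - W) else 0))" for j u
    by (simp add: holds_def)
  moreover have "satisfies \<alpha> (initial_clauses k x m W) \<longleftrightarrow> \<alpha> (0, k, W, 0) \<and>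
     (\<forall>j<k. \<forall>u\<le>2 * W. satisfies \<alpha> (?F j u))"
    unfolding initial_clauses_def satisfies_simps
    by (simp only: set_upt atLeast0LessThan lessThan_Suc_atMost) (simp add: holds_def Ball_def)
  ultimately show ?thesis by (simp only:)
qed

lemma valid_init_config:
  assumes "wf_tm M"
  shows "valid_config M (init_config M ws)"
  using assms by (auto simp: valid_config_def init_config_def wf_tm_def content_word_tape
      symbol_at_def split: list.splits)

lemma valid_config_run:
  assumes "wf_tm M"
  shows "valid_config M ((tm_step M ^^ t) (init_config M ws))"
  by (induction t) (auto simp: valid_init_config valid_config_step assms)

lemma cell_init_config:
  assumes "2 \<le> tapes M"
  shows "cell M W (init_config M [x, y]) j u =
    (if u < W \<or> 2 \<le> j then 0 else symbol_at (if j = 0 then x else y) (u - W))"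
proof (cases "j < tapes M")
  case True
  have "nat (int u - int W) = u - W" by simp
  with True show ?thesis
    by (auto simp: cell_def init_config_def content_word_tape symbol_at_def[of "[]"] nth_Cons'
        less_2_cases_iff)
next
  case False
  then show ?thesis using assms by (simp add: cell_def init_config_def)
qed

lemma symbol_at_cases: "symbol_at y i = 0 \<or> symbol_at y i = 1 \<or> symbol_at y i = 2"
  by (auto simp: symbol_at_def split: list.splits)

lemma symbol_at_eq_0: "symbol_at y i = 0 \<longleftrightarrow> length y \<le> i"
  by (auto simp: symbol_at_def split: list.splits)

lemma symbol_at_nth: "i < length y \<Longrightarrow> symbol_at y i = (if y ! i then 2 else 1)"
  by (simp add: symbol_at_def flip: Cons_nth_drop_Suc)

lemma tableau_complete:
  assumes M: "wf_tm M" "2 \<le> tapes M" and y: "length y \<le> m"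
    and out: "cell M (m + T) ((tm_step M ^^ T) (init_config M [x, y])) 0 (m + T) \<noteq> 1"
  shows "cnf_sat (tableau M x m T)"
proof -
  let ?W = "m + T"
  let ?c = "\<lambda>t. (tm_step M ^^ t) (init_config M [x, y])"
  define \<alpha> :: "tableau_var \<Rightarrow> bool" where "\<alpha> = (\<lambda>(t, j, u, a). cell M ?W (?c t) j u = a)"
  have \<alpha>: "\<alpha> (t, j, u, a) \<longleftrightarrow> cell M ?W (?c t) j u = a" for t j u a by (simp add: \<alpha>_def)
  have "satisfies \<alpha> (initial_clauses (tapes M) x m ?W)"
    unfolding satisfies_initial_clauses \<alpha>
    using y M(2) symbol_at_cases[of y] by (auto simp: cell_init_config symbol_at_eq_0)
  moreover have "satisfies \<alpha> (transition_clauses M ?W T)"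
    unfolding satisfies_transition_clauses
  proof (intro allI impI)
    fix t q rs
    assume t: "t < T" and "q \<le> states M"
      and *: "length rs = tapes M \<and> set rs \<subseteq> {..<symbols M} \<and> \<alpha> (t, tapes M, ?W, q) \<and>
          (\<forall>j<tapes M. \<alpha> (t, j, ?W, rs ! j))"
    \<comment> \<open>Under \<alpha> each cell has exactly one symbol, so the premises identify the
      state and the symbols actually read.\<close>
    have q: "q = fst (?c t)" using * by (simp add: \<alpha> cell_def)
    have rs: "rs = map (\<lambda>j. cell M ?W (?c t) j ?W) [0..<tapes M]"
      by (rule nth_equalityI) (use * in \<open>auto simp: \<alpha>\<close>)
    note step = cell_step[OF M(1) valid_config_run[OF M(1), of t "[x, y]"], where W = ?W, folded
        rs q]
    show "\<alpha> (Suc t, tapes M, ?W, fst (full_delta M q rs)) \<and>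
     (\<forall>j<tapes M. \<forall>u\<in>{1..<2 * ?W}.
        if u + shift (snd (snd (full_delta M q rs) ! j)) - 1 = ?W then \<alpha>
            (Suc t, j, u, fst (snd (full_delta M q rs) ! j))
        else \<forall>b<symbols M. \<alpha> (t, j, u + shift (snd (snd (full_delta M q rs) ! j)) - 1, b) \<longrightarrow> \<alpha>
            (Suc t, j, u, b))"
      unfolding \<alpha> using step(1,2) by simp
  qed
  moreover have "\<not> \<alpha> (T, 0, ?W, 1)" using out by (simp add: \<alpha>)
  ultimately have "satisfies \<alpha> (tableau M x m T)" by (simp add: tableau_def holds_def)
  then show ?thesis by (auto simp: cnf_sat_def satisfies_def)
qed

lemma tableau_sound:
  assumes M: "wf_tm M" "2 \<le> tapes M" and "cnf_sat (tableau M x m T)"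
  obtains y where "length y \<le> m"
      "cell M (m + T) ((tm_step M ^^ T) (init_config M [x, y])) 0 (m + T) \<noteq> 1"
proof -
  let ?W = "m + T"
  from assms(3) obtain \<alpha> where "satisfies \<alpha> (tableau M x m T)" by
      (auto simp: cnf_sat_def satisfies_def)
  then have out: "\<not> \<alpha> (T, 0, ?W, 1)" and init: "satisfies \<alpha> (initial_clauses (tapes M) x m ?W)"
    and trans: "satisfies \<alpha> (transition_clauses M ?W T)"
    by (auto simp: tableau_def holds_def)
  have init_state: "\<alpha> (0, tapes M, ?W, 0)" using init unfolding satisfies_initial_clauses by blast
  have init_cell: "if j = 1 \<and> ?W \<le> u \<and> u < ?W + m
       then (\<alpha> (0, 1, u, 0) \<or> \<alpha> (0, 1, u, 1) \<or> \<alpha> (0, 1, u, 2)) \<and>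
           (\<alpha> (0, 1, u, 0) \<longrightarrow> \<alpha> (0, 1, Suc u, 0))
       else \<alpha> (0, j, u, if j = 0 \<and> ?W \<le> u then symbol_at x (u - ?W) else 0)" if "j < tapes M" "u \<le>
           2 * ?W" for j u
    using init that unfolding satisfies_initial_clauses by blast
  \<comment> \<open>The certificate ends at the first blank. Where both bit symbols are true,
    \<open>y\<close> takes \<open>True\<close>; all that matters is that the chosen symbol is true
    under \<alpha>.\<close>
  define n where "n = (LEAST i. \<alpha> (0, 1, ?W + i, 0))"
  define y where "y = map (\<lambda>i. \<alpha> (0, 1, ?W + i, 2)) [0..<n]"
  \<comment> \<open>The first cell after the open part is forced to be blank, which bounds
    \<open>n\<close> by \<open>m\<close>.\<close>
  have "\<alpha> (0, 1, ?W + m, 0)" using init_cell[of 1 "?W + m"] M(2) by simp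
  then have n: "\<alpha> (0, 1, ?W + n, 0)" "n \<le> m" "\<And>i. i < n \<Longrightarrow> \<not> \<alpha> (0, 1, ?W + i, 0)"
    unfolding n_def by (auto intro: LeastI Least_le dest: not_less_Least)
  have blank: "\<alpha> (0, 1, ?W + i, 0)" if "n \<le> i" "i \<le> m" for i
    using that
  proof (induction i rule: dec_induct)
    case (step i)
    then show ?case using init_cell[of 1 "?W + i"] M(2) by simp
  qed (use n in auto)
  have "\<alpha> (0, 1, ?W + i, symbol_at y i)" if "?W + i \<le> 2 * ?W" for i
  proof -
    consider "i < n" | "n \<le> i" "i \<le> m" | "m < i" by linarith
    then show ?thesis
    proof cases
      case 1
      then show ?thesis using init_cell[of 1 "?W + i"] M(2) n(2,3)
        by (auto simp: symbol_at_nth y_def)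
    next
      case 2
      then have "symbol_at y i = 0" by (simp add: symbol_at_eq_0 y_def)
      with blank[OF 2] show ?thesis by simp
    next
      case 3
      then have "symbol_at y i = 0" using n(2) by (simp add: symbol_at_eq_0 y_def)
      with 3 show ?thesis using init_cell[of 1 "?W + i"] M(2) that by simp
    qed
  qed
  note tape1 = this
  let ?c = "\<lambda>t. (tm_step M ^^ t) (init_config M [x, y])"
  have "\<alpha> (0, j, u, cell M ?W (?c 0) j u)" if "j < tapes M" "u \<le> 2 * ?W" for j u
  proof (cases "j = 1 \<and> ?W \<le> u")
    case True
    then show ?thesis using tape1[of "u - ?W"] that by (simp add: cell_init_config[OF M(2)])
  next
    case False
    then show ?thesis using init_cell[OF that] that by
        (auto simp: cell_init_config[OF M(2)] split: if_splits)
  qed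
  note start = this
  \<comment> \<open>The known part of the window shrinks by one cell at each end in every step; the
    head cell is still inside at time \<open>T\<close>.\<close>
  have "\<alpha> (t, tapes M, ?W, fst (?c t)) \<and>
      (\<forall>j<tapes M. \<forall>u. t \<le> u \<and> u + t \<le> 2 * ?W \<longrightarrow> \<alpha> (t, j, u, cell M ?W (?c t) j u))"
    if "t \<le> T" for t
    using that
  proof (induction t)
    case 0
    then show ?case using init_state start by (simp add: init_config_def)
  next
    case (Suc t)
    define rs where "rs = map (\<lambda>j. cell M ?W (?c t) j ?W) [0..<tapes M]"
    note step = cell_step[OF M(1) valid_config_run[OF M(1), of t "[x, y]"], where W = ?W, folded
        rs_def]
    have IH: "\<alpha> (t, tapes M, ?W, fst (?c t))"
      "\<And>j u. j < tapes M \<Longrightarrow> t \<le> u \<Longrightarrow> u + t \<le> 2 * ?W \<Longrightarrow> \<alpha> (t, j, u, cell M ?W (?c t) j u)"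
      using Suc by auto
    have "\<forall>j<tapes M. \<alpha> (t, j, ?W, rs ! j)" using IH(2)[of _ ?W] Suc.prems by (simp add: rs_def)
    moreover have "fst (?c t) \<le> states M" using valid_config_run[OF M(1)] by
        (simp add: valid_config_def)
    ultimately have next_state: "\<alpha> (Suc t, tapes M, ?W, fst (full_delta M (fst (?c t)) rs))"
      and next_cell: "\<And>j u. j < tapes M \<Longrightarrow> u \<in> {1..<2 * ?W} \<Longrightarrow>
        if u + shift (snd (snd (full_delta M (fst (?c t)) rs) ! j)) - 1 = ?W then \<alpha>
            (Suc t, j, u, fst (snd (full_delta M (fst (?c t)) rs) ! j))
        else \<forall>b<symbols M. \<alpha>
            (t, j, u + shift (snd (snd (full_delta M (fst (?c t)) rs) ! j)) - 1, b) \<longrightarrow> \<alpha>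
            (Suc t, j, u, b)"
      using trans[unfolded satisfies_transition_clauses, rule_format, of t "fst (?c t)" rs] IH(1)
          step(3,4) Suc.prems
      by (simp_all add: Suc_le_eq)
    have "\<alpha> (Suc t, j, u, cell M ?W (?c (Suc t)) j u)" if j: "j < tapes M" and u: "Suc t \<le> u"
        "u + Suc t \<le> 2 * ?W" for j u
    proof -
      let ?d = "shift (snd (snd (full_delta M (fst (?c t)) rs) ! j))"
      have d: "?d \<le> 2" by (simp add: shift_def)
          (cases "snd (snd (full_delta M (fst (?c t)) rs) ! j)"; simp)
      \<comment> \<open>The copying clauses exist for the symbols of \<open>M\<close> only, so the
        content of the source cell must be one of them.\<close>
      have lt: "cell M ?W (?c t) j v < symbols M" for v
        using valid_config_run[OF M(1), of t "[x, y]"] j by (simp add: valid_config_def cell_def)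
      have "\<alpha> (t, j, u + ?d - 1, cell M ?W (?c t) j (u + ?d - 1))"
        using IH(2)[OF j] u d by simp
      then show ?thesis using next_cell[of j u] step(2)[of j u] j u lt by (auto split: if_splits)
    qed
    then show ?case using next_state step(1) by (simp add: cell_def)
  qed
  from this[of T] have "\<alpha> (T, 0, ?W, cell M ?W (?c T) 0 ?W)" using M(2) by auto
  with out have "cell M ?W (?c T) 0 ?W \<noteq> 1" by metis
  moreover have "length y \<le> m" using n(2) by (simp add: y_def)
  ultimately show ?thesis using that by blast
qed

lemma tm_step_halted: "fst c = states M \<Longrightarrow> (tm_step M ^^ n) c = c"
  by (induction n) (cases c, auto simp: tm_step.simps)+

text \<open>A halted configuration no longer changes, so the output can be read at the common time
  \<open>T\<close>, under the head, which is cell \<open>W\<close>.\<close>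

lemma computes_within_output:
  assumes "computes_within M ws [b] t" "t \<le> T" "wf_tm M"
  shows "cell M W ((tm_step M ^^ T) (init_config M ws)) 0 W = bit_symbol b"
proof -
  from assms(1) obtain n q ts where n: "n \<le> t" "(tm_step M ^^ n) (init_config M ws) = (q, ts)"
      "q = states M" "tape_holds (ts ! 0) [b]"
    by (auto simp: computes_within_def)
  have "(tm_step M ^^ T) (init_config M ws)
      = (tm_step M ^^ (T - n)) ((tm_step M ^^ n) (init_config M ws))"
    using n(1) assms(2) by (simp flip: funpow_add_apply)
  also have "\<dots> = (q, ts)" using n tm_step_halted[of "(q, ts)" M] by simp
  finally show ?thesis using n(4) assms(3) by (cases "ts ! 0") (simp add: cell_def wf_tm_def)
qed

lemma NP_hard_proper_symmetric_3sat: "NP_hard proper_symmetric_3sat"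
  unfolding NP_hard_def
proof (intro allI impI)
  fix L assume "in_NP L"
  then obtain R and p :: "nat poly" where R: "polytime_rel R"
    and L: "\<And>x. x \<in> L \<longleftrightarrow> (\<exists>y. length y \<le> poly p (length x) \<and> R x y)"
    unfolding in_NP_def by blast
  from R obtain M and q :: "nat poly" where M: "wf_tm M" "tapes M \<ge> 2"
    and run: "\<And>x y. computes_within M [x, y] [R x y] (poly q (length x + length y))"
    unfolding polytime_rel_def by blast
  define m :: "nat \<Rightarrow> nat" where "m n = poly p n" for n
  \<comment> \<open>By monotonicity this bounds the running time for all certificates of length at
    most \<open>m n\<close>.\<close>
  define T :: "nat \<Rightarrow> nat" where "T n = poly q (n + m n)" for n
  define f where "f x = enc_formula (cnf_to_3sat (tableau M x (m (length x)) (T (length x))))" for x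
  have "feasible f"
    unfolding f_def m_def T_def by (intro feasible_intros feasible_tableau)
  then have "polytime_fun f" by (rule feasible_polytime_fun)
  moreover have "x \<in> L \<longleftrightarrow> f x \<in> proper_symmetric_3sat" for x
  proof -
    have out: "cell M W ((tm_step M ^^ T (length x)) (init_config M [x, y])) 0 W \<noteq> 1 \<longleftrightarrow> R x y"
      if "length y \<le> m (length x)" for y W
    proof -
      have "poly q (length x + length y) \<le> T (length x)"
        unfolding T_def using that by (intro poly_nat_mono) simp
      from computes_within_output[OF run this M(1)] show ?thesis by (simp add: bit_symbol_def)
    qed
    have "f x \<in> proper_symmetric_3sat \<longleftrightarrow> cnf_sat (tableau M x (m (length x)) (T (length x)))"
      by (simp add: f_def cnf_to_3sat_correct)
    also have "\<dots> \<longleftrightarrow> (\<exists>y. length y \<le> m (length x) \<and> R x y)"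
      using tableau_complete[OF M] tableau_sound[OF M] out by metis
    finally show ?thesis using L by (simp add: m_def)
  qed
  ultimately show "polytime_reducible L proper_symmetric_3sat"
    unfolding polytime_reducible_def by blast
qed

section \<open>Verifying satisfying assignments\<close>

text \<open>
  The verifier works with variables given by their binary digits, least significant digit first,
  because their values may be exponential in the length of the input.
\<close>

type_synonym bits_lit = "bool list lit"
type_synonym bits_clause = "bits_lit \<times> bits_lit \<times> bits_lit"

fun bits_of_literal :: "literal \<Rightarrow> bits_lit" where
  "bits_of_literal (Pos n) = (True, rev (binary n))"
| "bits_of_literal (Neg n) = (False, rev (binary n))"

fun bits_of_clause :: "clause \<Rightarrow> bits_clause" where
  "bits_of_clause (a, b, c) = (bits_of_literal a, bits_of_literal b, bits_of_literal c)"

lemma bits_of_literal_inject [simp]: "bits_of_literal l = bits_of_literal m \<longleftrightarrow> l = m"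
  by (cases l; cases m) (auto simp: binary_inject)

lemma bits_of_clause_inject: "bits_of_clause c = bits_of_clause d \<longleftrightarrow> c = d"
  by (cases c; cases d) auto

lemma flip_bits_of_literal [simp]: "flip (bits_of_literal l) = bits_of_literal (neg_lit l)"
  by (cases l) (auto simp: flip_def)

text \<open>Digits beyond the end are 0, so words of different lengths can be compared.\<close>

definition digit :: "nat \<Rightarrow> bool list \<Rightarrow> bool" where
  "digit i u = (case drop i u of [] \<Rightarrow> False | b # _ \<Rightarrow> b)"

text \<open>Digits are scanned upwards and a later difference overrules earlier ones, so the most
  significant difference decides. The sum of the lengths is a convenient bound for both.\<close>

definition bits_less :: "bool list \<Rightarrow> bool list \<Rightarrow> bool" where
  "bits_less u v = foldl (\<lambda>lt i. if digit i u = digit i v then lt else digit i v) False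
      [0..<length u + length v]"

primrec value_of :: "bool list \<Rightarrow> nat" where
  "value_of [] = 0"
| "value_of (b # u) = of_bool b + 2 * value_of u"

lemma value_of_take_Suc:
  "value_of (take (Suc k) u) = value_of (take k u) + (if digit k u then 2 ^ k else 0)"
proof (induction u arbitrary: k)
  case (Cons b u)
  then show ?case by (cases k) (auto simp: digit_def)
qed (simp add: digit_def)

lemma value_of_less: "value_of u < 2 ^ length u"
  by (induction u) auto

lemma value_of_take_less: "value_of (take k u) < 2 ^ k"
  by (rule less_le_trans[OF value_of_less power_increasing]) auto

lemma bits_less_iff: "bits_less u v \<longleftrightarrow> value_of u < value_of v"
proof -
  have "foldl (\<lambda>lt i. if digit i u = digit i v then lt else digit i v) False [0..<k]
      \<longleftrightarrow> value_of (take k u) < value_of (take k v)" for k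
  proof (induction k)
    case (Suc k)
    then show ?case
      \<comment> \<open>The lower parts are below \<open>2 ^ k\<close>, so a difference in digit
        \<open>k\<close> outweighs them.\<close>
      using value_of_take_less[of k u] value_of_take_less[of k v]
      by (simp add: value_of_take_Suc)
  qed simp
  from this[of "length u + length v"] show ?thesis by (simp add: bits_less_def)
qed

lemma binary_simps [simp]: "binary 0 = []" "binary (Suc 0) = [True]"
  by (simp_all add: binary.simps[of 0] binary.simps[of "Suc 0"])

lemma value_of_binary: "value_of (rev (binary n)) = n"
proof (induction n rule: binary.induct)
  case (1 n)
  then show ?case by (subst binary.simps) (simp add: of_bool_def)
qed

text \<open>Excludes leading zeros. Re-encoding alone would accept them, but no formula has such a
  code.\<close>

definition canonical :: "bits_lit \<Rightarrow> bool" where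
  "canonical l = (case rev (snd l) of [] \<Rightarrow> True | b # _ \<Rightarrow> b)"

lemma binary_surj: "v = [] \<or> hd v \<Longrightarrow> \<exists>n. binary n = v"
proof (induction v rule: rev_induct)
  case Nil
  show ?case by (rule exI[of _ 0]) simp
next
  case (snoc b v)
  show ?case
  proof (cases "v = []")
    case True
    with snoc.prems show ?thesis by (intro exI[of _ 1]) simp
  next
    case False
    with snoc obtain n where n: "binary n = v" by auto
    with False have "n \<noteq> 0" by (cases n) auto
    with n show ?thesis by (intro exI[of _ "2 * n + of_bool b"])
        (simp add: binary.simps[of "2 * n + of_bool b"])
  qed
qed

lemma canonical_iff: "canonical l \<longleftrightarrow> l \<in> range bits_of_literal"
proof
  assume "canonical l"
  then have "rev (snd l) = [] \<or> hd (rev (snd l))" by (auto simp: canonical_def split: list.splits)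
  then obtain n where n: "binary n = rev (snd l)" using binary_surj by blast
  then have "l = bits_of_literal (if fst l then Pos n else Neg n)" by (cases l) auto
  then show "l \<in> range bits_of_literal" by blast
next
  have hd: "binary n \<noteq> [] \<Longrightarrow> hd (binary n)" for n
  proof (induction n rule: binary.induct)
    case (1 n)
    show ?case
    proof (cases "n = 1")
      case True
      then show ?thesis by simp
    next
      case False
      have n: "n \<noteq> 0" using 1(2) by (cases n) auto
      with False have "binary (n div 2) \<noteq> []" by (subst binary.simps) auto
      with 1(1) n show ?thesis by (subst binary.simps) auto
    qed
  qed
  assume "l \<in> range bits_of_literal"
  then obtain m where "l = bits_of_literal m" by auto
  then have "rev (snd l) = binary (var m)" by (cases m) auto
  with hd[of "var m"] show "canonical l" by (auto simp: canonical_def split: list.splits)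
qed

text \<open>
  The mode is 0 before a literal, 1 before a digit or the end of the literal, and 2 at a digit.
\<close>

definition parse_step :: "nat \<times> bool \<times> bool list \<times> bits_lit list \<Rightarrow> bool \<Rightarrow> nat \<times> bool \<times> bool list \<times>
    bits_lit list" where
  "parse_step s b = (if fst s = 0 then (1, b, [], snd (snd (snd s)))
     else if fst s = 1 then (if b then (2, snd s)
       else (0, False, [], (fst (snd s), fst (snd (snd s))) # snd (snd (snd s))))
     else (1, fst (snd s), b # fst (snd (snd s)), snd (snd (snd s))))"

definition parse_literals :: "bool list \<Rightarrow> bits_lit list" where
  "parse_literals w = rev (snd (snd (snd (foldl parse_step (0, False, [], []) w))))"

definition group_step :: "bits_lit list \<times> bits_clause list \<Rightarrow> bits_lit \<Rightarrow> bits_lit list \<times>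
    bits_clause list" where
  "group_step s l = (case fst s of [] \<Rightarrow> ([l], snd s) | a # as \<Rightarrow>
     (case as of [] \<Rightarrow> ([a, l], snd s) | b # _ \<Rightarrow> ([], (a, b, l) # snd s)))"

definition group_literals :: "bits_lit list \<Rightarrow> bits_clause list" where
  "group_literals ls = rev (snd (foldl group_step ([], []) ls))"

definition enc_bits_lit :: "bits_lit \<Rightarrow> bool list" where
  "enc_bits_lit l = fst l # concat (map (\<lambda>b. [True, b]) (rev (snd l))) @ [False]"

definition enc_bits_formula :: "bits_clause list \<Rightarrow> bool list" where
  "enc_bits_formula F = concat
      (map (\<lambda>c. enc_bits_lit (fst c) @ enc_bits_lit (fst (snd c)) @ enc_bits_lit (snd (snd c))) F)"

lemma enc_bits_lit: "enc_bits_lit (bits_of_literal l) = enc_literal l"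
  by (cases l) (auto simp: enc_bits_lit_def enc_nat_def)

lemma enc_bits_formula: "enc_bits_formula (map bits_of_clause \<phi>) = enc_formula \<phi>"
  unfolding enc_bits_formula_def enc_formula_def map_map
  by (rule arg_cong[where f = concat], rule map_cong[OF refl]) (auto simp: enc_bits_lit)

lemma parse_literals: "parse_literals (concat (map enc_bits_lit ls)) = ls"
proof -
  have digits: "foldl parse_step (1, s, u, ds) (concat (map (\<lambda>b. [True, b]) v) @ False # w) =
      foldl parse_step (0, False, [], (s, rev v @ u) # ds) w" for s u v ds w
    by (induction v arbitrary: u) (auto simp: parse_step_def)
  have "foldl parse_step (0, False, [], ds) (enc_bits_lit l @ w)
      = foldl parse_step (0, False, [], l # ds) w" for l ds w
    using digits[of "fst l" "[]" ds "rev (snd l)" w] by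
        (simp add: enc_bits_lit_def parse_step_def[of "(0, _)"])
  then have "foldl parse_step (0, False, [], ds) (concat (map enc_bits_lit ls))
      = (0, False, [], rev ls @ ds)" for ds
    by (induction ls arbitrary: ds) auto
  then show ?thesis by (simp add: parse_literals_def)
qed

text \<open>Malformed words are not rejected here but give some result; \<open>verify\<close>
  detects them by encoding the result again.\<close>

definition parse :: "bool list \<Rightarrow> bits_clause list" where
  "parse x = group_literals (parse_literals x)"

lemma parse_enc_bits_formula: "parse (enc_bits_formula F) = F"
proof -
  have "enc_bits_formula F = concat (map enc_bits_lit (concat (map (\<lambda>(a, b, c). [a, b, c]) F)))"
    by (induction F) (auto simp: enc_bits_formula_def)
  moreover have "foldl group_step ([], ds) (concat (map (\<lambda>(a, b, c). [a, b, c]) F))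
      = ([], rev F @ ds)" for ds
    by (induction F arbitrary: ds) (auto simp: group_step_def)
  ultimately show ?thesis by (simp add: parse_def parse_literals group_literals_def)
qed

section \<open>The verifier\<close>

definition lit_less :: "bits_lit \<Rightarrow> bits_lit \<Rightarrow> bool" where
  "lit_less l m \<longleftrightarrow> bits_less (snd l) (snd m) \<or> snd l = snd m \<and> fst l \<and> \<not> fst m"

definition clause_less :: "bits_clause \<Rightarrow> bits_clause \<Rightarrow> bool" where
  "clause_less c d \<longleftrightarrow> lit_less (fst c) (fst d) \<or> fst c = fst d \<and>
      (lit_less (fst (snd c)) (fst (snd d)) \<or>
     fst (snd c) = fst (snd d) \<and> lit_less (snd (snd c)) (snd (snd d)))"

definition clause_ok :: "bits_clause list \<Rightarrow> bits_lit list \<Rightarrow> bits_clause \<Rightarrow> bool" where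
  "clause_ok F A c \<longleftrightarrow> canonical (fst c) \<and> canonical (fst (snd c)) \<and> canonical (snd (snd c)) \<and>
     bits_less (snd (fst c)) (snd (fst (snd c))) \<and> bits_less (snd (fst (snd c)))
         (snd (snd (snd c))) \<and>
     (flip (fst c), flip (fst (snd c)), flip (snd (snd c))) \<in> set F \<and>
     (fst c \<in> set A \<or> fst (snd c) \<in> set A \<or> snd (snd c) \<in> set A)"

text \<open>The certificate is a list of literals, read as a partial assignment: free of
  complementary pairs and meeting every clause. One literal per clause is enough, whatever the size
  of the indices.\<close>

definition verify :: "bool list \<Rightarrow> bool list \<Rightarrow> bool" where
  "verify x y \<longleftrightarrow> enc_bits_formula (parse x) = x \<and> sorted_wrt clause_less (parse x) \<and>
     (\<forall>c\<in>set (parse x). clause_ok (parse x) (parse_literals y) c) \<and>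
     (\<forall>l\<in>set (parse_literals y). flip l \<notin> set (parse_literals y))"

lemma feasible_parse_literals [feasible_intros]:
  assumes "feasible w"
  shows "feasible (\<lambda>x. parse_literals (w x))"
proof -
  have growth: "tsize (parse_step s b) \<le> tsize s + 20" for s b
  proof -
    obtain m g d ds where s: "s = (m, g, d, ds)" by (cases s) auto
    have "tsize False = 1" by (simp add: tsize_def tr_bool_def)
    then show ?thesis using tsize_bool[of b] by (auto simp: s parse_step_def)
  qed
  show ?thesis unfolding parse_literals_def
    apply (intro feasible_intros feasible_foldl_const[where k = 20])
       apply (unfold parse_step_def)[1]
       apply (intro feasible_intros)
      apply (rule growth)
     apply (intro feasible_intros assms)+
    done
qed

lemma feasible_parse [feasible_intros]:
  assumes "feasible w"
  shows "feasible (\<lambda>x. parse (w x))"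
proof -
  have growth: "tsize (group_step s l) \<le> tsize s + poly [:10, 1:] (tsize x + tsize l)" for s l
      and x :: 'a
    by (auto simp: group_step_def tsize_fst[of s] split: list.splits)
  show ?thesis unfolding parse_def group_literals_def
    apply (intro feasible_intros feasible_foldl)
       apply (unfold group_step_def)[1]
       apply (intro feasible_intros)
      apply (use growth in blast)
     apply (intro feasible_intros assms)+
    done
qed

lemma feasible_bits_less [feasible_intros]:
  assumes "feasible u" "feasible v"
  shows "feasible (\<lambda>x. bits_less (u x) (v x))"
proof -
  have "feasible (\<lambda>p. bits_less (fst p) (snd p))"
    unfolding bits_less_def digit_def
    apply (rule feasible_foldl_const[where k = 3])
       apply (intro feasible_intros)
      apply (rule order_trans[OF tsize_bool]; simp)
     apply (intro feasible_intros)+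
    done
  from feasible_comp2[OF this assms] show ?thesis .
qed

lemma feasible_verify: "feasible (\<lambda>p. [verify (fst p) (snd p)])"
  unfolding verify_def clause_ok_def clause_less_def lit_less_def canonical_def
      enc_bits_formula_def enc_bits_lit_def
  by (intro feasible_intros)

lemma bits_less_var: "bits_less (snd (bits_of_literal l)) (snd (bits_of_literal m)) \<longleftrightarrow> var l < var m"
  by (cases l; cases m) (auto simp: bits_less_iff value_of_binary)

lemma lit_less_iff: "lit_less (bits_of_literal l) (bits_of_literal m) \<longleftrightarrow> l < m"
  by (cases l; cases m) (auto simp: lit_less_def bits_less_iff value_of_binary less_literal_def
      binary_inject)

lemma clause_less_iff: "clause_less (bits_of_clause c) (bits_of_clause d) \<longleftrightarrow> clause_le c d \<and> c \<noteq> d"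
  by (cases c; cases d) (auto simp: clause_less_def lit_less_iff)

lemma le_literal_var: "var a \<noteq> var b \<Longrightarrow> a \<le> b \<longleftrightarrow> var a < var b"
  by (cases a; cases b) (auto simp: less_eq_literal_def)

text \<open>For distinct variables the order of literals is that of their variables, so increasing
  variables cover both conditions on a clause. Distinct clauses occur once, so symmetry reduces to
  membership.\<close>

lemma proper_symmetric_iff:
  "proper \<phi> \<and> symmetric \<phi> \<longleftrightarrow> sorted_wrt (\<lambda>c d. clause_le c d \<and> c \<noteq> d) \<phi> \<and>
     (\<forall>c\<in>set \<phi>. mirror c \<in> set \<phi> \<and> (case c of (a, b, c) \<Rightarrow> var a < var b \<and> var b < var c))"
proof -
  have sorted: "sorted_wrt clause_le \<phi> \<and> distinct \<phi> \<longleftrightarrow> sorted_wrt (\<lambda>c d. clause_le c d \<and> c \<noteq> d) \<phi>"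
    by (induction \<phi>) auto
  have vars: "a \<le> b \<and> b \<le> c \<and> var a \<noteq> var b \<and> var a \<noteq> var c \<and> var b \<noteq> var c \<longleftrightarrow> var a < var b \<and>
      var b < var c" for a b c
    using le_literal_var[of a b] le_literal_var[of b c] by auto
  have count: "count_list \<phi> c = (if c \<in> set \<phi> then 1 else 0)" if "distinct \<phi>" for c
    using that by (induction \<phi>) auto
  have "proper \<phi> \<longleftrightarrow> sorted_wrt (\<lambda>c d. clause_le c d \<and> c \<noteq> d) \<phi> \<and>
      (\<forall>c\<in>set \<phi>. case c of (a, b, c) \<Rightarrow> var a < var b \<and> var b < var c)"
    unfolding proper_def reduced_def sorted[symmetric] vars[symmetric] by auto
  then show ?thesis using count unfolding symmetric_def sorted[symmetric] by auto
qed

lemma verify_enc_formula: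
  "verify (enc_formula \<phi>) y \<longleftrightarrow> proper \<phi> \<and> symmetric \<phi> \<and>
     (\<forall>(a, b, c)\<in>set \<phi>. \<exists>l\<in>{a, b, c}. bits_of_literal l \<in> set (parse_literals y)) \<and>
     (\<forall>l\<in>set (parse_literals y). flip l \<notin> set (parse_literals y))"
proof -
  have parse: "parse (enc_formula \<phi>) = map bits_of_clause \<phi>"
    by (simp add: parse_enc_bits_formula flip: enc_bits_formula)
  have "clause_ok (map bits_of_clause \<phi>) A (bits_of_clause c) \<longleftrightarrow>
     (mirror c \<in> set \<phi> \<and> (case c of (a, b, c) \<Rightarrow> var a < var b \<and> var b < var c)) \<and>
     (case c of (a, b, c) \<Rightarrow> \<exists>l\<in>{a, b, c}. bits_of_literal l \<in> set A)" for c A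
    using bits_of_clause_inject[of "mirror c"]
    by (cases c) (auto simp: clause_ok_def canonical_iff bits_less_var)
  then show ?thesis
    unfolding verify_def parse sorted_wrt_map clause_less_iff proper_symmetric_iff
        conj_assoc[symmetric]
    by (simp add: enc_bits_formula ball_conj_distrib)
qed

lemma verify_imp_enc_formula:
  assumes "verify x y"
  obtains \<phi> where "x = enc_formula \<phi>"
proof -
  have "\<exists>d. c = bits_of_clause d" if "c \<in> set (parse x)" for c
  proof -
    from assms that have "fst c \<in> range bits_of_literal" "fst (snd c) \<in> range bits_of_literal"
        "snd (snd c) \<in> range bits_of_literal"
      by (auto simp: verify_def clause_ok_def canonical_iff)
    then obtain k l m where "fst c = bits_of_literal k" "fst (snd c) = bits_of_literal l"
        "snd (snd c) = bits_of_literal m"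
      by blast
    then show ?thesis by (intro exI[of _ "(k, l, m)"]) (simp add: prod_eq_iff)
  qed
  then have "parse x \<in> lists (range bits_of_clause)" by blast
  then obtain \<phi> where "parse x = map bits_of_clause \<phi>" by (auto simp: lists_image)
  then have "x = enc_formula \<phi>" using assms by (simp add: verify_def flip: enc_bits_formula)
  then show ?thesis by (rule that)
qed

lemma verify_correct: "x \<in> proper_symmetric_3sat \<longleftrightarrow> (\<exists>y. length y \<le> length x \<and> verify x y)"
proof
  assume "x \<in> proper_symmetric_3sat"
  then obtain \<phi> \<alpha> where \<phi>: "x = enc_formula \<phi>" "proper \<phi>" "symmetric \<phi>"
      "\<And>c. c \<in> set \<phi> \<Longrightarrow> clause_true \<alpha> c"
    by (auto simp: proper_symmetric_3sat_def satisfiable_def)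
  have "\<exists>l. lit_true \<alpha> l \<and> (case c of (k, k', k'') \<Rightarrow> l \<in> {k, k', k''})" if "c \<in> set \<phi>" for c
    using \<phi>(4)[OF that] by (cases c) auto
  then obtain f where f: "\<And>c. c \<in> set \<phi> \<Longrightarrow> lit_true \<alpha> (f c) \<and>
      (case c of (k, k', k'') \<Rightarrow> f c \<in> {k, k', k''})"
    by metis
  \<comment> \<open>One true literal per clause; its code is part of the code of the clause, whence
    the bound on the length.\<close>
  define y where "y = concat (map (\<lambda>c. enc_literal (f c)) \<phi>)"
  have "length (enc_literal (f c)) \<le> length (enc_clause c)" if "c \<in> set \<phi>" for c
    using f[OF that] by (cases c) auto
  then have len: "length y \<le> length x"
    unfolding y_def \<phi>(1) enc_formula_def by
        (auto simp: length_concat comp_def intro!: sum_list_mono)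
  have y: "parse_literals y = map (\<lambda>c. bits_of_literal (f c)) \<phi>"
    using parse_literals[of "map (\<lambda>c. bits_of_literal (f c)) \<phi>"] by
        (simp add: y_def comp_def enc_bits_lit)
  have "\<exists>l\<in>{a, b, c}. bits_of_literal l \<in> set (parse_literals y)" if "(a, b, c) \<in> set \<phi>" for a b c
  proof (rule bexI)
    show "f (a, b, c) \<in> {a, b, c}" using f[OF that] by simp
    show "bits_of_literal (f (a, b, c)) \<in> set (parse_literals y)" using that by (simp add: y)
  qed
  moreover have "flip l \<notin> set (parse_literals y)" if l: "l \<in> set (parse_literals y)" for l
  proof
    assume "flip l \<in> set (parse_literals y)"
    with l obtain c d where cd: "c \<in> set \<phi>" "d \<in> set \<phi>" "neg_lit (f c) = f d"
      by (auto simp: y)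
    have "lit_true \<alpha> (neg_lit (f c)) \<longleftrightarrow> \<not> lit_true \<alpha> (f c)" by (cases "f c") auto
    with f[OF cd(1)] f[OF cd(2)] cd(3) show False by simp
  qed
  ultimately have "verify x y"
    unfolding \<phi>(1) verify_enc_formula using \<phi>(2,3) by blast
  with len show "\<exists>y. length y \<le> length x \<and> verify x y" by blast
next
  assume "\<exists>y. length y \<le> length x \<and> verify x y"
  then obtain y where y: "verify x y" by blast
  then obtain \<phi> where x: "x = enc_formula \<phi>" by (rule verify_imp_enc_formula)
  let ?A = "set (parse_literals y)"
  \<comment> \<open>Variables that do not occur in the certificate become false; negative literals
    are true because the certificate has no complementary pair.\<close>
  define \<alpha> where "\<alpha> n = (bits_of_literal (Pos n) \<in> ?A)" for n
  have \<phi>: "proper \<phi>" "symmetric \<phi>"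
      "\<And>a b c. (a, b, c) \<in> set \<phi> \<Longrightarrow> \<exists>l\<in>{a, b, c}. bits_of_literal l \<in> ?A"
    and cons: "\<And>l. l \<in> ?A \<Longrightarrow> flip l \<notin> ?A"
    using y unfolding x verify_enc_formula by auto
  have "lit_true \<alpha> l" if "bits_of_literal l \<in> ?A" for l
    using that cons[OF that] by (cases l) (auto simp: \<alpha>_def flip_def)
  then have "clause_true \<alpha> c" if "c \<in> set \<phi>" for c
    using \<phi>(3) that by (cases c) fastforce
  then show "x \<in> proper_symmetric_3sat"
    unfolding x proper_symmetric_3sat_def satisfiable_def using \<phi>(1,2) by blast
qed

lemma in_NP_proper_symmetric_3sat: "in_NP proper_symmetric_3sat"
  unfolding in_NP_def
  using feasible_polytime_rel[OF feasible_verify] verify_correct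
  by (intro exI[of _ verify] exI[of _ "[:0, 1:]"]) simp

theorem theorem2p2p3:
  shows "NP_hard proper_symmetric_3sat \<and> NP_complete proper_symmetric_3sat"
  using NP_hard_proper_symmetric_3sat in_NP_proper_symmetric_3sat by (simp add: NP_complete_def)

end
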